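(* Suppose that the following three conditions hold. (i) There is a continuous-time $S$-valued Markov chain $\boldsymbol X(t)$, whose law when started from $x\in S$ is denoted by $\boldsymbol P_x$, such that for all $x\in S$ and all sequences $\eta^N\in\mathcal E^x_N$, under $\mathbb P_{\eta^N}$ the process $X^T_N(t)$ converges in the Skorohod topology to the chain $\boldsymbol X(t)$ started from $x$. (ii) For all $t>0$, $$\lim_{N\to\infty}\max_{\eta\in\mathcal E_N}\mathbb E_\eta\Big[\int_0^t \mathbf 1\{\xi^N(s)\in\Delta_N\}\,ds\Big]=0.$$ (iii) For all $x\in S$, $$\lim_{\delta\to0}\limsup_{N\to\infty}\max_{\eta\in\mathcal E^x_N}\ \sup_{2\delta\le s\le3\delta}\mathbb P_\eta[\xi^N(s)\in\Delta_N]=0.$$ Then, for all $x\in S$ and all sequences $\{\eta^N:N\ge1\}$ with $\eta^N\in\mathcal E^x_N$, under $\mathbb P_{\eta^N}$ the finite-dimensional distributions of $X_N(t)$ converge, as $N\to\infty$, to the finite-dimensional distributions of the chain $\boldsymbol X(t)$ (started from $x$).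
   Context: For each $N\ge1$, $E_N$ is a finite set, with cardinality tending to infinity with $N$, and $\{\eta^N(t):t\ge0\}$ is a continuous-time, irreducible, $E_N$-valued Markov chain. Fix $\mathfrak n\ge2$ and let $S=\{1,\dots,\mathfrak n\}$. The set $E_N$ is partitioned as $E_N=\mathcal E_N\sqcup\Delta_N$ with $\mathcal E_N=\mathcal E^1_N\sqcup\cdots\sqcup\mathcal E^{\mathfrak n}_N$ (the sets $\mathcal E^x_N$ are called wells). Let $(\theta_N)$ be a sequence of positive numbers (the time-scale) and $\xi^N(t)=\eta^N(t\theta_N)$. $\mathbb P_\eta$ is the law of $\xi^N(\cdot)$ on the path space $D(\mathbb R_+,E_N)$ when $\xi^N(0)=\eta$, and $\mathbb E_\eta$ is the corresponding expectation. Let $\Phi_N:E_N\to\{0\}\cup S$ be given by $\Phi_N(\eta)=x$ if $\eta\in\mathcal E^x_N$ and $\Phi_N(\eta)=0$ if $\eta\in\Delta_N$; let $\Psi_N:\mathcal E_N\to S$ be the restriction of $\Phi_N$ to $\mathcal E_N$. Put $X_N(t)=\Phi_N(\xi^N(t))$. Trace process: for $\mathcal A\subset E_N$ let $T_{\mathcal A}(t)=\int_0^t\mathbf 1\{\xi^N(s)\in\mathcal A\}\,ds$, $S_{\mathcal A}(t)=\sup\{s\ge0:T_{\mathcal A}(s)\le t\}$; the trace of $\xi^N$ on $\mathcal A$ is $\xi^{\mathcal A}(t)=\xi^N(S_{\mathcal A}(t))$. Put $X^T_N(t)=\Psi_N(\xi^{\mathcal E_N}(t))$. *)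

theory Defs
  imports "HOL-Probability.Probability"
begin

text \<open>State spaces are discrete. Paths are functions on \<open>[0, \<infinity>)\<close>, encoded as
  elements of \<open>{0..} \<rightarrow>\<^sub>E K\<close>. A path in a discrete space is right-continuous at \<open>t\<close> iff it is
  eventually equal to its value at \<open>t\<close>, and it has a left limit at \<open>t\<close> iff it is eventually
  constant to the left of \<open>t\<close>.\<close>

definition cadlag_paths :: "'a set \<Rightarrow> (real \<Rightarrow> 'a) set" where
  "cadlag_paths K = {\<omega> \<in> {0..} \<rightarrow>\<^sub>E K.
     (\<forall>t\<ge>0. \<forall>\<^sub>F s in at_right t. \<omega> s = \<omega> t) \<and>
     (\<forall>t>0. \<exists>a. \<forall>\<^sub>F s in at_left t. \<omega> s = a)}"

definition path_space :: "'a set \<Rightarrow> (real \<Rightarrow> 'a) measure" where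
  "path_space K = restrict_space (\<Pi>\<^sub>M t\<in>{0..}. count_space K) (cadlag_paths K)"

text \<open>A time-homogeneous continuous-time Markov chain on \<open>K\<close>, given by the laws \<open>P x\<close> of its
  paths started from \<open>x\<close>. The last clause is the Markov property at time \<open>s\<close>, stated for the
  values \<open>a\<close> of the chain at finitely many earlier times.\<close>

definition markov_chain :: "'a set \<Rightarrow> ('a \<Rightarrow> (real \<Rightarrow> 'a) measure) \<Rightarrow> bool" where
  "markov_chain K P \<longleftrightarrow> (\<forall>x\<in>K.
     prob_space (P x) \<and> sets (P x) = sets (path_space K) \<and>
     measure (P x) {\<omega> \<in> space (P x). \<omega> 0 = x} = 1 \<and>
     (\<forall>s\<ge>0. \<forall>t\<ge>0. \<forall>I a. \<forall>y\<in>K. \<forall>z\<in>K. finite I \<and> I \<subseteq> {0..s} \<longrightarrow>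
        measure (P x) {\<omega> \<in> space (P x). (\<forall>r\<in>I. \<omega> r = a r) \<and> \<omega> s = y \<and> \<omega> (s + t) = z} =
        measure (P x) {\<omega> \<in> space (P x). (\<forall>r\<in>I. \<omega> r = a r) \<and> \<omega> s = y} *
        measure (P y) {\<omega> \<in> space (P y). \<omega> t = z}))"

definition irreducible_chain :: "'a set \<Rightarrow> ('a \<Rightarrow> (real \<Rightarrow> 'a) measure) \<Rightarrow> bool" where
  "irreducible_chain K P \<longleftrightarrow>
     (\<forall>x\<in>K. \<forall>y\<in>K. \<exists>t>0. measure (P x) {\<omega> \<in> space (P x). \<omega> t = y} > 0)"

definition time_change :: "real \<Rightarrow> (real \<Rightarrow> 'a) \<Rightarrow> real \<Rightarrow> 'a" where
  "time_change c \<omega> = (\<lambda>t\<in>{0..}. \<omega> (t * c))"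

definition accelerated_law :: "'a set \<Rightarrow> real \<Rightarrow> (real \<Rightarrow> 'a) measure \<Rightarrow> (real \<Rightarrow> 'a) measure" where
  "accelerated_law K c M = distr M (path_space K) (time_change c)"


subsection \<open>Trace process and projection on the wells\<close>

definition occupation_time :: "'a set \<Rightarrow> (real \<Rightarrow> 'a) \<Rightarrow> real \<Rightarrow> real" where
  "occupation_time A \<omega> t = (LINT s:{0..t}|lborel. indicator A (\<omega> s))"

definition inverse_occupation_time :: "'a set \<Rightarrow> (real \<Rightarrow> 'a) \<Rightarrow> real \<Rightarrow> real" where
  "inverse_occupation_time A \<omega> t = Sup {s. 0 \<le> s \<and> occupation_time A \<omega> s \<le> t}"

text \<open>If the total time spent in \<open>A\<close> is finite, the supremum above is infinite for large \<open>t\<close> and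
  the trace is not defined. For an irreducible chain on a finite set and nonempty \<open>A\<close> such paths
  form a null set; there the trace is set to an arbitrary constant path in \<open>A\<close>, so that the trace
  is a path in \<open>A\<close> for every \<open>\<omega>\<close>.\<close>

definition trace_path :: "'a set \<Rightarrow> (real \<Rightarrow> 'a) \<Rightarrow> real \<Rightarrow> 'a" where
  "trace_path A \<omega> = (\<lambda>t\<in>{0..}.
     if \<forall>u. \<exists>s\<ge>0. u < occupation_time A \<omega> s then \<omega> (inverse_occupation_time A \<omega> t)
     else (SOME a. a \<in> A))"

definition well_index :: "nat \<Rightarrow> (nat \<Rightarrow> 'a set) \<Rightarrow> 'a \<Rightarrow> nat" where
  "well_index n W \<eta> =
     (if \<exists>x\<in>{1..n}. \<eta> \<in> W x then THE x. x \<in> {1..n} \<and> \<eta> \<in> W x else 0)"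

definition wells :: "nat \<Rightarrow> (nat \<Rightarrow> 'a set) \<Rightarrow> 'a set" where
  "wells n W = (\<Union>x\<in>{1..n}. W x)"

definition order_process_law :: "nat \<Rightarrow> (nat \<Rightarrow> 'a set) \<Rightarrow> (real \<Rightarrow> 'a) measure \<Rightarrow> (real \<Rightarrow> nat) measure"
  where
  "order_process_law n W M =
     distr M (path_space {0..n}) (\<lambda>\<omega>. \<lambda>t\<in>{0..}. well_index n W (\<omega> t))"

definition trace_process_law :: "nat \<Rightarrow> (nat \<Rightarrow> 'a set) \<Rightarrow> (real \<Rightarrow> 'a) measure \<Rightarrow> (real \<Rightarrow> nat) measure"
  where
  "trace_process_law n W M =
     distr M (path_space {1..n}) (\<lambda>\<omega>. \<lambda>t\<in>{0..}. well_index n W (trace_path (wells n W) \<omega> t))"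


subsection \<open>Skorohod topology and weak convergence\<close>

text \<open>The basic neighbourhoods of the Skorohod (J1) topology on paths over \<open>[0, \<infinity>)\<close>: up to time
  \<open>T\<close>, the paths agree after a time deformation that moves times by less than \<open>e\<close>. The values
  have to agree exactly because the state space is discrete. Increasing bijections of
  \<open>[0, \<infinity>)\<close> are automatically continuous and fix \<open>0\<close>.\<close>

definition skorohod_nbhd :: "'a set \<Rightarrow> (real \<Rightarrow> 'a) \<Rightarrow> real \<Rightarrow> real \<Rightarrow> (real \<Rightarrow> 'a) set" where
  "skorohod_nbhd K \<omega> T e = {\<omega>' \<in> cadlag_paths K. \<exists>l :: real \<Rightarrow> real.
     strict_mono_on {0..} l \<and> l ` {0..} = {0..} \<and> (\<forall>t\<ge>0. \<bar>l t - t\<bar> < e) \<and>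
     (\<forall>t\<in>{0..T}. \<omega>' (l t) = \<omega> t)}"

definition skorohod_topology :: "'a set \<Rightarrow> (real \<Rightarrow> 'a) topology" where
  "skorohod_topology K = topology (\<lambda>U. U \<subseteq> cadlag_paths K \<and>
     (\<forall>\<omega>\<in>U. \<exists>T>0. \<exists>e>0. skorohod_nbhd K \<omega> T e \<subseteq> U))"

lemma skorohod_nbhd_mono:
  assumes "T' \<le> T" "e \<le> e'"
  shows "skorohod_nbhd K \<omega> T e \<subseteq> skorohod_nbhd K \<omega> T' e'"
proof
  fix \<omega>' assume "\<omega>' \<in> skorohod_nbhd K \<omega> T e"
  then obtain l where l: "\<omega>' \<in> cadlag_paths K" "strict_mono_on {0..} l" "l ` {0..} = {0..}"
      "\<forall>t\<ge>0. \<bar>l t - t\<bar> < e" "\<forall>t\<in>{0..T}. \<omega>' (l t) = \<omega> t"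
    unfolding skorohod_nbhd_def by blast
  have "\<forall>t\<ge>0. \<bar>l t - t\<bar> < e'" "\<forall>t\<in>{0..T'}. \<omega>' (l t) = \<omega> t"
    using l(4,5) assms by (auto intro: less_le_trans)
  with l(1-3) show "\<omega>' \<in> skorohod_nbhd K \<omega> T' e'"
    unfolding skorohod_nbhd_def by blast
qed

lemma openin_skorohod:
  "openin (skorohod_topology K) U \<longleftrightarrow> U \<subseteq> cadlag_paths K \<and>
     (\<forall>\<omega>\<in>U. \<exists>T>0. \<exists>e>0. skorohod_nbhd K \<omega> T e \<subseteq> U)"
proof -
  let ?P = "\<lambda>U \<omega>. \<exists>T>0. \<exists>e>0. skorohod_nbhd K \<omega> T e \<subseteq> U"
  have inter: "?P (U \<inter> V) \<omega>" if U: "?P U \<omega>" and V: "?P V \<omega>" for U V \<omega>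
  proof -
    obtain T e where 1: "T > 0" "e > 0" "skorohod_nbhd K \<omega> T e \<subseteq> U"
      using U by blast
    obtain T' e' where 2: "T' > 0" "e' > 0" "skorohod_nbhd K \<omega> T' e' \<subseteq> V"
      using V by blast
    have "skorohod_nbhd K \<omega> (max T T') (min e e') \<subseteq> U \<inter> V"
      using 1(3) 2(3) skorohod_nbhd_mono[of T "max T T'" "min e e'" e K \<omega>]
        skorohod_nbhd_mono[of T' "max T T'" "min e e'" e' K \<omega>]
      by simp (meson subset_trans)
    moreover have "max T T' > 0" "min e e' > 0"
      using 1 2 by auto
    ultimately show ?thesis
      by blast
  qed
  have union: "?P (\<Union>\<U>) \<omega>" if "U \<in> \<U>" "?P U \<omega>" for U \<U> \<omega>
    using that by (meson Union_upper subset_trans)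
  have "istopology (\<lambda>U. U \<subseteq> cadlag_paths K \<and> (\<forall>\<omega>\<in>U. ?P U \<omega>))"
    unfolding istopology_def
  proof (rule conjI)
    show "\<forall>U V. U \<subseteq> cadlag_paths K \<and> (\<forall>\<omega>\<in>U. ?P U \<omega>) \<longrightarrow>
        V \<subseteq> cadlag_paths K \<and> (\<forall>\<omega>\<in>V. ?P V \<omega>) \<longrightarrow>
        U \<inter> V \<subseteq> cadlag_paths K \<and> (\<forall>\<omega>\<in>U \<inter> V. ?P (U \<inter> V) \<omega>)"
      using inter by (metis (no_types, lifting) IntD1 IntD2 le_infI1)
    show "\<forall>\<U>. (\<forall>U\<in>\<U>. U \<subseteq> cadlag_paths K \<and> (\<forall>\<omega>\<in>U. ?P U \<omega>)) \<longrightarrow>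
        \<Union>\<U> \<subseteq> cadlag_paths K \<and> (\<forall>\<omega>\<in>\<Union>\<U>. ?P (\<Union>\<U>) \<omega>)"
      using union by (metis (no_types, lifting) Sup_least UnionE)
  qed
  then show ?thesis
    unfolding skorohod_topology_def by (simp add: topology_inverse')
qed

lemma topspace_skorohod: "topspace (skorohod_topology K) = cadlag_paths K"
proof -
  have "openin (skorohod_topology K) (cadlag_paths K)"
    unfolding openin_skorohod skorohod_nbhd_def using zero_less_one by blast
  moreover have "U \<subseteq> cadlag_paths K" if "openin (skorohod_topology K) U" for U
    using that by (simp add: openin_skorohod)
  ultimately show ?thesis
    by (metis openin_subset openin_topspace subset_antisym)
qed

text \<open>The measures are understood to live on the Borel sets of the topology. For finite \<open>K\<close>, the
  Borel sets of \<^term>\<open>skorohod_topology K\<close> are the measurable sets of \<^term>\<open>path_space K\<close>.\<close>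

definition weak_conv_in :: "'a topology \<Rightarrow> (nat \<Rightarrow> 'a measure) \<Rightarrow> 'a measure \<Rightarrow> bool" where
  "weak_conv_in T M M' \<longleftrightarrow>
     (\<forall>f. continuous_map T euclideanreal f \<and> (\<exists>B. \<forall>x\<in>topspace T. \<bar>f x\<bar> \<le> B) \<longrightarrow>
        (\<lambda>N. integral\<^sup>L (M N) f) \<longlonglongrightarrow> integral\<^sup>L M' f)"

definition fin_dim_distr :: "'a set \<Rightarrow> real set \<Rightarrow> (real \<Rightarrow> 'a) measure \<Rightarrow> (real \<Rightarrow> 'a) measure" where
  "fin_dim_distr K I M = distr M (\<Pi>\<^sub>M t\<in>I. count_space K) (\<lambda>\<omega>. restrict \<omega> I)"

definition fdd_conv :: "'a set \<Rightarrow> (nat \<Rightarrow> (real \<Rightarrow> 'a) measure) \<Rightarrow> (real \<Rightarrow> 'a) measure \<Rightarrow> bool" where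
  "fdd_conv K M M' \<longleftrightarrow> (\<forall>I. finite I \<and> I \<subseteq> {0..} \<longrightarrow>
     weak_conv_in (product_topology (\<lambda>_. discrete_topology K) I)
       (\<lambda>N. fin_dim_distr K I (M N)) (fin_dim_distr K I M'))"

end

theory Submission
  imports Defs
begin

text \<open>The fraction of time that a path spends in a state during \<open>[t, t + d]\<close> is a continuous function
  of the path in the Skorohod topology, and so is a product of such fractions over \<open>t \<in> I\<close>. Its
  expectation therefore converges along the trace processes. Since the trace process only cuts out
  the excursions to \<open>\<Delta>\<close>, the occupation times of the trace and of the order process up to \<open>t\<close> differ by
  at most the time spent in \<open>\<Delta>\<close>, which vanishes by (ii). Hence the time-averaged finite-dimensional
  distributions of the order process converge.

  It remains to remove the average. By the Markov property, the error made in replacing the value at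
  \<open>t\<close> by the average over \<open>[t, t + d]\<close> is at most the probability of being in \<open>\<Delta>\<close> at time \<open>t\<close> plus the
  largest expected fraction of \<open>[0, d]\<close> that the process, started in a well, spends outside of this
  well. The latter is again a time average: it converges as \<open>N \<rightarrow> \<infinity>\<close> to the same quantity for the
  limit chain, and this vanishes as \<open>d \<rightarrow> 0\<close>. The former vanishes by (ii) and (iii), because for most
  \<open>r \<in> [2d, 3d]\<close> the process is in a well at time \<open>t - r\<close>.\<close>


subsection \<open>Paths\<close>

text \<open>Evaluation at a fixed time is not continuous in the Skorohod topology, because a nearby
  path may jump slightly earlier or later; averages over a time window are insensitive to such
  shifts. The windows bring in errors of the form (time in \<open>\<Delta>\<close>) /
  \<open>d\<close>, which forces the order of limits: \<open>d\<close> is fixed, then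
  \<open>N \<rightarrow> \<infinity>\<close>, and only then \<open>d \<rightarrow> 0\<close>. Two
  obstacles shape the rest. The Markov property is available at deterministic times and for finitely
  many values only. Hence no stopping times occur: short-time behaviour is expressed by one-time
  probabilities, integrated over time by Fubini, and the almost sure unboundedness of the clock of
  the trace comes from recurrence along arithmetic progressions of times. Moreover, the bound on
  leaving a well has to be uniform over the starting states in the well. This uniformity is hidden
  in (i): convergence holds along every sequence of starting states, in particular along one that
  maximises the expected fraction of time spent outside of the well.\<close>

lemma space_path_space [simp]: "space (path_space K) = cadlag_paths K"
  by (auto simp: path_space_def space_restrict_space space_PiM cadlag_paths_def)

lemma measurable_path_component:
  assumes "0 \<le> t"
  shows "(\<lambda>\<omega>. \<omega> t) \<in> measurable (path_space K) (count_space K)"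
  unfolding path_space_def using assms
  by (intro measurable_restrict_space1 measurable_component_singleton) auto

lemma cadlag_paths_PiE: "\<omega> \<in> cadlag_paths K \<Longrightarrow> \<omega> \<in> {0..} \<rightarrow>\<^sub>E K"
  by (simp add: cadlag_paths_def)

lemma cadlag_paths_range: "\<omega> \<in> cadlag_paths K \<Longrightarrow> 0 \<le> t \<Longrightarrow> \<omega> t \<in> K"
  by (auto simp: cadlag_paths_def)

lemma cadlag_paths_right:
  assumes "\<omega> \<in> cadlag_paths K" "0 \<le> t"
  shows "\<exists>h>0. \<forall>s. t \<le> s \<and> s < t + h \<longrightarrow> \<omega> s = \<omega> t"
proof -
  have "\<forall>\<^sub>F s in at_right t. \<omega> s = \<omega> t"
    using assms by (auto simp: cadlag_paths_def)
  then obtain b where b: "b > t" "\<forall>z>t. z < b \<longrightarrow> \<omega> z = \<omega> t"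
    by (auto simp: eventually_at_right_field)
  have "\<omega> s = \<omega> t" if "t \<le> s" "s < t + (b - t)" for s
    using that b(2) by (cases "s = t") auto
  moreover have "0 < b - t"
    using b(1) by simp
  ultimately show ?thesis
    by blast
qed

text \<open>The bound \<open>h \<le> t\<close> keeps the interval before \<open>t\<close> inside
  \<open>[0, \<infinity>)\<close>, the only region where membership in \<open>cadlag_paths K\<close>
  constrains values to \<open>K\<close>.\<close>

lemma cadlag_paths_left:
  assumes "\<omega> \<in> cadlag_paths K" "0 < t"
  shows "\<exists>h a. 0 < h \<and> h \<le> t \<and> (\<forall>s. t - h < s \<and> s < t \<longrightarrow> \<omega> s = a)"
proof -
  obtain a where "\<forall>\<^sub>F s in at_left t. \<omega> s = a"
    using assms by (auto simp: cadlag_paths_def)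
  then obtain b where b: "b < t" "\<forall>z>b. z < t \<longrightarrow> \<omega> z = a"
    by (auto simp: eventually_at_left_field)
  with assms(2) show ?thesis
    by (intro exI[of _ "min t (t - b)"] exI[of _ a]) auto
qed

lemma cadlag_pathsI:
  assumes "\<omega> \<in> {0..} \<rightarrow>\<^sub>E K"
    and right: "\<And>t. 0 \<le> t \<Longrightarrow> \<exists>h>0. \<forall>s. t < s \<and> s < t + h \<longrightarrow> \<omega> s = \<omega> t"
    and left: "\<And>t. 0 < t \<Longrightarrow> \<exists>h>0. \<exists>a. \<forall>s. t - h < s \<and> s < t \<longrightarrow> \<omega> s = a"
  shows "\<omega> \<in> cadlag_paths K"
  unfolding cadlag_paths_def
proof (intro CollectI conjI allI impI)
  fix t :: real assume "0 \<le> t"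
  then obtain h where "h > 0" "\<forall>s. t < s \<and> s < t + h \<longrightarrow> \<omega> s = \<omega> t"
    using right by blast
  then show "\<forall>\<^sub>F s in at_right t. \<omega> s = \<omega> t"
    unfolding eventually_at_right_field by (intro exI[of _ "t + h"]) auto
next
  fix t :: real assume "0 < t"
  then obtain h a where "h > 0" "\<forall>s. t - h < s \<and> s < t \<longrightarrow> \<omega> s = a"
    using left by blast
  then show "\<exists>a. \<forall>\<^sub>F s in at_left t. \<omega> s = a"
    unfolding eventually_at_left_field by (intro exI[of _ a] exI[of _ "t - h"]) auto
qed (rule assms(1))

lemma cadlag_paths_map:
  assumes \<omega>: "\<omega> \<in> cadlag_paths K" and f: "f \<in> K \<rightarrow> K'"
  shows "(\<lambda>t\<in>{0..}. f (\<omega> t)) \<in> cadlag_paths K'"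
proof (rule cadlag_pathsI)
  show "(\<lambda>t\<in>{0..}. f (\<omega> t)) \<in> {0..} \<rightarrow>\<^sub>E K'"
    using funcset_mem[OF f cadlag_paths_range[OF \<omega>]] by (intro PiE_I) simp_all
next
  fix t :: real assume t: "0 \<le> t"
  obtain h where h: "0 < h" "\<And>s. t \<le> s \<Longrightarrow> s < t + h \<Longrightarrow> \<omega> s = \<omega> t"
    using cadlag_paths_right[OF \<omega> t] by blast
  have "(\<lambda>t\<in>{0..}. f (\<omega> t)) s = (\<lambda>t\<in>{0..}. f (\<omega> t)) t" if "t < s" "s < t + h" for s
    using that t h(2)[of s] by simp
  with h(1) show "\<exists>h>0. \<forall>s. t < s \<and> s < t + h \<longrightarrow> (\<lambda>t\<in>{0..}. f (\<omega> t)) s = (\<lambda>t\<in>{0..}. f (\<omega> t)) t"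
    by blast
next
  fix t :: real assume t: "0 < t"
  obtain h a where h: "0 < h" "h \<le> t" "\<And>s. t - h < s \<Longrightarrow> s < t \<Longrightarrow> \<omega> s = a"
    using cadlag_paths_left[OF \<omega> t] by blast
  have "(\<lambda>t\<in>{0..}. f (\<omega> t)) s = f a" if "t - h < s" "s < t" for s
    using that h(2) h(3)[of s] by simp
  with h(1) show "\<exists>h>0. \<exists>a. \<forall>s. t - h < s \<and> s < t \<longrightarrow> (\<lambda>t\<in>{0..}. f (\<omega> t)) s = a"
    by blast
qed

lemma cadlag_paths_time_change:
  assumes \<omega>: "\<omega> \<in> cadlag_paths K" and c: "0 < c"
  shows "time_change c \<omega> \<in> cadlag_paths K"
proof (rule cadlag_pathsI)
  show "time_change c \<omega> \<in> {0..} \<rightarrow>\<^sub>E K"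
    unfolding time_change_def using c by (intro PiE_I) (simp_all add: cadlag_paths_range[OF \<omega>])
next
  fix t :: real assume t: "0 \<le> t"
  have tc: "0 \<le> t * c"
    using t c by simp
  obtain h where h: "0 < h" "\<And>s. t * c \<le> s \<Longrightarrow> s < t * c + h \<Longrightarrow> \<omega> s = \<omega> (t * c)"
    using cadlag_paths_right[OF \<omega> tc] by blast
  have "time_change c \<omega> s = time_change c \<omega> t" if "t < s" "s < t + h / c" for s
    using that t c h(2)[of "s * c"] by (simp add: time_change_def field_simps)
  moreover have "0 < h / c"
    using h(1) c by simp
  ultimately show "\<exists>h>0. \<forall>s. t < s \<and> s < t + h \<longrightarrow> time_change c \<omega> s = time_change c \<omega> t"
    by blast
next
  fix t :: real assume t: "0 < t"
  have tc: "0 < t * c"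
    using t c by simp
  obtain h a where h: "0 < h" "h \<le> t * c" "\<And>s. t * c - h < s \<Longrightarrow> s < t * c \<Longrightarrow> \<omega> s = a"
    using cadlag_paths_left[OF \<omega> tc] by blast
  have "time_change c \<omega> s = a" if "t - h / c < s" "s < t" for s
  proof -
    have "t * c - h < s * c"
      using that c by (auto simp: field_simps)
    \<comment> \<open>A negative \<open>s\<close> would give
      \<open>s * c < 0 \<le> t * c - h\<close>, against the previous inequality.\<close>
    moreover from this have "0 \<le> s"
      using h(2) mult_neg_pos[OF _ c, of s] by (cases "s < 0") auto
    ultimately show ?thesis
      using that t c h(3)[of "s * c"] by (simp add: time_change_def)
  qed
  moreover have "0 < h / c"
    using h(1) c by simp
  ultimately show "\<exists>h>0. \<exists>a. \<forall>s. t - h < s \<and> s < t \<longrightarrow> time_change c \<omega> s = a"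
    by blast
qed

section \<open>Measurability of maps between path spaces and of evaluations\<close>

lemma measurable_path_spaceI:
  assumes "\<And>x. x \<in> space M \<Longrightarrow> f x \<in> cadlag_paths K"
    and "\<And>t. 0 \<le> t \<Longrightarrow> (\<lambda>x. f x t) \<in> measurable M (count_space K)"
  shows "f \<in> measurable M (path_space K)"
  unfolding path_space_def
proof (rule measurable_restrict_space2)
  show "f \<in> measurable M (\<Pi>\<^sub>M t\<in>{0..}. count_space K)"
    by (rule measurable_PiM_single') (use assms in \<open>auto dest: cadlag_paths_PiE[OF assms(1)]\<close>)
qed (use assms(1) in auto)

lemma measurable_path_map:
  assumes "f \<in> K \<rightarrow> K'"
  shows "(\<lambda>\<omega>. \<lambda>t\<in>{0..}. f (\<omega> t)) \<in> measurable (path_space K) (path_space K')"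
proof (rule measurable_path_spaceI)
  fix t :: real assume "0 \<le> t"
  moreover have "f \<in> measurable (count_space K) (count_space K')"
    using assms by auto
  ultimately show "(\<lambda>\<omega>. (\<lambda>t\<in>{0..}. f (\<omega> t)) t) \<in> measurable (path_space K) (count_space K')"
    by (auto intro: measurable_compose[OF measurable_path_component])
qed (simp add: cadlag_paths_map[OF _ assms])

lemma measurable_time_change:
  assumes "0 < c"
  shows "time_change c \<in> measurable (path_space K) (path_space K)"
proof (rule measurable_path_spaceI)
  fix t :: real assume "0 \<le> t"
  then show "(\<lambda>\<omega>. time_change c \<omega> t) \<in> measurable (path_space K) (count_space K)"
    using assms by (auto simp: time_change_def intro!: measurable_path_component)
qed (simp add: cadlag_paths_time_change[OF _ assms])

text \<open>The times \<open>(\<lfloor>m s\<rfloor> + 1) / m\<close> approach \<open>s\<close> from the right and take only countably many values.\<close>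

lemma borel_measurable_path_indicator:
  "(\<lambda>(\<omega>, s). indicator A (\<omega> (max 0 s)) :: real) \<in> borel_measurable (path_space K \<Otimes>\<^sub>M lborel)"
proof (rule borel_measurable_LIMSEQ_real)
  \<comment> \<open>Adding \<open>1\<close> puts the approximating time strictly to the right of
    \<open>max 0 s\<close>, where right continuity applies; \<open>Suc m\<close> avoids a division
    by zero. The clamp \<open>max 0 s\<close> is there because \<open>lborel\<close> charges
    negative times, at which a path has no meaningful value.\<close>
  let ?d = "\<lambda>m s. (real (nat \<lfloor>real (Suc m) * max 0 s\<rfloor>) + 1) / real (Suc m)"
  show "(\<lambda>(\<omega>, s). indicator A (\<omega> (?d m s)) :: real) \<in> borel_measurable (path_space K \<Otimes>\<^sub>M lborel)" for m
  proof -
    have 1: "(\<lambda>p. indicator A ((fst p) ((real i + 1) / real (Suc m))) :: real)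
        \<in> borel_measurable (path_space K \<Otimes>\<^sub>M lborel)" for i :: nat
      by (rule measurable_compose[OF measurable_compose[OF measurable_fst measurable_path_component]]) auto
    have 2: "(\<lambda>p. nat \<lfloor>real (Suc m) * max 0 (snd p)\<rfloor>)
        \<in> measurable (path_space K \<Otimes>\<^sub>M lborel) (count_space UNIV)"
      by measurable
    show ?thesis
      using measurable_compose_countable[of "\<lambda>i p. indicator A ((fst p) ((real i + 1) / real (Suc m))) :: real", OF 1 2]
      by (simp add: case_prod_beta del: of_nat_Suc of_nat_nat)
  qed
next
  let ?d = "\<lambda>m s. (real (nat \<lfloor>real (Suc m) * max 0 s\<rfloor>) + 1) / real (Suc m)"
  fix p :: "(real \<Rightarrow> 'a) \<times> real" assume "p \<in> space (path_space K \<Otimes>\<^sub>M lborel)"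
  then obtain \<omega> s where p: "p = (\<omega>, s)" and \<omega>: "\<omega> \<in> cadlag_paths K"
    by (auto simp: space_pair_measure)
  obtain h where h: "0 < h" "\<And>r. max 0 s \<le> r \<Longrightarrow> r < max 0 s + h \<Longrightarrow> \<omega> r = \<omega> (max 0 s)"
    using cadlag_paths_right[OF \<omega> max.cobounded1[of 0 s]] by blast
  obtain m0 where m0: "inverse (real (Suc m0)) < h"
    using h(1) reals_Archimedean by blast
  have "\<omega> (?d m s) = \<omega> (max 0 s)" if "m \<ge> m0" for m
  proof (rule h(2))
    define c where "c = real (Suc m)"
    have c: "0 < c" "1 / c \<le> 1 / real (Suc m0)"
      using that unfolding c_def by (auto intro!: divide_left_mono)
    have *: "?d m s = (of_int \<lfloor>c * max 0 s\<rfloor> + 1) / c"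
      unfolding c_def by simp
    have "c * max 0 s \<le> of_int \<lfloor>c * max 0 s\<rfloor> + 1"
      by linarith
    then show "max 0 s \<le> ?d m s"
      unfolding * using c(1) by (simp only: pos_le_divide_eq mult.commute)
    have "of_int \<lfloor>c * max 0 s\<rfloor> \<le> c * max 0 s"
      by linarith
    then have "?d m s \<le> (c * max 0 s + 1) / c"
      unfolding * using c(1) by (intro divide_right_mono) auto
    also have "\<dots> = max 0 s + 1 / c"
      using c(1) by (simp add: add_divide_distrib)
    finally show "?d m s < max 0 s + h"
      using m0 c(2) by (simp add: inverse_eq_divide)
  qed
  then have "\<forall>\<^sub>F m in sequentially. indicator A (\<omega> (?d m s)) = (indicator A (\<omega> (max 0 s)) :: real)"
    unfolding eventually_sequentially by (intro exI[of _ m0] allI impI) (simp only:)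
  then show "(\<lambda>m. (\<lambda>(\<omega>, s). indicator A (\<omega> (?d m s)) :: real) p)
      \<longlonglongrightarrow> (\<lambda>(\<omega>, s). indicator A (\<omega> (max 0 s))) p"
    unfolding p by (auto intro: tendsto_eventually)
qed

text \<open>The value at a random time is the jointly measurable indicator composed with
  \<open>\<omega> \<mapsto> (\<omega>, \<tau> \<omega>)\<close>. As \<open>K\<close> is countable,
  preimages of single states suffice.\<close>

lemma measurable_path_at:
  assumes K: "countable K" and \<tau>: "\<tau> \<in> borel_measurable (path_space K)" and nn: "\<And>\<omega>. 0 \<le> \<tau> \<omega>"
  shows "(\<lambda>\<omega>. \<omega> (\<tau> \<omega>)) \<in> measurable (path_space K) (count_space K)"
  unfolding measurable_count_space_eq_countable[OF K]
proof (intro conjI ballI)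
  fix a assume "a \<in> K"
  have "(\<lambda>\<omega>. (\<omega>, \<tau> \<omega>)) \<in> measurable (path_space K) (path_space K \<Otimes>\<^sub>M lborel)"
    using \<tau> by measurable
  from measurable_compose[OF this borel_measurable_path_indicator[of "{a}"]]
  have m [measurable]: "(\<lambda>\<omega>. indicator {a} (\<omega> (\<tau> \<omega>)) :: real) \<in> borel_measurable (path_space K)"
    using nn by simp
  have "(\<lambda>\<omega>. \<omega> (\<tau> \<omega>)) -` {a} \<inter> space (path_space K) =
      {\<omega> \<in> space (path_space K). indicator {a} (\<omega> (\<tau> \<omega>)) = (1::real)}"
    by (auto simp: indicator_def)
  also have "\<dots> \<in> sets (path_space K)"
    by measurable
  finally show "(\<lambda>\<omega>. \<omega> (\<tau> \<omega>)) -` {a} \<inter> space (path_space K) \<in> sets (path_space K)" .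
qed (simp add: nn cadlag_paths_range Pi_iff)


subsection \<open>Occupation times\<close>

text \<open>Rewrites the integrand in the clamped form for which joint measurability in path and
  time is known.\<close>

lemma occupation_time_max:
  "occupation_time A \<omega> t = (\<integral>s. indicator {0..t} s * indicator A (\<omega> (max 0 s)) \<partial>lborel)"
  unfolding occupation_time_def set_lebesgue_integral_def
  by (rule Bochner_Integration.integral_cong) (auto simp: indicator_def)

lemma borel_measurable_occupation_time:
  "(\<lambda>\<omega>. occupation_time A \<omega> t) \<in> borel_measurable (path_space K)"
  unfolding occupation_time_max
  by (rule lborel.borel_measurable_lebesgue_integral)
     (use borel_measurable_path_indicator[of A K] in \<open>simp add: case_prod_beta\<close>)

lemma set_integrable_path_indicator:
  assumes \<omega>: "\<omega> \<in> cadlag_paths K" and S: "S \<in> sets lborel" "S \<subseteq> {0..t}"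
  shows "set_integrable lborel S (\<lambda>s. indicator A (\<omega> s) :: real)"
proof -
  have [measurable]: "(\<lambda>s. indicator A (\<omega> (max 0 s)) :: real) \<in> borel_measurable lborel"
    using measurable_compose[OF measurable_Pair1' borel_measurable_path_indicator[of A], of \<omega> K] \<omega>
    by simp
  have "integrable lborel (\<lambda>s. indicator S s * indicator A (\<omega> (max 0 s)) :: real)"
  proof (rule Bochner_Integration.integrable_bound)
    show "integrable lborel (indicator {0..t} :: real \<Rightarrow> real)"
      by (simp add: emeasure_lborel_Icc_eq)
    show "(\<lambda>s. indicator S s * indicator A (\<omega> (max 0 s)) :: real) \<in> borel_measurable lborel"
      using S(1) by measurable
    show "AE s in lborel. norm (indicator S s * indicator A (\<omega> (max 0 s)) :: real)
        \<le> norm (indicator {0..t} s :: real)"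
    proof (rule AE_I2)
      fix s show "norm (indicator S s * indicator A (\<omega> (max 0 s)) :: real)
          \<le> norm (indicator {0..t} s :: real)"
        using S(2) by (auto simp: indicator_def)
    qed
  qed
  moreover have "indicator S s * indicator A (\<omega> (max 0 s)) = (indicator S s *\<^sub>R indicator A (\<omega> s) :: real)" for s
    using S(2) by (auto simp: indicator_def)
  ultimately show ?thesis
    by (simp add: set_integrable_def)
qed

lemma occupation_time_diff:
  assumes \<omega>: "\<omega> \<in> cadlag_paths K" and "0 \<le> u" "u \<le> v"
  shows "occupation_time A \<omega> v - occupation_time A \<omega> u
    = (LINT s:{u<..v}|lborel. indicator A (\<omega> s))"
proof -
  have "{0..v} = {0..u} \<union> {u<..v}"
    using assms by auto
  then have "occupation_time A \<omega> v = (LINT s:{0..u} \<union> {u<..v}|lborel. indicator A (\<omega> s))"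
    by (simp add: occupation_time_def)
  also have "\<dots> = (LINT s:{0..u}|lborel. indicator A (\<omega> s)) + (LINT s:{u<..v}|lborel. indicator A (\<omega> s))"
    by (rule set_integral_Un)
       (use assms in \<open>auto intro!: set_integrable_path_indicator[OF \<omega>, where t = v]\<close>)
  finally show ?thesis
    by (simp add: occupation_time_def)
qed

lemma occupation_time_0 [simp]: "occupation_time A \<omega> 0 = 0"
proof -
  have "AE s in lborel. indicator {0::real..0} s *\<^sub>R indicator A (\<omega> s) = (0::real)"
    using AE_lborel_singleton[of "0::real"] by eventually_elim auto
  then show ?thesis
    unfolding occupation_time_def set_lebesgue_integral_def
    by (simp add: integral_eq_zero_AE)
qed

lemma LINT_const_Ioc: "u \<le> v \<Longrightarrow> (LINT s:{u<..v}|lborel. (c::real)) = (v - u) * c"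
  by (simp add: set_lebesgue_integral_def)

text \<open>Nothing is assumed about the path at \<open>v\<close>, where it may jump: a single point
  has Lebesgue measure zero.\<close>

lemma occupation_time_const:
  assumes \<omega>: "\<omega> \<in> cadlag_paths K" and "0 \<le> u" "u \<le> v" and c: "\<And>s. u < s \<Longrightarrow> s < v \<Longrightarrow> \<omega> s = c"
  shows "occupation_time A \<omega> v - occupation_time A \<omega> u = (v - u) * indicator A c"
proof -
  have "occupation_time A \<omega> v - occupation_time A \<omega> u
      = (LINT s|lborel. indicator {u<..v} s *\<^sub>R indicator A (\<omega> s))"
    using occupation_time_diff[OF assms(1-3)] by (simp add: set_lebesgue_integral_def)
  also have "\<dots> = (LINT s|lborel. indicator {u<..v} s *\<^sub>R indicator A c)"
  proof (rule integral_cong_AE)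
    show "AE s in lborel. indicator {u<..v} s *\<^sub>R indicator A (\<omega> s)
        = (indicator {u<..v} s *\<^sub>R indicator A c :: real)"
      using AE_lborel_singleton[of v]
      by eventually_elim (auto simp: indicator_def c)
    have "set_integrable lborel {u<..v} (\<lambda>s. indicator A (\<omega> s) :: real)"
      by (rule set_integrable_path_indicator[OF \<omega>, where t = v]) (use assms in auto)
    then show "(\<lambda>s. indicator {u<..v} s *\<^sub>R indicator A (\<omega> s) :: real) \<in> borel_measurable lborel"
      unfolding set_integrable_def by (rule borel_measurable_integrable)
  qed auto
  also have "\<dots> = (v - u) * indicator A c"
    using LINT_const_Ioc[OF \<open>u \<le> v\<close>] by (simp add: set_lebesgue_integral_def)
  finally show ?thesis .
qed

lemma occupation_time_Un:
  assumes \<omega>: "\<omega> \<in> cadlag_paths K" and "A \<inter> B = {}"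
  shows "occupation_time (A \<union> B) \<omega> t = occupation_time A \<omega> t + occupation_time B \<omega> t"
proof -
  have "occupation_time (A \<union> B) \<omega> t = (LINT s:{0..t}|lborel. indicator A (\<omega> s) + indicator B (\<omega> s))"
    unfolding occupation_time_def using assms(2)
    by (intro set_lebesgue_integral_cong) (auto simp: indicator_def)
  also have "\<dots> = occupation_time A \<omega> t + occupation_time B \<omega> t"
    unfolding occupation_time_def
    by (rule set_integral_add) (auto intro!: set_integrable_path_indicator[OF \<omega>, where t = t])
  finally show ?thesis .
qed

lemma occupation_time_cong:
  assumes "\<And>s. 0 \<le> s \<Longrightarrow> s \<le> t \<Longrightarrow> \<omega> s \<in> A \<longleftrightarrow> \<omega>' s \<in> B"
  shows "occupation_time A \<omega> t = occupation_time B \<omega>' t"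
  unfolding occupation_time_def using assms
  by (intro set_lebesgue_integral_cong) (auto simp: indicator_def)

lemma occupation_time_UNIV:
  assumes "0 \<le> t"
  shows "occupation_time UNIV \<omega> t = t"
  using assms by (simp add: occupation_time_def set_lebesgue_integral_def)

lemma occupation_time_Compl:
  assumes "\<omega> \<in> cadlag_paths K" "0 \<le> t"
  shows "occupation_time A \<omega> t + occupation_time (- A) \<omega> t = t"
  using occupation_time_Un[OF assms(1), of A "- A" t] occupation_time_UNIV[OF assms(2), of \<omega>]
  by simp

lemma occupation_time_mono:
  assumes \<omega>: "\<omega> \<in> cadlag_paths K" and "0 \<le> u" "u \<le> v"
  shows "occupation_time A \<omega> u \<le> occupation_time A \<omega> v"
proof -
  have "0 \<le> (LINT s:{u<..v}|lborel. indicator A (\<omega> s) :: real)"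
    unfolding set_lebesgue_integral_def by (rule integral_nonneg_AE) auto
  then show ?thesis
    using occupation_time_diff[OF assms, of A] by simp
qed

lemma occupation_time_nonneg: "0 \<le> occupation_time A \<omega> t"
  unfolding occupation_time_def set_lebesgue_integral_def by (rule integral_nonneg_AE) auto

lemma occupation_time_diff_le:
  assumes \<omega>: "\<omega> \<in> cadlag_paths K" and "0 \<le> u" "u \<le> v"
  shows "occupation_time A \<omega> v - occupation_time A \<omega> u \<le> v - u"
  using occupation_time_Compl[OF \<omega>, of u A] occupation_time_Compl[OF \<omega>, of v A]
    occupation_time_mono[OF assms, of "- A"] assms by simp

lemma occupation_time_le:
  assumes "\<omega> \<in> cadlag_paths K" "0 \<le> t"
  shows "occupation_time A \<omega> t \<le> t"
  using occupation_time_diff_le[OF assms(1) order_refl assms(2), of A] by simp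

text \<open>The path takes values in \<open>K\<close>, so only \<open>A \<inter> K\<close> matters;
  the surplus is the time spent in \<open>B - A\<close>, which is nondecreasing.\<close>

lemma occupation_time_diff_mono:
  assumes \<omega>: "\<omega> \<in> cadlag_paths K" and "0 \<le> u" "u \<le> v" and "A \<inter> K \<subseteq> B"
  shows "occupation_time A \<omega> v - occupation_time A \<omega> u
    \<le> occupation_time B \<omega> v - occupation_time B \<omega> u"
proof -
  have "occupation_time B \<omega> t = occupation_time A \<omega> t + occupation_time (B - A) \<omega> t" for t
  proof -
    have "occupation_time B \<omega> t = occupation_time (A \<union> (B - A)) \<omega> t"
      by (rule occupation_time_cong) (use assms(4) cadlag_paths_range[OF \<omega>] in blast)
    then show ?thesis
      using occupation_time_Un[OF \<omega>, of A "B - A" t] by simp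
  qed
  with occupation_time_mono[OF assms(1-3), of "B - A"] show ?thesis
    by simp
qed

lemma continuous_on_occupation_time:
  assumes \<omega>: "\<omega> \<in> cadlag_paths K"
  shows "continuous_on {0..} (occupation_time A \<omega>)"
proof (rule lipschitz_on_continuous_on)
  show "1-lipschitz_on {0..} (occupation_time A \<omega>)"
  proof (rule lipschitz_onI)
    fix u v :: real assume "u \<in> {0..}" "v \<in> {0..}"
    then show "dist (occupation_time A \<omega> u) (occupation_time A \<omega> v) \<le> 1 * dist u v"
      using occupation_time_mono[OF \<omega>, of u v A] occupation_time_mono[OF \<omega>, of v u A]
        occupation_time_diff_le[OF \<omega>, of u v A] occupation_time_diff_le[OF \<omega>, of v u A]
      by (cases "u \<le> v") (auto simp: dist_real_def)
  qed simp
qed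


subsection \<open>Continuity of occupation times in the Skorohod topology\<close>

lemma continuous_map_skorohodI:
  fixes f :: "(real \<Rightarrow> 'a) \<Rightarrow> real"
  assumes "\<And>\<omega> \<epsilon>. \<omega> \<in> cadlag_paths K \<Longrightarrow> 0 < \<epsilon> \<Longrightarrow>
    \<exists>T>0. \<exists>e>0. \<forall>\<omega>'\<in>skorohod_nbhd K \<omega> T e. \<bar>f \<omega>' - f \<omega>\<bar> < \<epsilon>"
  shows "continuous_map (skorohod_topology K) euclideanreal f"
  unfolding continuous_map_def
proof (intro conjI allI impI)
  fix U :: "real set" assume "openin euclideanreal U"
  then have U: "open U" by simp
  show "openin (skorohod_topology K) {\<omega> \<in> topspace (skorohod_topology K). f \<omega> \<in> U}"
    unfolding openin_skorohod topspace_skorohod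
  proof (intro conjI ballI)
    fix \<omega> assume "\<omega> \<in> {\<omega> \<in> cadlag_paths K. f \<omega> \<in> U}"
    then have \<omega>: "\<omega> \<in> cadlag_paths K" and "f \<omega> \<in> U" by auto
    with U obtain \<epsilon> where \<epsilon>: "0 < \<epsilon>" "\<And>y. dist y (f \<omega>) < \<epsilon> \<Longrightarrow> y \<in> U"
      unfolding open_dist by blast
    obtain T e where Te: "T > 0" "e > 0" "\<And>\<omega>'. \<omega>' \<in> skorohod_nbhd K \<omega> T e \<Longrightarrow> \<bar>f \<omega>' - f \<omega>\<bar> < \<epsilon>"
      using assms[OF \<omega> \<epsilon>(1)] by blast
    have "skorohod_nbhd K \<omega> T e \<subseteq> {\<omega> \<in> cadlag_paths K. f \<omega> \<in> U}"
      using Te(3) \<epsilon>(2) by (auto simp: skorohod_nbhd_def dist_real_def)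
    with Te(1,2) show "\<exists>T>0. \<exists>e>0. skorohod_nbhd K \<omega> T e \<subseteq> {\<omega> \<in> cadlag_paths K. f \<omega> \<in> U}"
      by blast
  qed auto
qed simp

text \<open>In a discrete space, right continuity and left limits give one plateau on each side of
  \<open>t\<close>. Close to \<open>t\<close>, the value thus depends only on the side of
  \<open>t\<close> on which the time lies.\<close>

lemma cadlag_paths_locally_const:
  assumes \<omega>: "\<omega> \<in> cadlag_paths K" and "0 \<le> t"
  shows "\<exists>h>0. \<forall>r s. 0 \<le> r \<and> 0 \<le> s \<and> \<bar>r - t\<bar> < h \<and> \<bar>s - t\<bar> < h \<and> (t \<le> r \<longleftrightarrow> t \<le> s)
    \<longrightarrow> \<omega> r = \<omega> s"
proof -
  obtain h where h: "0 < h" "\<And>s. t \<le> s \<Longrightarrow> s < t + h \<Longrightarrow> \<omega> s = \<omega> t"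
    using cadlag_paths_right[OF assms] by blast
  have "\<exists>k>0. \<exists>a. \<forall>s. 0 \<le> s \<and> t - k < s \<and> s < t \<longrightarrow> \<omega> s = a"
  \<comment> \<open>At \<open>t = 0\<close> no nonnegative time lies to the left, so any
    \<open>k\<close> and \<open>a\<close> serve.\<close>
  proof (cases "t = 0")
    case False
    then show ?thesis
      using cadlag_paths_left[OF \<omega>, of t] \<open>0 \<le> t\<close> by (metis less_eq_real_def)
  qed (auto intro!: exI[of _ "1::real"])
  then obtain k a where k: "0 < k" "\<And>s. 0 \<le> s \<Longrightarrow> t - k < s \<Longrightarrow> s < t \<Longrightarrow> \<omega> s = a"
    by blast
  have "\<omega> r = \<omega> s" if "0 \<le> r \<and> 0 \<le> s \<and> \<bar>r - t\<bar> < min h k \<and> \<bar>s - t\<bar> < min h k \<and> (t \<le> r \<longleftrightarrow> t \<le> s)" for r s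
  proof (cases "t \<le> r")
    case True
    then have "r < t + h" "s < t + h" "t \<le> s"
      using that by auto
    then show ?thesis
      using h(2)[OF True] h(2)[of s] by metis
  next
    case False
    then have "t - k < r" "t - k < s" "r < t" "s < t"
      using that by auto
    then show ?thesis
      using k(2)[of r] k(2)[of s] that by metis
  qed
  moreover have "0 < min h k"
    using h k by simp
  ultimately show ?thesis
    by blast
qed

text \<open>Compactness of \<open>[0, t]\<close> turns the local plateaus into a uniform statement:
  away from a finite set \<open>C\<close>, which contains all jump times in \<open>[0, t]\<close>,
  small shifts of time do not change the value. The scale \<open>e\<close> is quantified after
  \<open>C\<close> and \<open>d\<close>, so that it can later be shrunk without changing the number
  of exceptional points.\<close>

lemma cadlag_paths_const_off_finite:
  assumes \<omega>: "\<omega> \<in> cadlag_paths K"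
  shows "\<exists>C d. finite C \<and> 0 < d \<and> (\<forall>e s r. e \<le> d \<and> 0 \<le> s \<and> s \<le> t \<and> 0 \<le> r \<and> \<bar>r - s\<bar> < e \<and>
    (\<forall>c\<in>C. e \<le> \<bar>s - c\<bar>) \<longrightarrow> \<omega> r = \<omega> s)"
proof -
  obtain h where h: "\<And>c. 0 \<le> c \<Longrightarrow> 0 < h c"
    "\<And>c r s. 0 \<le> c \<Longrightarrow> 0 \<le> r \<and> 0 \<le> s \<and> \<bar>r - c\<bar> < h c \<and> \<bar>s - c\<bar> < h c \<and> (c \<le> r \<longleftrightarrow> c \<le> s)
      \<longrightarrow> \<omega> r = \<omega> s"
    using cadlag_paths_locally_const[OF \<omega>] by metis
  have "{0..t} \<subseteq> (\<Union>c\<in>{0..t}. ball c (h c))"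
    using h(1) by force
  then obtain C where C: "C \<subseteq> {0..t}" "finite C" "{0..t} \<subseteq> (\<Union>c\<in>C. ball c (h c))"
    using compactE_image[of "{0..t}" "{0..t}" "\<lambda>c. ball c (h c)"] by auto
  \<comment> \<open>\<open>d\<close> is a Lebesgue number of the finite cover, so \<open>r\<close>
    and \<open>s\<close> fall into a common ball.\<close>
  obtain d where d: "0 < d" "\<And>s. s \<in> {0..t} \<Longrightarrow> \<exists>G\<in>(\<lambda>c. ball c (h c)) ` C. ball s d \<subseteq> G"
    using Heine_Borel_lemma[of "{0..t}" "(\<lambda>c. ball c (h c)) ` C"] C(3) by auto
  have "\<omega> r = \<omega> s" if *: "e \<le> d \<and> 0 \<le> s \<and> s \<le> t \<and> 0 \<le> r \<and> \<bar>r - s\<bar> < e \<and>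
    (\<forall>c\<in>C. e \<le> \<bar>s - c\<bar>)" for e s r
  proof -
    obtain c where c: "c \<in> C" "ball s d \<subseteq> ball c (h c)"
      using d(2)[of s] * by auto
    have "r \<in> ball s d" "s \<in> ball s d"
      using * d(1) by (auto simp: dist_real_def)
    then have "r \<in> ball c (h c)" "s \<in> ball c (h c)"
      using c(2) by blast+
    then have "\<bar>r - c\<bar> < h c" "\<bar>s - c\<bar> < h c"
      by (simp_all add: dist_real_def abs_minus_commute)
    \<comment> \<open>Since \<open>s\<close> is at distance at least \<open>e\<close> from
      \<open>c\<close> and \<open>r\<close> is closer than \<open>e\<close> to \<open>s\<close>, the
      centre \<open>c\<close> does not separate them.\<close>
    moreover have "c \<le> r \<longleftrightarrow> c \<le> s"
      using * c(1) by force
    moreover have "0 \<le> c"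
      using c(1) C(1) by auto
    ultimately show ?thesis
      using h(2)[of c r s] * by blast
  qed
  then show ?thesis
    using C(2) d(1) by blast
qed

text \<open>A path in a small Skorohod neighbourhood differs from \<open>\<omega>\<close> on
  \<open>[0, t]\<close> only within distance \<open>e\<close> of the finite exceptional set
  \<open>C\<close>, a set of times of measure at most \<open>2 e\<close> times the size of
  \<open>C\<close>.\<close>

lemma continuous_map_occupation_time:
  "continuous_map (skorohod_topology K) euclideanreal (\<lambda>\<omega>. occupation_time A \<omega> t)"
proof (rule continuous_map_skorohodI)
  fix \<omega> :: "real \<Rightarrow> 'a" and \<epsilon> :: real assume \<omega>: "\<omega> \<in> cadlag_paths K" and "0 < \<epsilon>"
  obtain C d where C: "finite C" "0 < d" "\<And>e s r. e \<le> d \<and> 0 \<le> s \<and> s \<le> t \<and> 0 \<le> r \<and> \<bar>r - s\<bar> < e \<and>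
    (\<forall>c\<in>C. e \<le> \<bar>s - c\<bar>) \<longrightarrow> \<omega> r = \<omega> s"
    using cadlag_paths_const_off_finite[OF \<omega>, of t] by blast
  \<comment> \<open>The summand \<open>1\<close> in the denominator covers an empty \<open>C\<close>
    and makes the final inequality strict.\<close>
  define e where "e = min d (\<epsilon> / (2 * real (card C) + 1))"
  have e: "0 < e" "e \<le> d" "2 * real (card C) * e < \<epsilon>"
  proof -
    show e0: "0 < e" "e \<le> d"
      using C(2) \<open>0 < \<epsilon>\<close> by (auto simp: e_def)
    have "2 * real (card C) * e < (2 * real (card C) + 1) * e"
      using e0 by simp
    also have "\<dots> \<le> (2 * real (card C) + 1) * (\<epsilon> / (2 * real (card C) + 1))"
      by (intro mult_left_mono) (auto simp: e_def)
    also have "\<dots> = \<epsilon>"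
      by simp
    finally show "2 * real (card C) * e < \<epsilon>" .
  qed
  \<comment> \<open>The horizon exceeds \<open>t + d\<close>: the deformation moves times by less
    than \<open>e \<le> d\<close>, so every \<open>s \<le> t\<close> equals \<open>l r\<close> for
    some \<open>r\<close> below this horizon. The absolute value and the \<open>1\<close> keep it
    positive for every real \<open>t\<close>.\<close>
  have "\<bar>occupation_time A \<omega>' t - occupation_time A \<omega> t\<bar> < \<epsilon>"
    if "\<omega>' \<in> skorohod_nbhd K \<omega> (\<bar>t\<bar> + d + 1) e" for \<omega>'
  proof -
    from that obtain l where \<omega>': "\<omega>' \<in> cadlag_paths K" and l: "l ` {0..} = {0..}"
      "\<And>t. 0 \<le> t \<Longrightarrow> \<bar>l t - t\<bar> < e" "\<And>s. s \<in> {0..\<bar>t\<bar> + d + 1} \<Longrightarrow> \<omega>' (l s) = \<omega> s"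
      unfolding skorohod_nbhd_def by blast
    have eq: "\<omega>' s = \<omega> s" if s: "0 \<le> s" "s \<le> t" "\<forall>c\<in>C. e \<le> \<bar>s - c\<bar>" for s
    proof -
      obtain r where r: "0 \<le> r" "l r = s"
        using s(1) l(1) by (metis atLeast_iff imageE)
      have "\<bar>r - s\<bar> < e"
        using l(2)[of r] r by auto
      moreover have "\<omega>' s = \<omega> r"
        using l(3)[of r] r s calculation e(2) by auto
      ultimately show ?thesis
        using C(3)[of e s r] e s r by auto
    qed
    let ?g = "\<lambda>s. indicator {0..t} s * (indicator A (\<omega>' s) - indicator A (\<omega> s)) :: real"
    have int: "integrable lborel (\<lambda>s. indicator {0..t} s * indicator A (w s) :: real)"
      if "w \<in> cadlag_paths K" for w
      using set_integrable_path_indicator[OF that, of "{0..t}" t A] by (simp add: set_integrable_def)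
    have g: "integrable lborel ?g"
      using Bochner_Integration.integrable_diff[OF int[OF \<omega>'] int[OF \<omega>]] by (simp add: algebra_simps)
    have "occupation_time A \<omega>' t - occupation_time A \<omega> t = (\<integral>s. ?g s \<partial>lborel)"
      unfolding occupation_time_def set_lebesgue_integral_def
      using int[OF \<omega>'] int[OF \<omega>] by (simp add: Bochner_Integration.integral_diff algebra_simps)
    also have "\<bar>\<dots>\<bar> \<le> (\<integral>s. \<bar>?g s\<bar> \<partial>lborel)"
      by (rule integral_abs_bound)
    also have "\<dots> \<le> (\<integral>s. (\<Sum>c\<in>C. indicator {c - e..c + e} s) \<partial>lborel)"
    proof (rule integral_mono)
      show "integrable lborel (\<lambda>s. \<bar>?g s\<bar>)"
        using g by (rule integrable_abs)
      show "integrable lborel (\<lambda>s. (\<Sum>c\<in>C. indicator {c - e..c + e} s) :: real)"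
        by (intro Bochner_Integration.integrable_sum) (simp add: emeasure_lborel_Icc_eq)
      fix s
      show "\<bar>?g s\<bar> \<le> (\<Sum>c\<in>C. indicator {c - e..c + e} s)"
      proof (cases "s \<in> {0..t} \<and> \<omega>' s \<noteq> \<omega> s")
        case True
        then obtain c where c: "c \<in> C" "\<bar>s - c\<bar> < e"
          using eq[of s] by force
        have "\<bar>?g s\<bar> \<le> 1"
          by (auto simp: indicator_def)
        also have "\<dots> = indicator {c - e..c + e} s"
          using c(2) by (auto simp: indicator_def)
        also have "\<dots> \<le> (\<Sum>c\<in>C. indicator {c - e..c + e} s)"
          using c(1) C(1) by (intro member_le_sum) auto
        finally show ?thesis .
      next
        case False
        then have "?g s = 0"
          by (auto simp: indicator_def)
        then show ?thesis
          by (simp only: abs_zero) (simp add: sum_nonneg)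
      qed
    qed
    also have "\<dots> = (\<Sum>c\<in>C. \<integral>s. indicator {c - e..c + e} s \<partial>lborel)"
      by (intro Bochner_Integration.integral_sum) (simp add: emeasure_lborel_Icc_eq)
    also have "\<dots> = 2 * real (card C) * e"
      using e(1) by simp
    finally show ?thesis
      using e(3) by linarith
  qed
  then show "\<exists>T>0. \<exists>e>0. \<forall>\<omega>'\<in>skorohod_nbhd K \<omega> T e.
      \<bar>occupation_time A \<omega>' t - occupation_time A \<omega> t\<bar> < \<epsilon>"
    using e(1) C(2) by (intro exI[of _ "\<bar>t\<bar> + d + 1"] conjI exI[of _ e]) auto
qed


subsection \<open>The trace process\<close>

text \<open>If \<open>g\<close> left the value \<open>g 0\<close>, look at the infimum of the times
  where it differs: continuity gives the value \<open>g 0\<close> there, and the plateau to the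
  right postpones the departure. This allows occupation times to be compared plateau by plateau
  without enumerating jump times.\<close>

lemma right_locally_const_imp_const:
  fixes g :: "real \<Rightarrow> real"
  assumes cont: "continuous_on {0..} g"
    and right: "\<And>u. 0 \<le> u \<Longrightarrow> \<exists>h>0. \<forall>r. u < r \<and> r < u + h \<longrightarrow> g r = g u"
    and "0 \<le> t"
  shows "g t = g 0"
proof (rule ccontr)
  assume neq: "g t \<noteq> g 0"
  define Z where "Z = {s. 0 \<le> s \<and> g s \<noteq> g 0}"
  have Z: "Z \<noteq> {}" "bdd_below Z"
    using neq \<open>0 \<le> t\<close> by (auto simp: Z_def intro!: bdd_belowI[of _ 0])
  define m where "m = Inf Z"
  have "0 \<le> m"
    unfolding m_def using Z by (intro cInf_greatest) (auto simp: Z_def)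
  have below: "s \<notin> Z" if "s < m" for s
    using cInf_lower[OF _ Z(2), of s] that unfolding m_def by auto
  \<comment> \<open>Otherwise continuity keeps \<open>g\<close> away from \<open>g 0\<close>
    slightly to the left of \<open>m\<close>, although all times before the infimum are outside of
    \<open>Z\<close>.\<close>
  have "g m = g 0"
  proof (rule ccontr)
    assume ne: "g m \<noteq> g 0"
    then have "m \<noteq> 0"
      by auto
    with \<open>0 \<le> m\<close> have "0 < m" by simp
    have "\<exists>d>0. \<forall>s\<in>{0..}. dist s m < d \<longrightarrow> dist (g s) (g m) < dist (g 0) (g m)"
      using cont \<open>0 \<le> m\<close> ne unfolding continuous_on_iff by auto
    then obtain d where d: "0 < d" "\<And>s. 0 \<le> s \<Longrightarrow> dist s m < d \<Longrightarrow> g s \<noteq> g 0"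
      by fastforce
    define s where "s = max 0 (m - d / 2)"
    have "0 \<le> s" "s < m" "dist s m < d"
      using \<open>0 < m\<close> d(1) by (auto simp: s_def dist_real_def)
    then show False
      using below[of s] d(2)[of s] by (auto simp: Z_def)
  qed
  obtain h where h: "h > 0" "\<And>r. m < r \<Longrightarrow> r < m + h \<Longrightarrow> g r = g m"
    using right[OF \<open>0 \<le> m\<close>] by blast
  obtain z where z: "z \<in> Z" "z < m + h"
    using cInf_lessD[OF Z(1), of "m + h"] h(1) unfolding m_def by auto
  have "m \<le> z"
    using below[of z] z(1) by force
  then have "g z = g 0"
    using h(2)[of z] z(2) \<open>g m = g 0\<close> by (cases "z = m") auto
  then show False
    using z(1) by (simp add: Z_def)
qed

lemma inverse_occupation_time_eqI:
  assumes "0 \<le> u" "occupation_time A \<omega> u \<le> t" "\<And>r. u < r \<Longrightarrow> t < occupation_time A \<omega> r"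
  shows "inverse_occupation_time A \<omega> t = u"
  unfolding inverse_occupation_time_def
  by (rule cSup_eq_maximum) (use assms in \<open>auto simp: not_less[symmetric]\<close>)

context
  fixes \<omega> :: "real \<Rightarrow> 'a" and K A :: "'a set"
  assumes \<omega>: "\<omega> \<in> cadlag_paths K"
    and unbounded: "\<forall>u. \<exists>s\<ge>0. u < occupation_time A \<omega> s"
begin

text \<open>The occupation time is 1-Lipschitz, so the supremum is attained with the exact value
  \<open>t\<close>; being the last such time, it is followed by strictly larger occupation times.
  Unboundedness is what makes the supremum finite.\<close>

lemma inverse_occupation_time:
  assumes t: "0 \<le> t"
  shows inverse_occupation_time_nonneg: "0 \<le> inverse_occupation_time A \<omega> t"
    and occupation_time_inverse: "occupation_time A \<omega> (inverse_occupation_time A \<omega> t) = t"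
    and occupation_time_gt: "\<And>r. inverse_occupation_time A \<omega> t < r \<Longrightarrow> t < occupation_time A \<omega> r"
    and inverse_occupation_time_ge: "t \<le> inverse_occupation_time A \<omega> t"
proof -
  let ?T = "occupation_time A \<omega>"
  define Z where "Z = {s. 0 \<le> s \<and> ?T s \<le> t}"
  define S where "S = inverse_occupation_time A \<omega> t"
  have S: "S = Sup Z"
    by (simp add: S_def Z_def inverse_occupation_time_def)
  have Z0: "0 \<in> Z"
    using t by (simp add: Z_def)
  obtain b where b: "0 \<le> b" "t < ?T b"
    using unbounded by blast
  have bdd: "bdd_above Z"
  proof (rule bdd_aboveI[of _ b])
    fix s assume "s \<in> Z"
    then show "s \<le> b"
      using b occupation_time_mono[OF \<omega>, of b s A] by (force simp: Z_def)
  qed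
  show nn: "0 \<le> S"
    unfolding S by (rule cSup_upper[OF Z0 bdd])
  show gt: "t < ?T r" if "S < r" for r
    using cSup_upper[OF _ bdd, of r] that nn unfolding S Z_def by force
  have "?T S \<le> t"
  proof (rule ccontr)
    assume "\<not> ?T S \<le> t"
    \<comment> \<open>An element of \<open>Z\<close> closer to \<open>S\<close> than the excess
      \<open>?T S - t\<close> contradicts the Lipschitz bound.\<close>
    then have "Sup Z - (?T S - t) < Sup Z"
      by simp
    then obtain s where s: "s \<in> Z" "S - (?T S - t) < s"
      using less_cSupD[of Z] Z0 unfolding S by blast
    have "s \<le> S"
      unfolding S by (rule cSup_upper[OF s(1) bdd])
    then have "?T S - ?T s \<le> S - s"
      using s(1) by (intro occupation_time_diff_le[OF \<omega>]) (auto simp: Z_def)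
    then show False
      using s by (auto simp: Z_def)
  qed
  moreover have "t \<le> ?T S"
  proof (rule ccontr)
    assume "\<not> t \<le> ?T S"
    \<comment> \<open>Waiting after \<open>S\<close> for exactly the deficit adds at most the
      deficit to the occupation time, yet any time after \<open>S\<close> already exceeds
      \<open>t\<close>.\<close>
    then have "?T (S + (t - ?T S)) - ?T S \<le> t - ?T S" "t < ?T (S + (t - ?T S))"
      using occupation_time_diff_le[OF \<omega> nn, of "S + (t - ?T S)" A] gt[of "S + (t - ?T S)"]
      by simp_all
    then show False by simp
  qed
  ultimately show *: "?T S = t" by simp
  show "t \<le> S"
    using occupation_time_le[OF \<omega> nn, of A] * by simp
qed

text \<open>The clock must run immediately after the inverse time, but on a plateau outside of
  \<open>A\<close> it stands still.\<close>

lemma path_at_inverse_occupation_time_mem: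
  assumes t: "0 \<le> t"
  shows "\<omega> (inverse_occupation_time A \<omega> t) \<in> A"
proof (rule ccontr)
  define S where "S = inverse_occupation_time A \<omega> t"
  note S = inverse_occupation_time[OF t, folded S_def]
  assume "\<not> ?thesis"
  then have notA: "\<omega> S \<notin> A"
    by (simp add: S_def)
  obtain h where h: "0 < h" "\<And>s. S \<le> s \<Longrightarrow> s < S + h \<Longrightarrow> \<omega> s = \<omega> S"
    using cadlag_paths_right[OF \<omega> S(1)] by blast
  have "occupation_time A \<omega> (S + h / 2) - occupation_time A \<omega> S = (S + h / 2 - S) * indicator A (\<omega> S)"
    by (rule occupation_time_const[OF \<omega> S(1)]) (use h(1) in \<open>auto intro!: h(2)\<close>)
  then show False
    using S(2) S(3)[of "S + h / 2"] h(1) notA by simp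
qed

text \<open>A path in \<open>A\<close> at time \<open>u\<close> stays there for a while, so the
  clock strictly increases after \<open>u\<close>, and \<open>u\<close> is the last time with its
  clock value.\<close>

lemma inverse_occupation_time_occupation_time:
  assumes u: "0 \<le> u" and A: "\<omega> u \<in> A"
  shows "inverse_occupation_time A \<omega> (occupation_time A \<omega> u) = u"
proof (rule inverse_occupation_time_eqI[OF u order_refl])
  fix r assume "u < r"
  obtain h where h: "0 < h" "\<And>s. u \<le> s \<Longrightarrow> s < u + h \<Longrightarrow> \<omega> s = \<omega> u"
    using cadlag_paths_right[OF \<omega> u] by blast
  define v where "v = min r (u + h / 2)"
  have v: "u < v" "v < u + h" "v \<le> r"
    using \<open>u < r\<close> h(1) by (auto simp: v_def)
  have "occupation_time A \<omega> v - occupation_time A \<omega> u = (v - u) * indicator A (\<omega> u)"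
    by (rule occupation_time_const[OF \<omega> u]) (use v in \<open>auto intro!: h(2)\<close>)
  moreover have "occupation_time A \<omega> v \<le> occupation_time A \<omega> r"
    using u v by (intro occupation_time_mono[OF \<omega>]) auto
  ultimately show "occupation_time A \<omega> u < occupation_time A \<omega> r"
    using A v(1) by simp
qed

lemma trace_path_unbounded:
  "0 \<le> t \<Longrightarrow> trace_path A \<omega> t = \<omega> (inverse_occupation_time A \<omega> t)"
  using unbounded by (simp add: trace_path_def)

lemma trace_path_occupation_time:
  assumes "0 \<le> u" "\<omega> u \<in> A"
  shows "trace_path A \<omega> (occupation_time A \<omega> u) = \<omega> u"
  using trace_path_unbounded[OF occupation_time_nonneg[of A \<omega> u]] inverse_occupation_time_occupation_time[OF assms]
  by simp

text \<open>A plateau of the path inside \<open>A\<close> reappears in the trace with the same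
  length, starting at the clock time of its left end.\<close>

lemma trace_path_after:
  assumes u: "0 \<le> u" "\<omega> u \<in> A" and h: "\<And>s. u \<le> s \<Longrightarrow> s < u + h \<Longrightarrow> \<omega> s = \<omega> u"
    and r: "0 \<le> r" "r < h"
  shows "occupation_time A \<omega> (u + r) = occupation_time A \<omega> u + r"
    and "trace_path A \<omega> (occupation_time A \<omega> u + r) = \<omega> u"
proof -
  have "occupation_time A \<omega> (u + r) - occupation_time A \<omega> u = (u + r - u) * indicator A (\<omega> u)"
    by (rule occupation_time_const[OF \<omega> u(1)]) (use r in \<open>auto intro!: h\<close>)
  then show *: "occupation_time A \<omega> (u + r) = occupation_time A \<omega> u + r"
    using u(2) by simp
  have "\<omega> (u + r) = \<omega> u"
    using r by (intro h) auto
  then show "trace_path A \<omega> (occupation_time A \<omega> u + r) = \<omega> u"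
    using trace_path_occupation_time[of "u + r"] u r(1) by (simp add: *)
qed

lemma cadlag_trace_path_unbounded: "trace_path A \<omega> \<in> cadlag_paths A"
proof (rule cadlag_pathsI)
  show "trace_path A \<omega> \<in> {0..} \<rightarrow>\<^sub>E A"
  proof (rule PiE_I)
    fix t :: real assume "t \<in> {0..}"
    then show "trace_path A \<omega> t \<in> A"
      using trace_path_unbounded[of t] path_at_inverse_occupation_time_mem[of t] by simp
  qed (simp add: trace_path_def)
next
  fix t :: real assume t: "0 \<le> t"
  define u where "u = inverse_occupation_time A \<omega> t"
  have u: "0 \<le> u" "occupation_time A \<omega> u = t" "\<omega> u \<in> A" "trace_path A \<omega> t = \<omega> u"
    using inverse_occupation_time[OF t] path_at_inverse_occupation_time_mem[OF t] trace_path_unbounded[OF t]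
    by (auto simp: u_def)
  obtain h where h: "0 < h" "\<And>s. u \<le> s \<Longrightarrow> s < u + h \<Longrightarrow> \<omega> s = \<omega> u"
    using cadlag_paths_right[OF \<omega> u(1)] by blast
  have "trace_path A \<omega> s = trace_path A \<omega> t" if "t < s" "s < t + h" for s
    using trace_path_after(2)[OF u(1,3) h(2), where r = "s - t"] that u(2,4) by simp
  with h(1) show "\<exists>h>0. \<forall>s. t < s \<and> s < t + h \<longrightarrow> trace_path A \<omega> s = trace_path A \<omega> t"
    by blast
next
  fix t :: real assume t: "0 < t"
  let ?S = "inverse_occupation_time A \<omega>"
  \<comment> \<open>Strictness matters: below it keeps \<open>?S s\<close> strictly before
    \<open>v\<close>, so that the plateau to the left of \<open>v\<close> applies and the value of
    the path at \<open>v\<close> is irrelevant.\<close>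
  have mono: "?S r < ?S s" if "0 \<le> r" "r < s" for r s
  proof (rule ccontr)
    assume "\<not> ?S r < ?S s"
    then have "occupation_time A \<omega> (?S s) \<le> occupation_time A \<omega> (?S r)"
      using that by (intro occupation_time_mono[OF \<omega>] inverse_occupation_time) auto
    then show False
      using occupation_time_inverse[of r] occupation_time_inverse[of s] that by simp
  qed
  have bdd: "bdd_above (?S ` {0..<t})"
    by (rule bdd_aboveI[of _ "?S t"]) (use mono[of _ t] in \<open>auto intro: less_imp_le\<close>)
  have ne: "?S ` {0..<t} \<noteq> {}"
    using t by simp
  \<comment> \<open>\<open>v\<close> is the left limit of the inverse clock at \<open>t\<close>. It
    may be smaller than \<open>?S t\<close>, namely when an excursion out of \<open>A\<close> is cut
    out at clock time \<open>t\<close>.\<close>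
  define v where "v = Sup (?S ` {0..<t})"
  have le_v: "?S s \<le> v" if "0 \<le> s" "s < t" for s
    unfolding v_def by (rule cSup_upper[OF _ bdd]) (use that in auto)
  have "0 < v"
    using le_v[of "t / 2"] inverse_occupation_time_ge[of "t / 2"] t by simp
  obtain h a where h: "0 < h" "h \<le> v" "\<And>s. v - h < s \<Longrightarrow> s < v \<Longrightarrow> \<omega> s = a"
    using cadlag_paths_left[OF \<omega> \<open>0 < v\<close>] by blast
  obtain s0 where s0: "0 \<le> s0" "s0 < t" "v - h < ?S s0"
    using less_cSupD[OF ne, of "v - h"] h(1) unfolding v_def by auto
  have "trace_path A \<omega> s = a" if "t - (t - s0) < s" "s < t" for s
  proof -
    have "v - h < ?S s"
      using mono[of s0 s] s0 that by simp
    moreover have "?S s < v"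
      using mono[of s "(s + t) / 2"] le_v[of "(s + t) / 2"] s0 that by simp
    ultimately show ?thesis
      using trace_path_unbounded[of s] h(3)[of "?S s"] s0 that by simp
  qed
  moreover have "0 < t - s0"
    using s0 by simp
  ultimately show "\<exists>h>0. \<exists>a. \<forall>s. t - h < s \<and> s < t \<longrightarrow> trace_path A \<omega> s = a"
    by blast
qed

text \<open>Read along the clock of \<open>A\<close>, the trace collects the same time in
  \<open>B\<close> as the path does. Both sides are continuous in \<open>u\<close> and their
  difference is constant on each plateau: inside \<open>A\<close> they grow at the same rate,
  outside of \<open>A\<close> both stand still.\<close>

lemma occupation_time_trace_path:
  assumes "B \<subseteq> A" "0 \<le> u"
  shows "occupation_time B (trace_path A \<omega>) (occupation_time A \<omega> u) = occupation_time B \<omega> u"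
proof -
  let ?T = "occupation_time A \<omega>" and ?tr = "trace_path A \<omega>"
  let ?g = "\<lambda>u. occupation_time B ?tr (?T u) - occupation_time B \<omega> u"
  note tr = cadlag_trace_path_unbounded
  have "?g u = ?g 0"
  proof (rule right_locally_const_imp_const[OF _ _ assms(2)])
    have "continuous_on {0..} (\<lambda>u. occupation_time B ?tr (?T u))"
      by (rule continuous_on_compose2[OF continuous_on_occupation_time[OF tr] continuous_on_occupation_time[OF \<omega>]])
         (auto simp: occupation_time_nonneg)
    then show "continuous_on {0..} ?g"
      by (intro continuous_on_diff continuous_on_occupation_time[OF \<omega>])
  next
    fix u :: real assume u: "0 \<le> u"
    obtain h where h: "0 < h" "\<And>s. u \<le> s \<Longrightarrow> s < u + h \<Longrightarrow> \<omega> s = \<omega> u"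
      using cadlag_paths_right[OF \<omega> u] by blast
    have "?g r = ?g u" if r: "u < r" "r < u + h" for r
    proof -
      have B: "occupation_time B \<omega> r - occupation_time B \<omega> u = (r - u) * indicator B (\<omega> u)"
        by (rule occupation_time_const[OF \<omega> u]) (use r in \<open>auto intro!: h(2)\<close>)
      show ?thesis
      proof (cases "\<omega> u \<in> A")
        case True
        note after = trace_path_after[OF u True h(2)]
        have T: "?T r = ?T u + (r - u)"
          using after(1)[where r = "r - u"] r by simp
        have "occupation_time B ?tr (?T u + (r - u)) - occupation_time B ?tr (?T u)
            = (?T u + (r - u) - ?T u) * indicator B (\<omega> u)"
        proof (rule occupation_time_const[OF tr occupation_time_nonneg])
          fix s assume "?T u < s" "s < ?T u + (r - u)"
          then show "?tr s = \<omega> u"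
            using after(2)[where r = "s - ?T u"] r by simp
        qed (use r in simp)
        with B show ?thesis
          unfolding T by simp
      next
        case False
        have "?T r - ?T u = (r - u) * indicator A (\<omega> u)"
          by (rule occupation_time_const[OF \<omega> u]) (use r in \<open>auto intro!: h(2)\<close>)
        moreover have "\<omega> u \<notin> B"
          using False \<open>B \<subseteq> A\<close> by auto
        ultimately show ?thesis
          using False B by simp
      qed
    qed
    with h(1) show "\<exists>h>0. \<forall>r. u < r \<and> r < u + h \<longrightarrow> ?g r = ?g u"
      by blast
  qed
  then show ?thesis
    by simp
qed

text \<open>At clock time \<open>occupation_time A \<omega> u\<close> the two quantities agree. The
  clock is behind \<open>u\<close> by the time spent outside of \<open>A\<close>, and the trace can
  add at most this amount until \<open>u\<close>.\<close>

lemma occupation_time_trace_path_bound: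
  assumes "B \<subseteq> A" "0 \<le> u"
  shows "\<bar>occupation_time B (trace_path A \<omega>) u - occupation_time B \<omega> u\<bar> \<le> occupation_time (- A) \<omega> u"
proof -
  let ?T = "occupation_time A \<omega>" and ?tr = "trace_path A \<omega>"
  note tr = cadlag_trace_path_unbounded
  have *: "0 \<le> ?T u" "?T u \<le> u"
    using occupation_time_le[OF \<omega> assms(2)] by (auto simp: occupation_time_nonneg)
  show ?thesis
    using occupation_time_trace_path[OF assms] occupation_time_mono[OF tr *, of B]
      occupation_time_diff_le[OF tr *, of B] occupation_time_Compl[OF \<omega> assms(2), of A]
    by simp
qed

end

lemma cadlag_paths_const:
  assumes "a \<in> K"
  shows "(\<lambda>t\<in>{0::real..}. a) \<in> cadlag_paths K"
proof (rule cadlag_pathsI)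
  fix t :: real assume "0 < t"
  moreover have "(\<lambda>t\<in>{0..}. a) s = a" if "t - t < s" for s
    using that by simp
  ultimately show "\<exists>h>0. \<exists>b. \<forall>s. t - h < s \<and> s < t \<longrightarrow> (\<lambda>t\<in>{0..}. a) s = b"
    by blast
qed (use assms in \<open>auto intro!: exI[of _ "1::real"]\<close>)

lemma cadlag_trace_path:
  assumes \<omega>: "\<omega> \<in> cadlag_paths K" and A: "A \<noteq> {}"
  shows "trace_path A \<omega> \<in> cadlag_paths A"
proof (cases "\<forall>u. \<exists>s\<ge>0. u < occupation_time A \<omega> s")
  case True
  then show ?thesis
    by (rule cadlag_trace_path_unbounded[OF \<omega>])
next
  case False
  have "(SOME a. a \<in> A) \<in> A"
    using A by (simp add: some_in_eq)
  then have "(\<lambda>t\<in>{0::real..}. SOME a. a \<in> A) \<in> cadlag_paths A"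
    by (rule cadlag_paths_const)
  moreover have "trace_path A \<omega> = (\<lambda>t\<in>{0..}. SOME a. a \<in> A)"
    unfolding trace_path_def by (simp only: False if_False)
  ultimately show ?thesis
    by simp
qed

section \<open>Measurability of the trace\<close>

lemma measurable_unbounded_occupation_time:
  "{\<omega> \<in> space (path_space K). \<forall>u. \<exists>s\<ge>0. u < occupation_time A \<omega> s} \<in> sets (path_space K)"
proof -
  note [measurable] = borel_measurable_occupation_time[of A _ K]
  \<comment> \<open>Monotonicity of the occupation time permits replacing both real quantifiers by
    quantifiers over the naturals.\<close>
  have "{\<omega> \<in> space (path_space K). \<forall>u. \<exists>s\<ge>0. u < occupation_time A \<omega> s}
      = {\<omega> \<in> space (path_space K). \<forall>u::nat. \<exists>s::nat. real u < occupation_time A \<omega> (real s)}"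
  proof (intro Collect_cong conj_cong refl iffI allI)
    fix \<omega> :: "real \<Rightarrow> 'a" and u :: nat
    assume \<omega>: "\<omega> \<in> space (path_space K)" and "\<forall>u. \<exists>s\<ge>0. u < occupation_time A \<omega> s"
    then obtain s where s: "0 \<le> s" "real u < occupation_time A \<omega> s"
      by blast
    have "occupation_time A \<omega> s \<le> occupation_time A \<omega> (real (nat \<lceil>s\<rceil>))"
      using \<omega> s(1) by (intro occupation_time_mono[of _ K]) auto
    with s(2) have "real u < occupation_time A \<omega> (real (nat \<lceil>s\<rceil>))"
      by (rule less_le_trans)
    then show "\<exists>s::nat. real u < occupation_time A \<omega> (real s)"
      by blast
  next
    fix \<omega> :: "real \<Rightarrow> 'a" and u :: real
    assume *: "\<forall>u::nat. \<exists>s::nat. real u < occupation_time A \<omega> (real s)"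
    obtain n where "u \<le> real n"
      using real_arch_simple by blast
    with * show "\<exists>s\<ge>0. u < occupation_time A \<omega> s"
      by (meson le_less_trans of_nat_0_le_iff)
  qed
  also have "\<dots> \<in> sets (path_space K)"
    by measurable
  finally show ?thesis .
qed

lemma measurable_trace_path:
  assumes K: "countable K" and A: "A \<noteq> {}" "A \<subseteq> K"
  shows "trace_path A \<in> measurable (path_space K) (path_space A)"
proof (rule measurable_path_spaceI)
  fix t :: real assume t: "0 \<le> t"
  let ?U = "\<lambda>\<omega>. \<forall>u. \<exists>s\<ge>0. u < occupation_time A \<omega> s"
  let ?S = "\<lambda>\<omega>. inverse_occupation_time A \<omega> t"
  \<comment> \<open>The defaults make \<open>\<tau>\<close> nonnegative for every function, also
    where the inverse clock has no meaning, as evaluation at a random time requires.\<close>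
  define \<tau> where "\<tau> \<omega> = (if ?U \<omega> then max 0 (?S \<omega>) else 0)" for \<omega>
  have \<tau>: "\<tau> \<in> borel_measurable (path_space K)"
  proof (rule borel_measurableI_greater)
    fix c :: real
    \<comment> \<open>For \<open>c \<ge> 0\<close>, the inverse clock exceeds \<open>c\<close> iff
      some rational time after \<open>c\<close> still has occupation time at most \<open>t\<close>:
      the inverse is the last such time.\<close>
    have "{\<omega> \<in> space (path_space K). c < \<tau> \<omega>} =
      {\<omega> \<in> space (path_space K). c < 0 \<or> ?U \<omega> \<and> (\<exists>q\<in>\<rat>. c < q \<and> 0 \<le> q \<and> occupation_time A \<omega> q \<le> t)}"
    proof (intro Collect_cong conj_cong refl)
      fix \<omega> :: "real \<Rightarrow> 'a" assume "\<omega> \<in> space (path_space K)"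
      then have \<omega>: "\<omega> \<in> cadlag_paths K" by simp
      show "c < \<tau> \<omega> \<longleftrightarrow> c < 0 \<or> ?U \<omega> \<and> (\<exists>q\<in>\<rat>. c < q \<and> 0 \<le> q \<and> occupation_time A \<omega> q \<le> t)"
      proof (cases "c < 0 \<or> \<not> ?U \<omega>")
        case True
        then show ?thesis
          by (auto simp: \<tau>_def)
      next
        case False
        then have c: "0 \<le> c" and U: "?U \<omega>" by auto
        note S = inverse_occupation_time[OF \<omega> U t]
        have "c < ?S \<omega> \<longleftrightarrow> (\<exists>q\<in>\<rat>. c < q \<and> 0 \<le> q \<and> occupation_time A \<omega> q \<le> t)"
        proof
          assume "c < ?S \<omega>"
          then obtain q where q: "q \<in> \<rat>" "c < q" "q < ?S \<omega>"
            using Rats_dense_in_real by blast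
          moreover have "occupation_time A \<omega> q \<le> occupation_time A \<omega> (?S \<omega>)"
            using c q by (intro occupation_time_mono[OF \<omega>]) auto
          ultimately show "\<exists>q\<in>\<rat>. c < q \<and> 0 \<le> q \<and> occupation_time A \<omega> q \<le> t"
            using c S(2) by (intro bexI[of _ q]) auto
        next
          assume "\<exists>q\<in>\<rat>. c < q \<and> 0 \<le> q \<and> occupation_time A \<omega> q \<le> t"
          then obtain q where "c < q" "occupation_time A \<omega> q \<le> t" by blast
          then show "c < ?S \<omega>"
            using S(3)[of q] by force
        qed
        with False S(1) show ?thesis
          by (simp add: \<tau>_def)
      qed
    qed
    also have "\<dots> = {\<omega> \<in> space (path_space K). c < 0} \<union>
        ({\<omega> \<in> space (path_space K). ?U \<omega>} \<inter>
          (\<Union>q\<in>{q \<in> \<rat>. c < q \<and> 0 \<le> q}. {\<omega> \<in> space (path_space K). occupation_time A \<omega> q \<le> t}))"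
      by blast
    also have "\<dots> \<in> sets (path_space K)"
    proof (intro sets.Un sets.Int measurable_unbounded_occupation_time sets.countable_UN'' sets.sets_Collect_const)
      show "countable {q \<in> \<rat>. c < q \<and> 0 \<le> q}"
        using countable_rat by (rule countable_subset[rotated]) auto
      show "{\<omega> \<in> space (path_space K). occupation_time A \<omega> q \<le> t} \<in> sets (path_space K)" for q
        using borel_measurable_occupation_time[of A q K]
        by (intro borel_measurable_le) auto
    qed
    finally show "{\<omega> \<in> space (path_space K). c < \<tau> \<omega>} \<in> sets (path_space K)" .
  qed
  have SOME: "(SOME a. a \<in> A) \<in> A"
    using A by (simp add: some_in_eq)
  have "(\<lambda>\<omega>. if ?U \<omega> then \<omega> (\<tau> \<omega>) else (SOME a. a \<in> A)) \<in> measurable (path_space K) (count_space K)"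
  proof (rule measurable_If)
    show "(\<lambda>\<omega>. \<omega> (\<tau> \<omega>)) \<in> measurable (path_space K) (count_space K)"
      by (rule measurable_path_at[OF K \<tau>]) (simp add: \<tau>_def)
    show "(\<lambda>\<omega>. SOME a. a \<in> A) \<in> measurable (path_space K) (count_space K)"
      using SOME A(2) by auto
    show "{\<omega> \<in> space (path_space K). ?U \<omega>} \<in> sets (path_space K)"
      by (rule measurable_unbounded_occupation_time)
  qed
  also have "?this \<longleftrightarrow> (\<lambda>\<omega>. trace_path A \<omega> t) \<in> measurable (path_space K) (count_space K)"
  proof (rule measurable_cong)
    fix \<omega> :: "real \<Rightarrow> 'a" assume "\<omega> \<in> space (path_space K)"
    then show "(if ?U \<omega> then \<omega> (\<tau> \<omega>) else (SOME a. a \<in> A)) = trace_path A \<omega> t"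
      using inverse_occupation_time_nonneg[of \<omega> K A t] t by (auto simp: trace_path_def \<tau>_def)
  qed
  finally have m: "(\<lambda>\<omega>. trace_path A \<omega> t) \<in> measurable (path_space K) (count_space K)" .
  show "(\<lambda>\<omega>. trace_path A \<omega> t) \<in> measurable (path_space K) (count_space A)"
    unfolding measurable_count_space_eq_countable[OF countable_subset[OF A(2) K]]
  proof (intro conjI ballI)
    show "(\<lambda>\<omega>. trace_path A \<omega> t) \<in> space (path_space K) \<rightarrow> A"
      using cadlag_paths_range[OF cadlag_trace_path[OF _ A(1)] t] by (auto simp: Pi_iff)
    show "(\<lambda>\<omega>. trace_path A \<omega> t) -` {a} \<inter> space (path_space K) \<in> sets (path_space K)" if "a \<in> A" for a
      using measurable_sets[OF m, of "{a}"] that A(2) by auto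
  qed
qed (simp add: cadlag_trace_path[OF _ A(1)])


subsection \<open>Finite Markov chains\<close>

locale finite_chain =
  fixes K :: "'a set" and P :: "'a \<Rightarrow> (real \<Rightarrow> 'a) measure"
  assumes finite_K: "finite K" and markov: "markov_chain K P"
begin

lemma prob_space_P: "x \<in> K \<Longrightarrow> prob_space (P x)"
  and sets_P: "x \<in> K \<Longrightarrow> sets (P x) = sets (path_space K)"
  using markov by (auto simp: markov_chain_def)

lemma space_P: "x \<in> K \<Longrightarrow> space (P x) = cadlag_paths K"
  using sets_eq_imp_space_eq[OF sets_P] by simp

lemma measurable_P: "x \<in> K \<Longrightarrow> measurable (P x) N = measurable (path_space K) N"
  by (rule measurable_cong_sets[OF sets_P refl])

lemma sets_path_at:
  assumes "x \<in> K" "0 \<le> t"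
  shows "{\<omega> \<in> space (P x). \<omega> t \<in> B} \<in> sets (P x)"
proof -
  have "{\<omega> \<in> space (P x). \<omega> t \<in> B} = (\<lambda>\<omega>. \<omega> t) -` (B \<inter> K) \<inter> space (path_space K)"
    using cadlag_paths_range[OF _ assms(2)] by (auto simp: space_P[OF assms(1)])
  also have "\<dots> \<in> sets (path_space K)"
    by (rule measurable_sets[OF measurable_path_component[OF assms(2)]]) auto
  finally show ?thesis
    using sets_P[OF assms(1)] by simp
qed

lemma sets_path_at_eq:
  assumes "x \<in> K" "0 \<le> t"
  shows "{\<omega> \<in> space (P x). \<omega> t = y} \<in> sets (P x)"
  using sets_path_at[OF assms, of "{y}"] by simp

lemma sets_path_at_Int:
  assumes "x \<in> K" "0 \<le> t" "S \<in> sets (P x)"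
  shows "{\<omega> \<in> S. \<omega> t \<in> B} \<in> sets (P x)"
proof -
  have "{\<omega> \<in> S. \<omega> t \<in> B} = S \<inter> {\<omega> \<in> space (P x). \<omega> t \<in> B}"
    using sets.sets_into_space[OF assms(3)] by auto
  then show ?thesis
    using assms(3) sets_path_at[OF assms(1,2)] by simp
qed

lemma sets_path_fdd:
  assumes "x \<in> K" "finite J" "J \<subseteq> {0..}" "S \<in> sets (P x)"
  shows "{\<omega> \<in> S. \<forall>r\<in>J. \<omega> r \<in> C r} \<in> sets (P x)"
  using assms(2,3)
proof (induction J)
  case (insert r J)
  have "{\<omega> \<in> S. \<forall>r\<in>insert r J. \<omega> r \<in> C r} = {\<omega> \<in> {\<omega> \<in> S. \<forall>r\<in>J. \<omega> r \<in> C r}. \<omega> r \<in> C r}"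
    by auto
  also have "\<dots> \<in> sets (P x)"
    using insert by (intro sets_path_at_Int[OF assms(1)]) auto
  finally show ?case .
qed (simp add: assms)

text \<open>The Markov property is stated for prescribed values; this finite decomposition transfers
  it to events that prescribe sets of values.\<close>

lemma measure_fdd_sum:
  assumes x: "x \<in> K" and J: "finite J" "J \<subseteq> {0..}" and S: "S \<in> sets (P x)"
  shows "measure (P x) {\<omega> \<in> S. \<forall>r\<in>J. \<omega> r \<in> C r}
    = (\<Sum>a\<in>Pi\<^sub>E J (\<lambda>r. C r \<inter> K). measure (P x) {\<omega> \<in> S. \<forall>r\<in>J. \<omega> r = a r})"
proof -
  interpret prob_space "P x" by (rule prob_space_P[OF x])
  let ?S = "\<lambda>a. {\<omega> \<in> S. \<forall>r\<in>J. \<omega> r = a r}"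
  have "{\<omega> \<in> S. \<forall>r\<in>J. \<omega> r \<in> C r} = (\<Union>a\<in>Pi\<^sub>E J (\<lambda>r. C r \<inter> K). ?S a)"
  proof (intro equalityI subsetI)
    fix \<omega> assume \<omega>: "\<omega> \<in> {\<omega> \<in> S. \<forall>r\<in>J. \<omega> r \<in> C r}"
    then have "\<omega> \<in> cadlag_paths K"
      using sets.sets_into_space[OF S] space_P[OF x] by auto
    then have "restrict \<omega> J \<in> Pi\<^sub>E J (\<lambda>r. C r \<inter> K)" "\<omega> \<in> ?S (restrict \<omega> J)"
      using \<omega> J(2) cadlag_paths_range by auto
    then show "\<omega> \<in> (\<Union>a\<in>Pi\<^sub>E J (\<lambda>r. C r \<inter> K). ?S a)"
      by blast
  qed auto
  moreover have "measure (P x) (\<Union>a\<in>Pi\<^sub>E J (\<lambda>r. C r \<inter> K). ?S a)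
      = (\<Sum>a\<in>Pi\<^sub>E J (\<lambda>r. C r \<inter> K). measure (P x) (?S a))"
  proof (rule finite_measure_finite_Union)
    show "finite (Pi\<^sub>E J (\<lambda>r. C r \<inter> K))"
      using J(1) finite_K by (intro finite_PiE) auto
    show "?S ` Pi\<^sub>E J (\<lambda>r. C r \<inter> K) \<subseteq> sets (P x)"
      using sets_path_fdd[OF x J S, of "\<lambda>r. {a r}" for a] by auto
    show "disjoint_family_on ?S (Pi\<^sub>E J (\<lambda>r. C r \<inter> K))"
      unfolding disjoint_family_on_def
    proof (intro ballI impI)
      fix a b assume "a \<in> Pi\<^sub>E J (\<lambda>r. C r \<inter> K)" "b \<in> Pi\<^sub>E J (\<lambda>r. C r \<inter> K)" "a \<noteq> b"
      then obtain r where "r \<in> J" "a r \<noteq> b r"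
        by (meson PiE_ext)
      then show "?S a \<inter> ?S b = {}"
        by auto
    qed
  qed
  ultimately show ?thesis
    by simp
qed

lemma measure_at_sum:
  assumes x: "x \<in> K" and t: "0 \<le> t" and S: "S \<in> sets (P x)"
  shows "measure (P x) {\<omega> \<in> S. \<omega> t \<in> B} = (\<Sum>y\<in>B \<inter> K. measure (P x) {\<omega> \<in> S. \<omega> t = y})"
proof -
  interpret prob_space "P x" by (rule prob_space_P[OF x])
  have "{\<omega> \<in> S. \<omega> t \<in> B} = (\<Union>y\<in>B \<inter> K. {\<omega> \<in> S. \<omega> t = y})"
    using sets.sets_into_space[OF S] space_P[OF x] cadlag_paths_range[of _ K, OF _ t] by blast
  moreover have "measure (P x) (\<Union>y\<in>B \<inter> K. {\<omega> \<in> S. \<omega> t = y})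
      = (\<Sum>y\<in>B \<inter> K. measure (P x) {\<omega> \<in> S. \<omega> t = y})"
    using finite_K sets_path_at_Int[OF x t S, of "{y}" for y]
    by (intro finite_measure_finite_Union) (auto simp: disjoint_family_on_def)
  ultimately show ?thesis
    by simp
qed

lemma markov_eq:
  assumes "x \<in> K" "y \<in> K" "z \<in> K" "0 \<le> s" "0 \<le> t" "finite I" "I \<subseteq> {0..s}"
  shows "measure (P x) {\<omega> \<in> space (P x). (\<forall>r\<in>I. \<omega> r = a r) \<and> \<omega> s = y \<and> \<omega> (s + t) = z} =
    measure (P x) {\<omega> \<in> space (P x). (\<forall>r\<in>I. \<omega> r = a r) \<and> \<omega> s = y} *
    measure (P y) {\<omega> \<in> space (P y). \<omega> t = z}"
  using markov assms unfolding markov_chain_def by blast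

text \<open>Summing the pointwise Markov property over the earlier values \<open>a\<close> and the
  later value \<open>z\<close>, the double sum factorises.\<close>

lemma markov_fdd:
  assumes x: "x \<in> K" and y: "y \<in> K" and s: "0 \<le> s" and t: "0 \<le> t" and J: "finite J" "J \<subseteq> {0..s}"
  shows "measure (P x) {\<omega> \<in> space (P x). (\<forall>r\<in>J. \<omega> r \<in> C r) \<and> \<omega> s = y \<and> \<omega> (s + t) \<in> B} =
    measure (P x) {\<omega> \<in> space (P x). (\<forall>r\<in>J. \<omega> r \<in> C r) \<and> \<omega> s = y} *
    measure (P y) {\<omega> \<in> space (P y). \<omega> t \<in> B}"
proof -
  have J0: "J \<subseteq> {0..}" using J(2) by auto
  let ?S = "{\<omega> \<in> space (P x). \<omega> s = y}" and ?Pi = "Pi\<^sub>E J (\<lambda>r. C r \<inter> K)"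
  let ?Q = "\<lambda>z. {\<omega> \<in> ?S. \<omega> (s + t) = z}"
  have S: "?S \<in> sets (P x)"
    by (rule sets_path_at_eq[OF x s])
  have Q: "?Q z \<in> sets (P x)" for z
    using sets_path_at_Int[OF x _ S, of "s + t" "{z}"] s t by simp
  have SJ: "{\<omega> \<in> ?S. \<forall>r\<in>J. \<omega> r \<in> C r} \<in> sets (P x)"
    by (rule sets_path_fdd[OF x J(1) J0 S])
  have "measure (P x) {\<omega> \<in> space (P x). (\<forall>r\<in>J. \<omega> r \<in> C r) \<and> \<omega> s = y \<and> \<omega> (s + t) \<in> B}
      = measure (P x) {\<omega> \<in> {\<omega> \<in> ?S. \<forall>r\<in>J. \<omega> r \<in> C r}. \<omega> (s + t) \<in> B}"
    by (rule arg_cong[of _ _ "measure (P x)"]) auto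
  also have "\<dots> = (\<Sum>z\<in>B \<inter> K. measure (P x) {\<omega> \<in> {\<omega> \<in> ?S. \<forall>r\<in>J. \<omega> r \<in> C r}. \<omega> (s + t) = z})"
    using s t by (intro measure_at_sum[OF x _ SJ]) auto
  also have "\<dots> = (\<Sum>z\<in>B \<inter> K. measure (P x) {\<omega> \<in> ?Q z. \<forall>r\<in>J. \<omega> r \<in> C r})"
    by (intro sum.cong refl arg_cong[of _ _ "measure (P x)"]) auto
  also have "\<dots> = (\<Sum>z\<in>B \<inter> K. \<Sum>a\<in>?Pi. measure (P x) {\<omega> \<in> ?Q z. \<forall>r\<in>J. \<omega> r = a r})"
    by (intro sum.cong refl measure_fdd_sum[OF x J(1) J0 Q])
  also have "\<dots> = (\<Sum>z\<in>B \<inter> K. \<Sum>a\<in>?Pi. measure (P x) {\<omega> \<in> ?S. \<forall>r\<in>J. \<omega> r = a r} *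
      measure (P y) {\<omega> \<in> space (P y). \<omega> t = z})"
  proof (intro sum.cong refl)
    fix z a assume z: "z \<in> B \<inter> K"
    have "{\<omega> \<in> ?Q z. \<forall>r\<in>J. \<omega> r = a r}
        = {\<omega> \<in> space (P x). (\<forall>r\<in>J. \<omega> r = a r) \<and> \<omega> s = y \<and> \<omega> (s + t) = z}"
      "{\<omega> \<in> ?S. \<forall>r\<in>J. \<omega> r = a r} = {\<omega> \<in> space (P x). (\<forall>r\<in>J. \<omega> r = a r) \<and> \<omega> s = y}"
      by auto
    then show "measure (P x) {\<omega> \<in> ?Q z. \<forall>r\<in>J. \<omega> r = a r} =
        measure (P x) {\<omega> \<in> ?S. \<forall>r\<in>J. \<omega> r = a r} * measure (P y) {\<omega> \<in> space (P y). \<omega> t = z}"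
      using markov_eq[OF x y _ s t J, of z a] z by simp
  qed
  also have "\<dots> = (\<Sum>a\<in>?Pi. measure (P x) {\<omega> \<in> ?S. \<forall>r\<in>J. \<omega> r = a r}) *
      (\<Sum>z\<in>B \<inter> K. measure (P y) {\<omega> \<in> space (P y). \<omega> t = z})"
    by (simp add: sum_product sum.swap[of _ "B \<inter> K"])
  also have "\<dots> = measure (P x) {\<omega> \<in> ?S. \<forall>r\<in>J. \<omega> r \<in> C r} *
      measure (P y) {\<omega> \<in> space (P y). \<omega> t \<in> B}"
    using measure_fdd_sum[OF x J(1) J0 S, of C] measure_at_sum[OF y t sets.top, of B] by simp
  also have "{\<omega> \<in> ?S. \<forall>r\<in>J. \<omega> r \<in> C r} = {\<omega> \<in> space (P x). (\<forall>r\<in>J. \<omega> r \<in> C r) \<and> \<omega> s = y}"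
    by auto
  finally show ?thesis .
qed

lemma markov_at:
  assumes "x \<in> K" "y \<in> K" "0 \<le> s" "0 \<le> t"
  shows "measure (P x) {\<omega> \<in> space (P x). \<omega> s = y \<and> \<omega> (s + t) \<in> B} =
    measure (P x) {\<omega> \<in> space (P x). \<omega> s = y} * measure (P y) {\<omega> \<in> space (P y). \<omega> t \<in> B}"
  using markov_fdd[OF assms, of "{}" _ B] by simp

lemma AE_start: "x \<in> K \<Longrightarrow> AE \<omega> in P x. \<omega> 0 = x"
proof -
  assume x: "x \<in> K"
  interpret prob_space "P x" by (rule prob_space_P[OF x])
  have "prob {\<omega> \<in> space (P x). \<omega> 0 = x} = 1"
    using markov x by (auto simp: markov_chain_def)
  then have "AE \<omega> in P x. \<omega> \<in> {\<omega> \<in> space (P x). \<omega> 0 = x}"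
    using AE_in_set_eq_1[OF sets_path_at_eq[OF x order_refl]] by blast
  then show ?thesis
    by eventually_elim auto
qed

section \<open>Expected occupation times\<close>

lemma integrable_occupation_time:
  assumes "x \<in> K" "0 \<le> t"
  shows "integrable (P x) (\<lambda>\<omega>. occupation_time B \<omega> t)"
proof -
  interpret prob_space "P x" by (rule prob_space_P[OF assms(1)])
  show ?thesis
  proof (rule integrable_const_bound[of _ t])
    show "AE \<omega> in P x. norm (occupation_time B \<omega> t) \<le> t"
      using occupation_time_le[OF _ assms(2)]
      by (intro AE_I2) (auto simp: space_P[OF assms(1)] occupation_time_nonneg)
  qed (simp add: measurable_P[OF assms(1)] borel_measurable_occupation_time)
qed

text \<open>Expected occupation times become time integrals of one-time probabilities, the only
  quantities to which the Markov property applies. The event \<open>S\<close> leaves room for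
  conditioning on the state at a given time.\<close>

lemma occupation_time_Fubini:
  assumes x: "x \<in> K" and S: "S \<in> sets (P x)" and uv: "0 \<le> u" "u \<le> v"
  shows "set_integrable lborel {u<..v} (\<lambda>s. measure (P x) {\<omega> \<in> S. \<omega> s \<in> B})"
    and "(\<integral>\<omega>. indicator S \<omega> * (occupation_time B \<omega> v - occupation_time B \<omega> u) \<partial>P x)
      = (LINT s:{u<..v}|lborel. measure (P x) {\<omega> \<in> S. \<omega> s \<in> B})"
proof -
  interpret prob_space "P x" by (rule prob_space_P[OF x])
  interpret pair_sigma_finite "P x" lborel ..
  let ?f = "\<lambda>\<omega> s. indicator S \<omega> * (indicator {u<..v} s * indicator B (\<omega> (max 0 s))) :: real"
  have m: "(\<lambda>(\<omega>, s). indicator B (\<omega> (max 0 s)) :: real) \<in> borel_measurable (P x \<Otimes>\<^sub>M lborel)"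
    using borel_measurable_path_indicator[of B K]
      measurable_cong_sets[OF sets_pair_measure_cong[OF sets_P[OF x] refl] refl] by blast
  have f: "integrable (P x \<Otimes>\<^sub>M lborel) (case_prod ?f)"
  proof (rule integrableI_bounded_set[where A = "space (P x) \<times> {u<..v}" and B = 1])
    show "case_prod ?f \<in> borel_measurable (P x \<Otimes>\<^sub>M lborel)"
      using m S by (simp add: case_prod_beta)
    show "emeasure (P x \<Otimes>\<^sub>M lborel) (space (P x) \<times> {u<..v}) < \<infinity>"
      using uv by (subst lborel.emeasure_pair_measure_Times) (auto simp: emeasure_space_1)
    show "AE p in P x \<Otimes>\<^sub>M lborel. p \<in> space (P x) \<times> {u<..v} \<longrightarrow> norm (case_prod ?f p) \<le> 1"
      by (intro AE_I2) (auto simp: indicator_def)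
    show "AE p in P x \<Otimes>\<^sub>M lborel. p \<notin> space (P x) \<times> {u<..v} \<longrightarrow> case_prod ?f p = 0"
      by (intro AE_I2) (auto simp: space_pair_measure indicator_def)
  qed auto
  have 1: "(\<integral>\<omega>. ?f \<omega> s \<partial>P x) = indicator {u<..v} s *\<^sub>R measure (P x) {\<omega> \<in> S. \<omega> s \<in> B}" for s
  proof (cases "s \<in> {u<..v}")
    case True
    then have s: "0 \<le> s" using uv by auto
    have "(\<integral>\<omega>. ?f \<omega> s \<partial>P x) = (\<integral>\<omega>. indicator {\<omega> \<in> S. \<omega> s \<in> B} \<omega> \<partial>P x)"
      using True s by (intro Bochner_Integration.integral_cong) (auto simp: indicator_def)
    also have "\<dots> = measure (P x) {\<omega> \<in> S. \<omega> s \<in> B}"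
      using sets.sets_into_space[OF sets_path_at_Int[OF x s S, of B]]
      by (simp add: Int_absorb2)
    finally show ?thesis
      using True by simp
  qed simp
  have "integrable lborel (\<lambda>s. \<integral>\<omega>. ?f \<omega> s \<partial>P x)"
    using integrable_snd[OF f] by simp
  then show "set_integrable lborel {u<..v} (\<lambda>s. measure (P x) {\<omega> \<in> S. \<omega> s \<in> B})"
    unfolding 1 set_integrable_def .
  have "(\<integral>\<omega>. indicator S \<omega> * (occupation_time B \<omega> v - occupation_time B \<omega> u) \<partial>P x)
      = (\<integral>\<omega>. (\<integral>s. ?f \<omega> s \<partial>lborel) \<partial>P x)"
  proof (intro Bochner_Integration.integral_cong refl)
    fix \<omega> assume "\<omega> \<in> space (P x)"
    then have "occupation_time B \<omega> v - occupation_time B \<omega> u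
        = (\<integral>s. indicator {u<..v} s * indicator B (\<omega> s) \<partial>lborel)"
      using occupation_time_diff[OF _ uv, of \<omega> K B] space_P[OF x]
      by (simp add: set_lebesgue_integral_def)
    also have "\<dots> = (\<integral>s. indicator {u<..v} s * indicator B (\<omega> (max 0 s)) \<partial>lborel)"
      using uv by (intro Bochner_Integration.integral_cong) (auto simp: indicator_def)
    finally show "indicator S \<omega> * (occupation_time B \<omega> v - occupation_time B \<omega> u)
        = (\<integral>s. ?f \<omega> s \<partial>lborel)"
      by simp
  qed
  also have "\<dots> = (\<integral>s. (\<integral>\<omega>. ?f \<omega> s \<partial>P x) \<partial>lborel)"
    by (rule Fubini_integral[OF f, symmetric])
  also have "\<dots> = (LINT s:{u<..v}|lborel. measure (P x) {\<omega> \<in> S. \<omega> s \<in> B})"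
    unfolding 1 set_lebesgue_integral_def ..
  finally show "(\<integral>\<omega>. indicator S \<omega> * (occupation_time B \<omega> v - occupation_time B \<omega> u) \<partial>P x)
      = (LINT s:{u<..v}|lborel. measure (P x) {\<omega> \<in> S. \<omega> s \<in> B})" .
qed

lemma expectation_occupation_time:
  assumes x: "x \<in> K" and t: "0 \<le> t"
  shows "set_integrable lborel {0<..t} (\<lambda>s. measure (P x) {\<omega> \<in> space (P x). \<omega> s \<in> B})"
    and "(\<integral>\<omega>. occupation_time B \<omega> t \<partial>P x)
      = (LINT s:{0<..t}|lborel. measure (P x) {\<omega> \<in> space (P x). \<omega> s \<in> B})"
proof -
  note F = occupation_time_Fubini[OF x sets.top order_refl t, of B]
  show "set_integrable lborel {0<..t} (\<lambda>s. measure (P x) {\<omega> \<in> space (P x). \<omega> s \<in> B})"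
    by (rule F(1))
  have "(\<integral>\<omega>. occupation_time B \<omega> t \<partial>P x)
      = (\<integral>\<omega>. indicator (space (P x)) \<omega> * (occupation_time B \<omega> t - occupation_time B \<omega> 0) \<partial>P x)"
    by (intro Bochner_Integration.integral_cong) auto
  with F(2) show "(\<integral>\<omega>. occupation_time B \<omega> t \<partial>P x)
      = (LINT s:{0<..t}|lborel. measure (P x) {\<omega> \<in> space (P x). \<omega> s \<in> B})"
    by simp
qed

text \<open>A Markov property for a functional of the whole path after \<open>t\<close>, obtained by
  applying the property at each single time \<open>t + r\<close> and integrating over
  \<open>r\<close>.\<close>

lemma markov_occupation_time:
  assumes x: "x \<in> K" and y: "y \<in> K" and t: "0 \<le> t" and d: "0 \<le> d"
  shows "(\<integral>\<omega>. indicator {\<omega> \<in> space (P x). \<omega> t = y} \<omega> *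
      (occupation_time B \<omega> (t + d) - occupation_time B \<omega> t) \<partial>P x)
    = measure (P x) {\<omega> \<in> space (P x). \<omega> t = y} * (\<integral>\<omega>. occupation_time B \<omega> d \<partial>P y)"
proof -
  let ?S = "{\<omega> \<in> space (P x). \<omega> t = y}"
  have S: "?S \<in> sets (P x)"
    by (rule sets_path_at_eq[OF x t])
  have "(\<integral>\<omega>. indicator ?S \<omega> * (occupation_time B \<omega> (t + d) - occupation_time B \<omega> t) \<partial>P x)
      = (\<integral>s. indicator {t<..t + d} s *\<^sub>R measure (P x) {\<omega> \<in> ?S. \<omega> s \<in> B} \<partial>lborel)"
    using occupation_time_Fubini(2)[OF x S t, of "t + d" B] d
    by (simp add: set_lebesgue_integral_def)
  \<comment> \<open>Translation invariance of Lebesgue measure, with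
    \<open>s = t + r\<close>.\<close>
  also have "\<dots> = (\<integral>r. indicator {t<..t + d} (t + r) *\<^sub>R measure (P x) {\<omega> \<in> ?S. \<omega> (t + r) \<in> B} \<partial>lborel)"
    by (subst lborel_integral_real_affine[of 1 _ t]) simp_all
  also have "\<dots> = (\<integral>r. measure (P x) ?S *
      (indicator {0<..d} r *\<^sub>R measure (P y) {\<omega> \<in> space (P y). \<omega> r \<in> B}) \<partial>lborel)"
  proof (intro Bochner_Integration.integral_cong refl)
    fix r :: real
    show "indicator {t<..t + d} (t + r) *\<^sub>R measure (P x) {\<omega> \<in> ?S. \<omega> (t + r) \<in> B} =
        measure (P x) ?S * (indicator {0<..d} r *\<^sub>R measure (P y) {\<omega> \<in> space (P y). \<omega> r \<in> B})"
    proof (cases "r \<in> {0<..d}")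
      case True
      have "{\<omega> \<in> ?S. \<omega> (t + r) \<in> B} = {\<omega> \<in> space (P x). \<omega> t = y \<and> \<omega> (t + r) \<in> B}"
        by auto
      then show ?thesis
        using markov_at[OF x y t, of r B] True by simp
    qed auto
  qed
  also have "\<dots> = measure (P x) ?S * (\<integral>\<omega>. occupation_time B \<omega> d \<partial>P y)"
    unfolding expectation_occupation_time(2)[OF y d] set_lebesgue_integral_def
    by (rule Bochner_Integration.integral_mult_right_zero)
  finally show ?thesis .
qed

text \<open>From a good state \<open>y \<in> G\<close> at time \<open>t\<close>, the error is
  exactly the fraction of the window spent on the opposite side of \<open>A\<close>, whose
  conditional expectation is at most \<open>c\<close> by the Markov property. From other states the
  error is bounded by \<open>1\<close>. In the applications \<open>G\<close> is the union of the
  wells, or the whole state space of the limit chain.\<close>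

lemma average_estimate:
  assumes x: "x \<in> K" and t: "0 \<le> t" and d: "0 < d" and G: "G \<subseteq> K" and c: "0 \<le> c"
    and inside: "\<And>y. y \<in> G \<Longrightarrow> y \<in> A \<Longrightarrow> (\<integral>\<omega>. occupation_time (- A) \<omega> d \<partial>P y) \<le> c * d"
    and outside: "\<And>y. y \<in> G \<Longrightarrow> y \<notin> A \<Longrightarrow> (\<integral>\<omega>. occupation_time A \<omega> d \<partial>P y) \<le> c * d"
  shows "(\<integral>\<omega>. \<bar>indicator A (\<omega> t) - (occupation_time A \<omega> (t + d) - occupation_time A \<omega> t) / d\<bar> \<partial>P x)
    \<le> measure (P x) {\<omega> \<in> space (P x). \<omega> t \<notin> G} + c"
proof -
  interpret prob_space "P x" by (rule prob_space_P[OF x])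
  have fin: "finite G" using G finite_K by (rule finite_subset)
  let ?avg = "\<lambda>B \<omega>. (occupation_time B \<omega> (t + d) - occupation_time B \<omega> t) / d"
  let ?out = "{\<omega> \<in> space (P x). \<omega> t \<notin> G}" and ?at = "\<lambda>y. {\<omega> \<in> space (P x). \<omega> t = y}"
  \<comment> \<open>\<open>B y\<close> is the side of \<open>A\<close> that does not contain
    \<open>y\<close>.\<close>
  define B where "B y = (if y \<in> A then - A else A)" for y
  have avg01: "0 \<le> ?avg C \<omega>" "?avg C \<omega> \<le> 1" if "\<omega> \<in> space (P x)" for C \<omega>
    using that occupation_time_mono[of \<omega> K t "t + d" C] occupation_time_diff_le[of \<omega> K t "t + d" C] t d
    by (auto simp: space_P[OF x])
  have m_at: "?at y \<in> sets (P x)" for y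
    by (rule sets_path_at_eq[OF x t])
  have m_out: "?out \<in> sets (P x)"
    using sets_path_at[OF x t, of "- G"] by simp
  have m_avg: "?avg C \<in> borel_measurable (P x)" for C
    using borel_measurable_occupation_time[of C _ K]
    by (intro borel_measurable_divide borel_measurable_diff) (auto simp: measurable_P[OF x])
  have m_ind: "(\<lambda>\<omega>. indicator A (\<omega> t) :: real) \<in> borel_measurable (P x)"
    unfolding measurable_P[OF x]
    by (rule measurable_compose[OF measurable_path_component[OF t]]) auto
  have i_avg: "integrable (P x) (\<lambda>\<omega>. indicator (?at y) \<omega> * ?avg C \<omega>)" for y C
  proof (rule integrable_const_bound[of _ 1])
    show "AE \<omega> in P x. norm (indicator (?at y) \<omega> * ?avg C \<omega>) \<le> 1"
    proof (rule AE_I2)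
      fix \<omega> assume "\<omega> \<in> space (P x)"
      from avg01[OF this, of C] have "\<bar>?avg C \<omega>\<bar> \<le> 1"
        by linarith
      then show "norm (indicator (?at y) \<omega> * ?avg C \<omega>) \<le> 1"
        by (cases "\<omega> \<in> ?at y")
          (simp_all only: indicator_simps mult_1_left mult_zero_left real_norm_def abs_zero zero_le_one simp_thms)
    qed
    show "(\<lambda>\<omega>. indicator (?at y) \<omega> * ?avg C \<omega>) \<in> borel_measurable (P x)"
      using m_at m_avg by (intro borel_measurable_times borel_measurable_indicator)
  qed
  have i_lhs: "integrable (P x) (\<lambda>\<omega>. \<bar>indicator A (\<omega> t) - ?avg A \<omega>\<bar>)"
  proof (rule integrable_const_bound[of _ 1])
    show "AE \<omega> in P x. norm \<bar>indicator A (\<omega> t) - ?avg A \<omega>\<bar> \<le> 1"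
    proof (rule AE_I2)
      fix \<omega> assume "\<omega> \<in> space (P x)"
      from avg01[OF this, of A] show "norm \<bar>indicator A (\<omega> t) - ?avg A \<omega>\<bar> \<le> 1"
        by (cases "\<omega> t \<in> A") auto
    qed
  qed (use m_ind m_avg[of A] in \<open>auto intro!: borel_measurable_diff\<close>)
  have i_out: "integrable (P x) (indicator ?out :: _ \<Rightarrow> real)"
    using m_out by (simp add: emeasure_eq_measure)
  let ?rhs = "\<lambda>\<omega>. indicator ?out \<omega> + (\<Sum>y\<in>G. indicator (?at y) \<omega> * ?avg (B y) \<omega>)"
  have i_sum: "integrable (P x) (\<lambda>\<omega>. \<Sum>y\<in>G. indicator (?at y) \<omega> * ?avg (B y) \<omega>)"
    by (intro Bochner_Integration.integrable_sum i_avg)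
  have "(\<integral>\<omega>. \<bar>indicator A (\<omega> t) - ?avg A \<omega>\<bar> \<partial>P x) \<le> (\<integral>\<omega>. ?rhs \<omega> \<partial>P x)"
  proof (rule integral_mono[OF i_lhs Bochner_Integration.integrable_add[OF i_out i_sum]])
    fix \<omega> assume \<omega>: "\<omega> \<in> space (P x)"
    show "\<bar>indicator A (\<omega> t) - ?avg A \<omega>\<bar> \<le> ?rhs \<omega>"
    proof (cases "\<omega> t \<in> G")
      case False
      have nn: "0 \<le> (\<Sum>y\<in>G. indicator (?at y) \<omega> * ?avg (B y) \<omega>)"
        by (intro sum_nonneg mult_nonneg_nonneg avg01(1)[OF \<omega>]) simp
      have "\<bar>indicator A (\<omega> t) - ?avg A \<omega>\<bar> \<le> 1"
        using avg01[OF \<omega>, of A] by (cases "\<omega> t \<in> A") auto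
      also have "1 = indicator ?out \<omega>"
        using \<omega> False by simp
      also have "\<dots> \<le> ?rhs \<omega>"
        using nn by linarith
      finally show ?thesis .
    next
      case True
      have "(\<Sum>y\<in>G. indicator (?at y) \<omega> * ?avg (B y) \<omega>) = (\<Sum>y\<in>G. if y = \<omega> t then ?avg (B y) \<omega> else 0)"
        using \<omega> by (intro sum.cong) auto
      also have "\<dots> = ?avg (B (\<omega> t)) \<omega>"
        using fin True by simp
      also have "\<dots> = \<bar>indicator A (\<omega> t) - ?avg A \<omega>\<bar>"
      proof (cases "\<omega> t \<in> A")
        case True
        have "occupation_time A \<omega> (t + d) - occupation_time A \<omega> t
            + (occupation_time (- A) \<omega> (t + d) - occupation_time (- A) \<omega> t) = d"
          using occupation_time_Compl[of \<omega> K t A] occupation_time_Compl[of \<omega> K "t + d" A] \<omega> t d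
          by (simp add: space_P[OF x])
        then have "?avg A \<omega> + ?avg (- A) \<omega> = 1"
          using d by (simp only: add_divide_distrib[symmetric]) simp
        with True avg01[OF \<omega>, of A] show ?thesis
          by (simp add: B_def)
      next
        case False
        with avg01[OF \<omega>, of A] show ?thesis
          by (simp add: B_def del: abs_divide)
      qed
      finally show ?thesis
        using True by simp
    qed
  qed
  also have "\<dots> = measure (P x) ?out + (\<Sum>y\<in>G. \<integral>\<omega>. indicator (?at y) \<omega> * ?avg (B y) \<omega> \<partial>P x)"
    using i_out i_sum i_avg m_out sets.sets_into_space[OF m_out]
    by (simp add: Bochner_Integration.integral_add Bochner_Integration.integral_sum Int_absorb2)
  also have "(\<Sum>y\<in>G. \<integral>\<omega>. indicator (?at y) \<omega> * ?avg (B y) \<omega> \<partial>P x) \<le> (\<Sum>y\<in>G. measure (P x) (?at y) * c)"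
  proof (rule sum_mono)
    fix y assume y: "y \<in> G"
    have "(\<integral>\<omega>. indicator (?at y) \<omega> * ?avg (B y) \<omega> \<partial>P x)
        = (\<integral>\<omega>. indicator (?at y) \<omega> * (occupation_time (B y) \<omega> (t + d) - occupation_time (B y) \<omega> t) / d \<partial>P x)"
      by simp
    also have "\<dots> = measure (P x) (?at y) * ((\<integral>\<omega>. occupation_time (B y) \<omega> d \<partial>P y) / d)"
      using markov_occupation_time[OF x _ t, of y d "B y"] y G d
      by (subst Bochner_Integration.integral_divide_zero) auto
    also have "\<dots> \<le> measure (P x) (?at y) * c"
      using inside[OF y] outside[OF y] d
      by (intro mult_left_mono) (auto simp: B_def pos_divide_le_eq)
    finally show "(\<integral>\<omega>. indicator (?at y) \<omega> * ?avg (B y) \<omega> \<partial>P x) \<le> measure (P x) (?at y) * c" .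
  qed
  also have "\<dots> = measure (P x) {\<omega> \<in> space (P x). \<omega> t \<in> G} * c"
    using measure_at_sum[OF x t sets.top, of G] G by (simp add: sum_distrib_right Int_absorb2)
  also have "\<dots> \<le> c"
    using c by (simp add: mult_left_le_one_le)
  finally show ?thesis
    by simp
qed

text \<open>A right-continuous path in a discrete space stays at its starting point for a positive
  time, so the indicators converge almost surely and dominated convergence applies.\<close>

lemma tendsto_prob_stay:
  assumes y: "y \<in> K"
  shows "((\<lambda>r. measure (P y) {\<omega> \<in> space (P y). \<omega> r = y}) \<longlongrightarrow> 1) (at_right 0)"
proof (rule tendsto_at_right_sequentially[of 0 1])
  fix r :: "nat \<Rightarrow> real" assume r: "\<And>i. 0 < r i" "r \<longlonglongrightarrow> 0"
  interpret prob_space "P y" by (rule prob_space_P[OF y])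
  let ?A = "\<lambda>i. {\<omega> \<in> space (P y). \<omega> (r i) = y}"
  have A: "?A i \<in> sets (P y)" for i
    using r(1)[of i] by (intro sets_path_at_eq[OF y]) auto
  have "(\<lambda>i. \<integral>\<omega>. indicator (?A i) \<omega> \<partial>P y) \<longlonglongrightarrow> (\<integral>\<omega>. 1 \<partial>P y :: real)"
  proof (rule integral_dominated_convergence[where w = "\<lambda>_. 1"])
    show "AE \<omega> in P y. (\<lambda>i. indicator (?A i) \<omega>) \<longlonglongrightarrow> (1::real)"
      using AE_start[OF y] AE_space
    proof eventually_elim
      case (elim \<omega>)
      then have \<omega>: "\<omega> \<in> cadlag_paths K" by (simp add: space_P[OF y])
      obtain h where h: "0 < h" "\<And>s. 0 \<le> s \<Longrightarrow> s < 0 + h \<Longrightarrow> \<omega> s = \<omega> 0"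
        using cadlag_paths_right[OF \<omega> order_refl] by blast
      have "\<forall>\<^sub>F i in sequentially. r i < h"
        using r(2) h(1) by (rule order_tendstoD)
      then have "\<forall>\<^sub>F i in sequentially. indicator (?A i) \<omega> = (1::real)"
      proof eventually_elim
        case (elim i)
        then have "\<omega> (r i) = y"
          using h(2)[of "r i"] r(1)[of i] \<open>\<omega> 0 = y\<close> by simp
        then show ?case
          using \<open>\<omega> \<in> space (P y)\<close> by simp
      qed
      then show ?case
        by (rule tendsto_eventually)
    qed
  qed (use A in \<open>auto simp: indicator_def\<close>)
  then show "(\<lambda>i. measure (P y) (?A i)) \<longlonglongrightarrow> 1"
    using sets.sets_into_space[OF A] by (simp add: Int_absorb2 prob_space)
qed simp

text \<open>The probability of being away from \<open>y\<close> is small at every single small time,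
  hence so is its average over \<open>[0, d]\<close>. Control of the first exit time is not
  involved.\<close>

lemma tendsto_early_exit:
  assumes y: "y \<in> K"
  shows "((\<lambda>d. (\<integral>\<omega>. occupation_time (- {y}) \<omega> d \<partial>P y) / d) \<longlongrightarrow> 0) (at_right 0)"
proof (rule tendstoI)
  interpret prob_space "P y" by (rule prob_space_P[OF y])
  fix \<epsilon> :: real assume \<epsilon>: "0 < \<epsilon>"
  have "\<forall>\<^sub>F r in at_right 0. 1 - \<epsilon> / 2 < measure (P y) {\<omega> \<in> space (P y). \<omega> r = y}"
    using tendsto_prob_stay[OF y] \<epsilon> by (intro order_tendstoD(1)[where y = 1]) auto
  then obtain b where b: "b > 0" "\<And>r. 0 < r \<Longrightarrow> r < b \<Longrightarrow> 1 - \<epsilon> / 2 < measure (P y) {\<omega> \<in> space (P y). \<omega> r = y}"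
    by (auto simp: eventually_at_right_field)
  have "dist ((\<integral>\<omega>. occupation_time (- {y}) \<omega> d \<partial>P y) / d) 0 < \<epsilon>" if d: "0 < d" "d < b" for d
  proof -
    have le: "measure (P y) {\<omega> \<in> space (P y). \<omega> s \<in> - {y}} \<le> \<epsilon> / 2" if "0 < s" "s \<le> d" for s
      using prob_neg[of "\<lambda>\<omega>. \<omega> s = y"] sets_path_at_eq[OF y, of s y] b(2)[of s] that d by simp
    have "(\<integral>\<omega>. occupation_time (- {y}) \<omega> d \<partial>P y)
        = (LINT s:{0<..d}|lborel. measure (P y) {\<omega> \<in> space (P y). \<omega> s \<in> - {y}})"
      using d by (intro expectation_occupation_time(2)[OF y]) auto
    also have "\<dots> \<le> (LINT s:{0<..d}|lborel. \<epsilon> / 2)"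
      using expectation_occupation_time(1)[OF y, of d "- {y}"] le d
      by (intro set_integral_mono) (auto simp: set_integrable_def)
    also have "\<dots> = d * (\<epsilon> / 2)"
      using LINT_const_Ioc[of 0 d "\<epsilon> / 2"] d by simp
    finally have "(\<integral>\<omega>. occupation_time (- {y}) \<omega> d \<partial>P y) / d \<le> \<epsilon> / 2"
      using d by (simp add: pos_divide_le_eq mult.commute)
    moreover have "0 \<le> (\<integral>\<omega>. occupation_time (- {y}) \<omega> d \<partial>P y) / d"
      using d by (intro divide_nonneg_pos Bochner_Integration.integral_nonneg occupation_time_nonneg)
    ultimately show ?thesis
      unfolding dist_real_def using \<epsilon> by linarith
  qed
  with b(1) show "\<forall>\<^sub>F d in at_right 0. dist ((\<integral>\<omega>. occupation_time (- {y}) \<omega> d \<partial>P y) / d) 0 < \<epsilon>"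
    unfolding eventually_at_right_field by blast
qed


subsection \<open>Recurrence\<close>

lemma chapman_kolmogorov_le:
  assumes "x \<in> K" "y \<in> K" "0 \<le> s" "0 \<le> t"
  shows "measure (P x) {\<omega> \<in> space (P x). \<omega> s = y} * measure (P y) {\<omega> \<in> space (P y). \<omega> t = z}
    \<le> measure (P x) {\<omega> \<in> space (P x). \<omega> (s + t) = z}"
proof -
  interpret prob_space "P x" by (rule prob_space_P[OF assms(1)])
  have "measure (P x) {\<omega> \<in> space (P x). \<omega> s = y} * measure (P y) {\<omega> \<in> space (P y). \<omega> t = z}
      = measure (P x) {\<omega> \<in> space (P x). \<omega> s = y \<and> \<omega> (s + t) = z}"
    using markov_at[OF assms, of "{z}"] by simp
  also have "\<dots> \<le> measure (P x) {\<omega> \<in> space (P x). \<omega> (s + t) = z}"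
    using assms by (intro finite_measure_mono sets_path_at_eq) auto
  finally show ?thesis .
qed

text \<open>Staying has positive probability over all sufficiently short times; a long time is split
  into equal short steps, each of which ends at \<open>w\<close>.\<close>

lemma prob_return_pos:
  assumes w: "w \<in> K" and s: "0 \<le> s"
  shows "0 < measure (P w) {\<omega> \<in> space (P w). \<omega> s = w}"
proof -
  interpret prob_space "P w" by (rule prob_space_P[OF w])
  let ?p = "\<lambda>r. measure (P w) {\<omega> \<in> space (P w). \<omega> r = w}"
  have p0: "0 < ?p 0"
    using markov w by (auto simp: markov_chain_def)
  have "\<forall>\<^sub>F r in at_right 0. 0 < ?p r"
    using tendsto_prob_stay[OF w] by (rule order_tendstoD) simp
  then obtain b where b: "b > 0" "\<And>r. 0 < r \<Longrightarrow> r < b \<Longrightarrow> 0 < ?p r"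
    by (auto simp: eventually_at_right_field)
  have multiple: "0 < ?p (real k * r)" if r: "0 \<le> r" "r < b" for k r
  proof (induction k)
    case (Suc k)
    have "0 < ?p r"
      using p0 b(2)[of r] r by (cases "r = 0") auto
    then have "0 < ?p (real k * r) * ?p r"
      using Suc by simp
    also have "\<dots> \<le> ?p (real k * r + r)"
      using r by (intro chapman_kolmogorov_le[OF w w]) auto
    finally show ?case
      by (simp add: algebra_simps)
  qed (simp add: p0)
  \<comment> \<open>With this \<open>k\<close>, each of the \<open>k\<close> steps has length
    \<open>s / k < b\<close>.\<close>
  obtain k where k: "s / b < real k"
    using reals_Archimedean2 by blast
  then have "0 < real k"
    using s b(1) by (metis divide_nonneg_pos le_less_trans)
  then have "s / real k < b"
    using k b(1) by (simp add: field_simps)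
  then show ?thesis
    using multiple[of "s / real k" k] s \<open>0 < real k\<close> by simp
qed

text \<open>Irreducibility gives a time for each starting state. These times are padded to a common
  \<open>h\<close> by returning to \<open>w\<close>, which has positive probability over any
  duration; finiteness of \<open>K\<close> then yields a positive minimum.\<close>

lemma uniform_hitting_bound:
  assumes irr: "irreducible_chain K P" and w: "w \<in> K"
  shows "\<exists>h>0. \<exists>q>0. \<forall>y\<in>K. q \<le> measure (P y) {\<omega> \<in> space (P y). \<omega> h = w}"
proof -
  have "\<forall>y\<in>K. \<exists>t>0. 0 < measure (P y) {\<omega> \<in> space (P y). \<omega> t = w}"
    using irr w unfolding irreducible_chain_def by blast
  from bchoice[OF this] obtain t where "\<forall>y\<in>K. t y > 0 \<and>
      0 < measure (P y) {\<omega> \<in> space (P y). \<omega> (t y) = w}" ..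
  then have t: "\<And>y. y \<in> K \<Longrightarrow> 0 < t y"
      "\<And>y. y \<in> K \<Longrightarrow> 0 < measure (P y) {\<omega> \<in> space (P y). \<omega> (t y) = w}"
    by blast+
  \<comment> \<open>Any common upper bound of the times \<open>t y\<close> would do; the sum is one,
    since all of them are positive.\<close>
  define h where "h = sum t K"
  let ?p = "\<lambda>y. measure (P y) {\<omega> \<in> space (P y). \<omega> h = w}"
  have le: "t y \<le> h" if "y \<in> K" for y
    unfolding h_def using that finite_K t(1) by (intro member_le_sum) (auto intro: less_imp_le)
  have "0 < h"
    using le[OF w] t(1)[OF w] by simp
  have pos: "0 < ?p y" if y: "y \<in> K" for y
  proof -
    have "0 < measure (P y) {\<omega> \<in> space (P y). \<omega> (t y) = w} *
        measure (P w) {\<omega> \<in> space (P w). \<omega> (h - t y) = w}"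
      using t(2)[OF y] prob_return_pos[OF w, of "h - t y"] le[OF y] by simp
    also have "\<dots> \<le> measure (P y) {\<omega> \<in> space (P y). \<omega> (t y + (h - t y)) = w}"
      using t(1)[OF y] le[OF y] by (intro chapman_kolmogorov_le[OF y w]) auto
    finally show ?thesis by simp
  qed
  have "\<forall>y\<in>K. Min (?p ` K) \<le> ?p y"
    using finite_K by simp
  moreover have "0 < Min (?p ` K)"
    using finite_K w pos by (subst Min_gr_iff) auto
  ultimately show ?thesis
    using \<open>0 < h\<close> by blast
qed

text \<open>Each further step of length \<open>h\<close> hits \<open>w\<close> with conditional
  probability at least \<open>q\<close>. There are \<open>m + 1\<close> times but only
  \<open>m\<close> steps, since nothing is known about the first time \<open>u\<close>.\<close>

lemma prob_skeleton_avoids: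
  assumes x: "x \<in> K" and w: "w \<in> K" and h: "0 < h" and u: "0 \<le> u"
    and q: "\<And>y. y \<in> K \<Longrightarrow> q \<le> measure (P y) {\<omega> \<in> space (P y). \<omega> h = w}" and q1: "q \<le> 1"
  shows "measure (P x) {\<omega> \<in> space (P x). \<forall>r\<in>(\<lambda>j. u + real j * h) ` {..m}. \<omega> r \<noteq> w} \<le> (1 - q) ^ m"
proof (induction m)
  case 0
  interpret prob_space "P x" by (rule prob_space_P[OF x])
  show ?case by simp
next
  case (Suc m)
  interpret prob_space "P x" by (rule prob_space_P[OF x])
  let ?J = "\<lambda>m. (\<lambda>j. u + real j * h) ` {..m}"
  let ?s = "u + real m * h"
  let ?D = "\<lambda>m. {\<omega> \<in> space (P x). \<forall>r\<in>?J m. \<omega> r \<in> - {w}}"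
  have s: "0 \<le> ?s" "0 \<le> ?s + h"
    using u h by auto
  have J: "?J m \<subseteq> {0..?s}"
    using u h by (auto intro!: mult_right_mono)
  have D: "?D k \<in> sets (P x)" for k
    using u h by (intro sets_path_fdd[OF x]) auto
  \<comment> \<open>At least the fraction \<open>q\<close> of the mass avoiding \<open>w\<close> so
    far is caught at the next time. The split over the state at \<open>?s\<close> makes the Markov
    property applicable.\<close>
  have "q * measure (P x) (?D m) = (\<Sum>y\<in>K. q * measure (P x) {\<omega> \<in> ?D m. \<omega> ?s = y})"
  proof -
    have "?D m = {\<omega> \<in> ?D m. \<omega> ?s \<in> K}"
      using cadlag_paths_range[OF _ s(1)] by (auto simp: space_P[OF x])
    then have "measure (P x) (?D m) = (\<Sum>y\<in>K. measure (P x) {\<omega> \<in> ?D m. \<omega> ?s = y})"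
      using measure_at_sum[OF x s(1) D, of m K] by simp
    then show ?thesis
      by (simp add: sum_distrib_left)
  qed
  also have "\<dots> \<le> (\<Sum>y\<in>K. measure (P x) {\<omega> \<in> {\<omega> \<in> ?D m. \<omega> (?s + h) \<in> {w}}. \<omega> ?s = y})"
  proof (rule sum_mono)
    fix y assume y: "y \<in> K"
    have "q * measure (P x) {\<omega> \<in> ?D m. \<omega> ?s = y}
        \<le> measure (P y) {\<omega> \<in> space (P y). \<omega> h \<in> {w}} * measure (P x) {\<omega> \<in> ?D m. \<omega> ?s = y}"
      using q[OF y] by (intro mult_right_mono) auto
    also have "\<dots> = measure (P x) {\<omega> \<in> space (P x). (\<forall>r\<in>?J m. \<omega> r \<in> - {w}) \<and> \<omega> ?s = y \<and> \<omega> (?s + h) \<in> {w}}"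
      using markov_fdd[OF x y s(1) less_imp_le[OF h] _ J, of "\<lambda>_. - {w}" "{w}"]
      by (simp add: conj_assoc)
    also have "\<dots> = measure (P x) {\<omega> \<in> {\<omega> \<in> ?D m. \<omega> (?s + h) \<in> {w}}. \<omega> ?s = y}"
      by (rule arg_cong[of _ _ "measure (P x)"]) auto
    finally show "q * measure (P x) {\<omega> \<in> ?D m. \<omega> ?s = y}
        \<le> measure (P x) {\<omega> \<in> {\<omega> \<in> ?D m. \<omega> (?s + h) \<in> {w}}. \<omega> ?s = y}" .
  qed
  also have "\<dots> = measure (P x) {\<omega> \<in> {\<omega> \<in> ?D m. \<omega> (?s + h) \<in> {w}}. \<omega> ?s \<in> K}"
    using measure_at_sum[OF x s(1) sets_path_at_Int[OF x s(2) D], of m "{w}" K] by simp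
  also have "\<dots> = measure (P x) (?D m - ?D (Suc m))"
  proof (rule arg_cong[of _ _ "measure (P x)"])
    have "?J (Suc m) = insert (?s + h) (?J m)"
      by (auto simp: atMost_Suc algebra_simps)
    then show "{\<omega> \<in> {\<omega> \<in> ?D m. \<omega> (?s + h) \<in> {w}}. \<omega> ?s \<in> K} = ?D m - ?D (Suc m)"
      using cadlag_paths_range[OF _ s(1)] by (auto simp: space_P[OF x])
  qed
  also have "\<dots> = measure (P x) (?D m) - measure (P x) (?D (Suc m))"
    by (rule finite_measure_Diff[OF D D]) (auto simp: atMost_Suc)
  finally have "measure (P x) (?D (Suc m)) \<le> (1 - q) * measure (P x) (?D m)"
    by (simp add: algebra_simps)
  also have "\<dots> \<le> (1 - q) * (1 - q) ^ m"
    using Suc q1 by (intro mult_left_mono) auto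
  finally show ?case by simp
qed

text \<open>Avoiding \<open>w\<close> from index \<open>k\<close> on has probability zero by the
  geometric bound for the progression started at \<open>u + k h\<close>; countably many
  \<open>k\<close> share one null set.\<close>

lemma AE_skeleton_recurrent:
  assumes x: "x \<in> K" and w: "w \<in> K" and h: "0 < h" and u: "0 \<le> u"
    and q: "0 < q" "\<And>y. y \<in> K \<Longrightarrow> q \<le> measure (P y) {\<omega> \<in> space (P y). \<omega> h = w}"
  shows "AE \<omega> in P x. \<forall>k. \<exists>j\<ge>k. \<omega> (u + real j * h) = w"
proof -
  interpret prob_space "P x" by (rule prob_space_P[OF x])
  interpret W: prob_space "P w" by (rule prob_space_P[OF w])
  have q1: "q \<le> 1"
    using q(2)[OF w] W.prob_le_1 by (rule order_trans)
  have "AE \<omega> in P x. \<exists>j\<ge>k. \<omega> (u + real j * h) = w" for k :: nat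
  proof -
    let ?u = "u + real k * h"
    have u0: "0 \<le> ?u" using u h by simp
    let ?D = "\<lambda>m. {\<omega> \<in> space (P x). \<forall>r\<in>(\<lambda>j. ?u + real j * h) ` {..m}. \<omega> r \<noteq> w}"
    have D: "?D m \<in> sets (P x)" for m
    proof -
      have "(\<lambda>j. ?u + real j * h) ` {..m} \<subseteq> {0..}"
        using u h by auto
      from sets_path_fdd[OF x _ this sets.top, of "\<lambda>_. - {w}"] show ?thesis
        by simp
    qed
    have "(\<lambda>m. measure (P x) (?D m)) \<longlonglongrightarrow> measure (P x) (\<Inter>m. ?D m)"
      using D by (intro finite_Lim_measure_decseq) (auto simp: decseq_def)
    moreover have "(\<lambda>m. measure (P x) (?D m)) \<longlonglongrightarrow> 0"
    proof (rule tendsto_sandwich[where f = "\<lambda>_. 0"])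
      show "\<forall>\<^sub>F m in sequentially. measure (P x) (?D m) \<le> (1 - q) ^ m"
        using prob_skeleton_avoids[OF x w h u0 q(2) q1] by simp
      show "(\<lambda>m. (1 - q) ^ m) \<longlonglongrightarrow> 0"
        using q(1) q1 by (intro LIMSEQ_power_zero) auto
    qed auto
    ultimately have "measure (P x) (\<Inter>m. ?D m) = 0"
      by (rule LIMSEQ_unique)
    moreover have "(\<Inter>m. ?D m) \<in> sets (P x)"
      using D by (intro sets.countable_INT) auto
    ultimately have "(\<Inter>m. ?D m) \<in> null_sets (P x)"
      by (simp add: null_sets_def emeasure_eq_measure)
    then show ?thesis
    proof (rule AE_I')
      show "{\<omega> \<in> space (P x). \<not> (\<exists>j\<ge>k. \<omega> (u + real j * h) = w)} \<subseteq> (\<Inter>m. ?D m)"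
      proof
        fix \<omega> assume \<omega>: "\<omega> \<in> {\<omega> \<in> space (P x). \<not> (\<exists>j\<ge>k. \<omega> (u + real j * h) = w)}"
        have "\<omega> r \<noteq> w" if r: "r \<in> (\<lambda>j. ?u + real j * h) ` {..m}" for m r
        proof -
          from r obtain j where "r = u + real (k + j) * h"
            by (auto simp: algebra_simps)
          then show ?thesis
            using \<omega> le_add1[of k j] by blast
        qed
        then show "\<omega> \<in> (\<Inter>m. ?D m)"
          using \<omega> by blast
      qed
    qed
  qed
  then show ?thesis
    by (simp add: AE_all_countable)
qed

text \<open>If the path visits \<open>w\<close> at infinitely many of the times \<open>u + j h\<close>, for almost every
  \<open>u \<in> [0, h)\<close>, then the time spent in \<open>w\<close>, which is the integral over \<open>u\<close> of the number of these
  visits, is infinite. This needs the Markov property only at deterministic times.\<close>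

lemma unbounded_occupation_time_if_recurrent:
  assumes \<omega>: "\<omega> \<in> cadlag_paths K" and h: "0 < h"
    and rec: "AE u in lborel. \<forall>k. \<exists>j\<ge>k. \<omega> (max 0 u + real j * h) = w"
  shows "\<exists>s\<ge>0. c < occupation_time {w} \<omega> s"
proof (rule ccontr)
  assume "\<not> ?thesis"
  then have bound: "occupation_time {w} \<omega> s \<le> c" if "0 \<le> s" for s
    using that by force
  \<comment> \<open>The translates of \<open>(0, h]\<close> by the multiples \<open>j h\<close> tile
    \<open>(0, \<infinity>)\<close>, so summing \<open>?g j\<close> over \<open>j\<close> counts the
    visits, and integrating it over \<open>u\<close> gives the time in \<open>w\<close> during the
    corresponding tile.\<close>
  let ?g = "\<lambda>j u. indicator {0<..h} u * indicator {w} (\<omega> (max 0 (u + real j * h))) :: ennreal"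
  have [measurable]: "(\<lambda>s. indicator {w} (\<omega> (max 0 s)) :: real) \<in> borel_measurable lborel"
    using measurable_compose[OF measurable_Pair1' borel_measurable_path_indicator[of "{w}"], of \<omega> K] \<omega>
    by simp
  have g_eq: "?g j u = ennreal (indicator {0<..h} u * indicator {w} (\<omega> (max 0 (u + real j * h))))" for j u
    by (auto simp: indicator_def)
  have m: "?g j \<in> borel_measurable lborel" for j
    unfolding g_eq by measurable
  have int: "(\<integral>\<^sup>+u. ?g j u \<partial>lborel)
      = ennreal (occupation_time {w} \<omega> (real (Suc j) * h) - occupation_time {w} \<omega> (real j * h))" for j
  proof -
    let ?a = "real j * h"
    have a: "0 \<le> ?a" "?a \<le> ?a + h" using h by auto
    have "set_integrable lborel {?a<..?a + h} (\<lambda>s. indicator {w} (\<omega> s) :: real)"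
    proof (rule set_integrable_path_indicator[OF \<omega>, where t = "?a + h"])
      show "{?a<..?a + h} \<subseteq> {0..?a + h}"
        using order_trans[OF a(1)] by (intro subsetI) (simp add: less_imp_le)
    qed simp
    then have i: "integrable lborel (\<lambda>s. indicator {?a<..?a + h} s * indicator {w} (\<omega> s) :: real)"
      by (simp add: set_integrable_def)
    have "(\<integral>\<^sup>+u. ?g j u \<partial>lborel) = (\<integral>\<^sup>+u. ennreal (indicator {?a<..?a + h} (?a + u) * indicator {w} (\<omega> (?a + u))) \<partial>lborel)"
      unfolding g_eq using a
      by (intro nn_integral_cong arg_cong[of _ _ ennreal]) (auto simp: indicator_def add.commute)
    also have "\<dots> = (\<integral>\<^sup>+s. ennreal (indicator {?a<..?a + h} s * indicator {w} (\<omega> s)) \<partial>lborel)"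
      using i by (subst nn_integral_real_affine[of _ 1 ?a]) auto
    also have "\<dots> = ennreal (\<integral>s. indicator {?a<..?a + h} s * indicator {w} (\<omega> s) \<partial>lborel)"
      by (rule nn_integral_eq_integral[OF i]) simp
    also have "\<dots> = ennreal (occupation_time {w} \<omega> (?a + h) - occupation_time {w} \<omega> ?a)"
      using occupation_time_diff[OF \<omega> a, of "{w}"] by (simp add: set_lebesgue_integral_def)
    finally show ?thesis
      by (simp add: algebra_simps)
  qed
  have "(\<integral>\<^sup>+u. (\<Sum>j. ?g j u) \<partial>lborel) = (\<Sum>j. \<integral>\<^sup>+u. ?g j u \<partial>lborel)"
    by (rule nn_integral_suminf[OF m])
  \<comment> \<open>The partial sums telescope to the occupation time up to \<open>k h\<close>,
    which the contradiction assumption bounds by \<open>c\<close>.\<close>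
  also have "\<dots> \<le> ennreal c"
  proof (rule suminf_le_const[OF summableI])
    fix k
    have "(\<Sum>j<k. \<integral>\<^sup>+u. ?g j u \<partial>lborel)
        = ennreal (\<Sum>j<k. occupation_time {w} \<omega> (real (Suc j) * h) - occupation_time {w} \<omega> (real j * h))"
      unfolding int using h
      by (intro sum_ennreal) (auto intro!: occupation_time_mono[OF \<omega>] simp: mult_right_mono)
    also have "\<dots> = ennreal (occupation_time {w} \<omega> (real k * h))"
      by (subst sum_lessThan_telescope) simp
    also have "\<dots> \<le> ennreal c"
      using bound[of "real k * h"] h by (intro ennreal_leI) auto
    finally show "(\<Sum>j<k. \<integral>\<^sup>+u. ?g j u \<partial>lborel) \<le> ennreal c" .
  qed
  finally have "(\<integral>\<^sup>+u. (\<Sum>j. ?g j u) \<partial>lborel) \<le> ennreal c" .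
  then have "(\<integral>\<^sup>+u. (\<Sum>j. ?g j u) \<partial>lborel) \<noteq> \<infinity>"
    by (metis ennreal_neq_top infinity_ennreal_def neq_top_trans)
  moreover have "(\<lambda>u. \<Sum>j. ?g j u) \<in> borel_measurable lborel"
    using m by (rule borel_measurable_suminf_order)
  ultimately have "AE u in lborel. (\<Sum>j. ?g j u) \<noteq> \<infinity>"
    by (intro nn_integral_PInf_AE)
  with rec have "AE u in lborel. u \<notin> {0<..h}"
  proof eventually_elim
    case (elim u)
    show ?case
    proof
      assume u: "u \<in> {0<..h}"
      let ?J = "{j. \<omega> (u + real j * h) = w}"
      have "infinite ?J"
        using elim(1) u by (auto simp: infinite_nat_iff_unbounded_le)
      moreover obtain r where r: "(\<Sum>j. ?g j u) = ennreal r" "0 \<le> r"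
        using elim(2) by (cases "\<Sum>j. ?g j u") auto
      \<comment> \<open>A finite sum of indicators cannot dominate more than \<open>r\<close>
        visits, while recurrence provides \<open>n > r\<close> of them. Hence no such
        \<open>u\<close> lies in \<open>(0, h]\<close> outside of a null set, although this interval
        has length \<open>h > 0\<close>.\<close>
      obtain n where n: "r < real n"
        using reals_Archimedean2 by blast
      ultimately obtain F where F: "finite F" "card F = n" "F \<subseteq> ?J"
        using infinite_arbitrarily_large by blast
      have "ennreal (real n) = (\<Sum>j\<in>F. 1)"
        using F(2) by (simp add: ennreal_of_nat_eq_real_of_nat)
      also have "\<dots> = (\<Sum>j\<in>F. ?g j u)"
        using F(3) u h by (intro sum.cong) (auto simp: subset_iff max_def)
      also have "\<dots> \<le> ennreal r"
        unfolding r(1)[symmetric] by (rule sum_le_suminf[OF summableI F(1)]) simp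
      finally show False
        using n r(2) by simp
    qed
  qed
  then have "{0<..h} \<in> null_sets lborel"
    by (subst AE_iff_null_sets) auto
  then have "emeasure lborel {0<..h} = 0"
    by auto
  then show False
    using h by simp
qed

text \<open>Recurrence along \<open>u + j h\<close> holds for each fixed \<open>u\<close> outside of
  a null set of paths that depends on \<open>u\<close>. Fubini exchanges the two quantifiers, which
  is what the deterministic criterion for a single path needs.\<close>

lemma AE_unbounded_occupation_time:
  assumes irr: "irreducible_chain K P" and x: "x \<in> K" and A: "w \<in> A" "w \<in> K"
  shows "AE \<omega> in P x. \<forall>u. \<exists>s\<ge>0. u < occupation_time A \<omega> s"
proof -
  interpret prob_space "P x" by (rule prob_space_P[OF x])
  interpret pair_sigma_finite "P x" lborel ..
  obtain h q where h: "0 < h" and q: "0 < q" "\<And>y. y \<in> K \<Longrightarrow> q \<le> measure (P y) {\<omega> \<in> space (P y). \<omega> h = w}"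
    using uniform_hitting_bound[OF irr A(2)] by blast
  let ?R = "\<lambda>\<omega> u. \<forall>k. \<exists>j\<ge>k. \<omega> (max 0 u + real j * h) = w"
  have "AE u in lborel. AE \<omega> in P x. ?R \<omega> u"
    by (rule AE_I2) (rule AE_skeleton_recurrent[OF x A(2) h max.cobounded1 q])
  then have "AE \<omega> in P x. AE u in lborel. ?R \<omega> u"
  proof (subst AE_commute)
    have m: "(\<lambda>(\<omega>, s). indicator {w} (\<omega> (max 0 s)) :: real) \<in> borel_measurable (P x \<Otimes>\<^sub>M lborel)"
      using borel_measurable_path_indicator[of "{w}" K]
        measurable_cong_sets[OF sets_pair_measure_cong[OF sets_P[OF x] refl] refl] by blast
    \<comment> \<open>The outer \<open>max 0\<close> has no effect; it brings the evaluation time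
      into the form of the jointly measurable indicator.\<close>
    have [measurable]: "(\<lambda>p. indicator {w} (fst p (max 0 (max 0 (snd p) + real j * h))) :: real)
        \<in> borel_measurable (P x \<Otimes>\<^sub>M lborel)" for j
    proof -
      have "(\<lambda>p. (fst p, max 0 (snd p) + real j * h)) \<in> measurable (P x \<Otimes>\<^sub>M lborel) (P x \<Otimes>\<^sub>M lborel)"
        by measurable
      from measurable_compose[OF this m] show ?thesis
        by simp
    qed
    have "{p \<in> space (P x \<Otimes>\<^sub>M lborel). ?R (fst p) (snd p)}
        = {p \<in> space (P x \<Otimes>\<^sub>M lborel). \<forall>k. \<exists>j\<ge>k.
            indicator {w} (fst p (max 0 (max 0 (snd p) + real j * h))) = (1::real)}"
      using h by (simp add: indicator_eq_1_iff)
    also have "\<dots> \<in> sets (P x \<Otimes>\<^sub>M lborel)"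
      by measurable
    finally show "{p \<in> space (P x \<Otimes>\<^sub>M lborel). ?R (fst p) (snd p)} \<in> sets (P x \<Otimes>\<^sub>M lborel)" .
  qed
  with AE_space show ?thesis
  proof eventually_elim
    case (elim \<omega>)
    then have \<omega>: "\<omega> \<in> cadlag_paths K"
      by (simp add: space_P[OF x])
    show ?case
    proof
      fix u
      obtain s where s: "0 \<le> s" "u < occupation_time {w} \<omega> s"
        using unbounded_occupation_time_if_recurrent[OF \<omega> h elim(2)] by blast
      have "occupation_time {w} \<omega> s \<le> occupation_time A \<omega> s"
        using occupation_time_diff_mono[OF \<omega> order_refl s(1), of "{w}" A] A by auto
      with s show "\<exists>s\<ge>0. u < occupation_time A \<omega> s"
        by (meson less_le_trans)
    qed
  qed
qed

end


subsection \<open>Accelerated chains\<close>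

lemma (in finite_chain) measure_accelerated_law:
  assumes x: "x \<in> K" and c: "0 < c" and S: "{\<omega> \<in> cadlag_paths K. R \<omega>} \<in> sets (path_space K)"
  shows "measure (accelerated_law K c (P x)) {\<omega> \<in> space (accelerated_law K c (P x)). R \<omega>}
    = measure (P x) {\<omega> \<in> space (P x). R (time_change c \<omega>)}"
proof -
  have m: "time_change c \<in> measurable (P x) (path_space K)"
    using measurable_time_change[OF c] by (simp add: measurable_P[OF x])
  have "measure (accelerated_law K c (P x)) {\<omega> \<in> space (accelerated_law K c (P x)). R \<omega>}
      = measure (P x) (time_change c -` {\<omega> \<in> cadlag_paths K. R \<omega>} \<inter> space (P x))"
    unfolding accelerated_law_def using measure_distr[OF m S] by simp
  also have "time_change c -` {\<omega> \<in> cadlag_paths K. R \<omega>} \<inter> space (P x)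
      = {\<omega> \<in> space (P x). R (time_change c \<omega>)}"
    using cadlag_paths_time_change[OF _ c] by (auto simp: space_P[OF x])
  finally show ?thesis .
qed

lemma (in finite_chain) accelerated:
  assumes c: "0 < c"
  shows "finite_chain K (\<lambda>x. accelerated_law K c (P x))"
proof
  let ?P = "\<lambda>x. accelerated_law K c (P x)"
  show "markov_chain K ?P"
    unfolding markov_chain_def
  proof (intro ballI conjI allI impI)
    fix x assume x: "x \<in> K"
    interpret prob_space "P x" by (rule prob_space_P[OF x])
    show "prob_space (?P x)"
      unfolding accelerated_law_def
      using measurable_time_change[OF c] by (intro prob_space_distr) (simp add: measurable_P[OF x])
    show "sets (?P x) = sets (path_space K)"
      by (simp add: accelerated_law_def)
    have "{\<omega> \<in> cadlag_paths K. \<omega> 0 = x} \<in> sets (path_space K)"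
      using sets_path_at_eq[OF x order_refl, of x] by (simp add: space_P[OF x] sets_P[OF x])
    then have "measure (?P x) {\<omega> \<in> space (?P x). \<omega> 0 = x} = prob {\<omega> \<in> space (P x). \<omega> 0 = x}"
      by (subst measure_accelerated_law[OF x c]) (simp_all add: time_change_def)
    also have "\<dots> = 1"
      using markov x by (auto simp: markov_chain_def)
    finally show "measure (?P x) {\<omega> \<in> space (?P x). \<omega> 0 = x} = 1" .
    fix s t :: real and I :: "real set" and a :: "real \<Rightarrow> 'a" and y z
    assume s: "0 \<le> s" and t: "0 \<le> t" and y: "y \<in> K" and z: "z \<in> K" and I: "finite I \<and> I \<subseteq> {0..s}"
    \<comment> \<open>Times are multiplied by \<open>c\<close> and the prescribed values reindexed
      accordingly, so the claim becomes the Markov property of the original chain at time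
      \<open>s * c\<close>.\<close>
    let ?I = "(\<lambda>r. r * c) ` I" and ?a = "\<lambda>r. a (r / c)"
    have I0: "finite I" "I \<subseteq> {0..}" using I by auto
    have I': "finite ?I" "?I \<subseteq> {0..s * c}"
      using I c by (auto intro!: mult_right_mono)
    have sc: "0 \<le> s * c" "0 \<le> t * c"
      using s t c by auto
    have m1: "{\<omega> \<in> cadlag_paths K. (\<forall>r\<in>I. \<omega> r = a r) \<and> \<omega> s = y} \<in> sets (path_space K)"
    proof -
      have "{\<omega> \<in> {\<omega> \<in> space (P x). \<omega> s = y}. \<forall>r\<in>I. \<omega> r \<in> {a r}} \<in> sets (P x)"
        by (rule sets_path_fdd[OF x I0 sets_path_at_eq[OF x s]])
      also have "{\<omega> \<in> {\<omega> \<in> space (P x). \<omega> s = y}. \<forall>r\<in>I. \<omega> r \<in> {a r}}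
          = {\<omega> \<in> cadlag_paths K. (\<forall>r\<in>I. \<omega> r = a r) \<and> \<omega> s = y}"
        by (auto simp: space_P[OF x])
      finally show ?thesis by (simp add: sets_P[OF x])
    qed
    have m2: "{\<omega> \<in> cadlag_paths K. (\<forall>r\<in>I. \<omega> r = a r) \<and> \<omega> s = y \<and> \<omega> (s + t) = z} \<in> sets (path_space K)"
    proof -
      have "{\<omega> \<in> {\<omega> \<in> cadlag_paths K. (\<forall>r\<in>I. \<omega> r = a r) \<and> \<omega> s = y}. \<omega> (s + t) \<in> {z}} \<in> sets (P x)"
        using s t m1 by (intro sets_path_at_Int[OF x]) (auto simp: sets_P[OF x])
      also have "{\<omega> \<in> {\<omega> \<in> cadlag_paths K. (\<forall>r\<in>I. \<omega> r = a r) \<and> \<omega> s = y}. \<omega> (s + t) \<in> {z}}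
          = {\<omega> \<in> cadlag_paths K. (\<forall>r\<in>I. \<omega> r = a r) \<and> \<omega> s = y \<and> \<omega> (s + t) = z}"
        by auto
      finally show ?thesis by (simp add: sets_P[OF x])
    qed
    have m3: "{\<omega> \<in> cadlag_paths K. \<omega> t = z} \<in> sets (path_space K)"
      using sets_path_at_eq[OF y t, of z] by (simp add: space_P[OF y] sets_P[OF y])
    have tc: "(\<forall>r\<in>I. time_change c \<omega> r = a r) \<longleftrightarrow> (\<forall>r\<in>?I. \<omega> r = ?a r)" for \<omega>
      using I0(2) c by (auto simp: time_change_def)
    have "measure (?P x) {\<omega> \<in> space (?P x). (\<forall>r\<in>I. \<omega> r = a r) \<and> \<omega> s = y \<and> \<omega> (s + t) = z}
        = measure (P x) {\<omega> \<in> space (P x). (\<forall>r\<in>?I. \<omega> r = ?a r) \<and> \<omega> (s * c) = y \<and> \<omega> (s * c + t * c) = z}"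
      using measure_accelerated_law[OF x c m2] s t unfolding tc by (simp add: time_change_def algebra_simps)
    also have "\<dots> = measure (P x) {\<omega> \<in> space (P x). (\<forall>r\<in>?I. \<omega> r = ?a r) \<and> \<omega> (s * c) = y}
        * measure (P y) {\<omega> \<in> space (P y). \<omega> (t * c) = z}"
      by (rule markov_eq[OF x y z sc I'])
    also have "\<dots> = measure (?P x) {\<omega> \<in> space (?P x). (\<forall>r\<in>I. \<omega> r = a r) \<and> \<omega> s = y}
        * measure (?P y) {\<omega> \<in> space (?P y). \<omega> t = z}"
      using measure_accelerated_law[OF x c m1] measure_accelerated_law[OF y c m3] s t
      unfolding tc by (simp add: time_change_def)
    finally show "measure (?P x) {\<omega> \<in> space (?P x). (\<forall>r\<in>I. \<omega> r = a r) \<and> \<omega> s = y \<and> \<omega> (s + t) = z}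
        = measure (?P x) {\<omega> \<in> space (?P x). (\<forall>r\<in>I. \<omega> r = a r) \<and> \<omega> s = y}
        * measure (?P y) {\<omega> \<in> space (?P y). \<omega> t = z}" .
  qed
qed (rule finite_K)

lemma (in finite_chain) irreducible_accelerated:
  assumes irr: "irreducible_chain K P" and c: "0 < c"
  shows "irreducible_chain K (\<lambda>x. accelerated_law K c (P x))"
  unfolding irreducible_chain_def
proof (intro ballI)
  fix x y assume x: "x \<in> K" and y: "y \<in> K"
  then obtain t where t: "t > 0" "0 < measure (P x) {\<omega> \<in> space (P x). \<omega> t = y}"
    using irr unfolding irreducible_chain_def by blast
  have tc: "0 < t / c" using t(1) c by simp
  have "{\<omega> \<in> cadlag_paths K. \<omega> (t / c) = y} \<in> sets (path_space K)"
    using sets_path_at_eq[OF x less_imp_le[OF tc], of y] by (simp add: space_P[OF x] sets_P[OF x])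
  then have "measure (accelerated_law K c (P x)) {\<omega> \<in> space (accelerated_law K c (P x)). \<omega> (t / c) = y}
      = measure (P x) {\<omega> \<in> space (P x). \<omega> t = y}"
    using measure_accelerated_law[OF x c, of "\<lambda>\<omega>. \<omega> (t / c) = y"] tc c
    by (simp add: time_change_def)
  then show "\<exists>t>0. 0 < measure (accelerated_law K c (P x)) {\<omega> \<in> space (accelerated_law K c (P x)). \<omega> t = y}"
    using t(2) tc by (intro exI[of _ "t / c"]) simp
qed


subsection \<open>Estimates by occupation times\<close>

context finite_chain
begin

text \<open>To be in \<open>D\<close> at time \<open>s + r\<close>, the chain is either in
  \<open>D\<close> at time \<open>s\<close>, or it enters \<open>D\<close> from a state outside,
  which by the Markov property has probability at most \<open>M\<close>.\<close>

lemma measure_at_le: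
  assumes x: "x \<in> K" and s: "0 \<le> s" "0 \<le> r" and M: "0 \<le> M"
    and le: "\<And>y. y \<in> K \<Longrightarrow> y \<notin> D \<Longrightarrow> measure (P y) {\<omega> \<in> space (P y). \<omega> r \<in> D} \<le> M"
  shows "measure (P x) {\<omega> \<in> space (P x). \<omega> (s + r) \<in> D} \<le> measure (P x) {\<omega> \<in> space (P x). \<omega> s \<in> D} + M"
proof -
  interpret prob_space "P x" by (rule prob_space_P[OF x])
  let ?S = "{\<omega> \<in> space (P x). \<omega> (s + r) \<in> D}"
  have S: "?S \<in> sets (P x)"
    using s by (intro sets_path_at[OF x]) auto
  have D: "{\<omega> \<in> space (P x). \<omega> s \<in> D} \<in> sets (P x)" "{\<omega> \<in> ?S. \<omega> s \<in> - D} \<in> sets (P x)"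
    by (rule sets_path_at[OF x s(1)], rule sets_path_at_Int[OF x s(1) S])
  have "measure (P x) ?S \<le> measure (P x) ({\<omega> \<in> space (P x). \<omega> s \<in> D} \<union> {\<omega> \<in> ?S. \<omega> s \<in> - D})"
    using D by (intro finite_measure_mono) auto
  also have "\<dots> \<le> measure (P x) {\<omega> \<in> space (P x). \<omega> s \<in> D} + measure (P x) {\<omega> \<in> ?S. \<omega> s \<in> - D}"
    by (rule measure_Un_le[OF D])
  also have "measure (P x) {\<omega> \<in> ?S. \<omega> s \<in> - D} = (\<Sum>y\<in>- D \<inter> K. measure (P x) {\<omega> \<in> ?S. \<omega> s = y})"
    by (rule measure_at_sum[OF x s(1) S])
  also have "\<dots> \<le> (\<Sum>y\<in>- D \<inter> K. measure (P x) {\<omega> \<in> space (P x). \<omega> s = y} * M)"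
  proof (rule sum_mono)
    fix y assume y: "y \<in> - D \<inter> K"
    have "{\<omega> \<in> ?S. \<omega> s = y} = {\<omega> \<in> space (P x). \<omega> s = y \<and> \<omega> (s + r) \<in> D}"
      by auto
    then show "measure (P x) {\<omega> \<in> ?S. \<omega> s = y} \<le> measure (P x) {\<omega> \<in> space (P x). \<omega> s = y} * M"
      using markov_at[OF x _ s, of y D] le[of y] y by (simp add: mult_left_mono)
  qed
  also have "\<dots> = measure (P x) {\<omega> \<in> space (P x). \<omega> s \<in> - D} * M"
    using measure_at_sum[OF x s(1) sets.top, of "- D"] by (simp add: sum_distrib_right)
  also have "\<dots> \<le> M"
    using M by (simp add: mult_left_le_one_le)
  finally show ?thesis by simp
qed

text \<open>Averaging the previous bound over the intermediate time \<open>t - r\<close>, \<open>r \<in> [2d, 3d)\<close>, replaces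
  the probability of being in \<open>D\<close> at that time by an expected occupation time.\<close>

lemma measure_at_le_occupation_time:
  assumes x: "x \<in> K" and d: "0 < d" "3 * d \<le> t" and M: "0 \<le> M"
    and le: "\<And>y r. y \<in> K \<Longrightarrow> y \<notin> D \<Longrightarrow> 2 * d \<le> r \<Longrightarrow> r \<le> 3 * d \<Longrightarrow>
      measure (P y) {\<omega> \<in> space (P y). \<omega> r \<in> D} \<le> M"
  shows "measure (P x) {\<omega> \<in> space (P x). \<omega> t \<in> D} \<le> (\<integral>\<omega>. occupation_time D \<omega> t \<partial>P x) / d + M"
proof -
  let ?p = "\<lambda>s. measure (P x) {\<omega> \<in> space (P x). \<omega> s \<in> D}"
  let ?u = "t - 3 * d" and ?v = "t - 2 * d"
  have uv: "0 \<le> ?u" "?u \<le> ?v" "0 \<le> ?v" "?v \<le> t" "0 \<le> t" using d by auto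
  note F = occupation_time_Fubini[OF x sets.top uv(1,2), of D]
  \<comment> \<open>The window of intermediate times has length \<open>d\<close>, and each of its
    points \<open>s\<close> satisfies \<open>2 * d \<le> t - s \<le> 3 * d\<close>.\<close>
  have "d * (?p t - M) = (LINT s:{?u<..?v}|lborel. ?p t - M)"
    using LINT_const_Ioc[OF uv(2), of "?p t - M"] by simp
  also have "\<dots> \<le> (LINT s:{?u<..?v}|lborel. ?p s)"
  proof (rule set_integral_mono)
    show "set_integrable lborel {?u<..?v} (\<lambda>s. ?p t - M)"
      using uv by (simp add: set_integrable_def)
    show "set_integrable lborel {?u<..?v} ?p"
      by (rule F(1))
    fix s assume s: "s \<in> {?u<..?v}"
    have "?p (s + (t - s)) \<le> ?p s + M"
      using s uv by (intro measure_at_le[OF x _ _ M] le) auto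
    then show "?p t - M \<le> ?p s"
      by simp
  qed
  also have "\<dots> = (\<integral>\<omega>. indicator (space (P x)) \<omega> * (occupation_time D \<omega> ?v - occupation_time D \<omega> ?u) \<partial>P x)"
    using F(2) by simp
  also have "\<dots> = (\<integral>\<omega>. occupation_time D \<omega> ?v - occupation_time D \<omega> ?u \<partial>P x)"
    by (intro Bochner_Integration.integral_cong) auto
  also have "\<dots> \<le> (\<integral>\<omega>. occupation_time D \<omega> t \<partial>P x)"
  proof (intro integral_mono Bochner_Integration.integrable_diff integrable_occupation_time x uv)
    fix \<omega> assume "\<omega> \<in> space (P x)"
    then have "occupation_time D \<omega> ?v \<le> occupation_time D \<omega> t"
      using uv by (intro occupation_time_mono[of _ K]) (auto simp: space_P[OF x])
    then show "occupation_time D \<omega> ?v - occupation_time D \<omega> ?u \<le> occupation_time D \<omega> t"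
      using occupation_time_nonneg[of D \<omega> ?u] by linarith
  qed
  finally have "?p t - M \<le> (\<integral>\<omega>. occupation_time D \<omega> t \<partial>P x) / d"
    using d by (simp add: pos_le_divide_eq mult.commute)
  then show ?thesis by simp
qed

text \<open>Products of numbers in \<open>[0, 1]\<close> differ by at most the sum of the
  differences of their factors. This reduces several times to one time each; the windows may
  overlap, and no joint law at different times is needed.\<close>

lemma fdd_average_estimate:
  assumes x: "x \<in> K" and I: "finite I" "I \<subseteq> {0..}" and d: "0 < d" and G: "G \<subseteq> K" and c: "0 \<le> c"
    and inside: "\<And>t y. t \<in> I \<Longrightarrow> y \<in> G \<Longrightarrow> y \<in> V t \<Longrightarrow> (\<integral>\<omega>. occupation_time (- V t) \<omega> d \<partial>P y) \<le> c * d"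
    and outside: "\<And>t y. t \<in> I \<Longrightarrow> y \<in> G \<Longrightarrow> y \<notin> V t \<Longrightarrow> (\<integral>\<omega>. occupation_time (V t) \<omega> d \<partial>P y) \<le> c * d"
  shows "\<bar>measure (P x) {\<omega> \<in> space (P x). \<forall>t\<in>I. \<omega> t \<in> V t}
      - (\<integral>\<omega>. (\<Prod>t\<in>I. (occupation_time (V t) \<omega> (t + d) - occupation_time (V t) \<omega> t) / d) \<partial>P x)\<bar>
    \<le> (\<Sum>t\<in>I. measure (P x) {\<omega> \<in> space (P x). \<omega> t \<notin> G} + c)"
proof -
  interpret prob_space "P x" by (rule prob_space_P[OF x])
  define avg where "avg t \<omega> = (occupation_time (V t) \<omega> (t + d) - occupation_time (V t) \<omega> t) / d" for t \<omega>
  let ?i = "\<lambda>t \<omega>. indicator (V t) (\<omega> t) :: real"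
  have avg01: "\<bar>avg t \<omega>\<bar> \<le> 1" "0 \<le> avg t \<omega>" if "\<omega> \<in> space (P x)" "t \<in> I" for t \<omega>
  proof -
    have t: "0 \<le> t" using that I by auto
    show "0 \<le> avg t \<omega>"
      using occupation_time_mono[of \<omega> K t "t + d" "V t"] that t d by (simp add: avg_def space_P[OF x])
    moreover have "avg t \<omega> \<le> 1"
      using occupation_time_diff_le[of \<omega> K t "t + d" "V t"] that t d by (simp add: avg_def space_P[OF x])
    ultimately show "\<bar>avg t \<omega>\<bar> \<le> 1" by simp
  qed
  have m_avg: "avg t \<in> borel_measurable (P x)" for t
    unfolding avg_def using borel_measurable_occupation_time[of "V t" _ K]
    by (intro borel_measurable_divide borel_measurable_diff) (auto simp: measurable_P[OF x])
  have m_i: "?i t \<in> borel_measurable (P x)" if "t \<in> I" for t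
    unfolding measurable_P[OF x] using that I(2)
    by (intro measurable_compose[OF measurable_path_component]) auto
  have i_avg: "integrable (P x) (\<lambda>\<omega>. \<Prod>t\<in>I. avg t \<omega>)"
  proof (rule integrable_const_bound[of _ 1])
    show "AE \<omega> in P x. norm (\<Prod>t\<in>I. avg t \<omega>) \<le> 1"
      using avg01 by (intro AE_I2) (simp add: abs_prod prod_le_1)
  qed (use m_avg in auto)
  have i_i: "integrable (P x) (\<lambda>\<omega>. \<Prod>t\<in>I. ?i t \<omega>)"
  proof (rule integrable_const_bound[of _ 1])
    show "AE \<omega> in P x. norm (\<Prod>t\<in>I. ?i t \<omega>) \<le> 1"
      by (intro AE_I2) (simp add: abs_prod prod_le_1)
  qed (use m_i in auto)
  have i_diff: "integrable (P x) (\<lambda>\<omega>. \<bar>?i t \<omega> - avg t \<omega>\<bar>)" if t: "t \<in> I" for t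
  proof (rule integrable_const_bound[of _ 2])
    show "AE \<omega> in P x. norm \<bar>?i t \<omega> - avg t \<omega>\<bar> \<le> 2"
    proof (rule AE_I2)
      fix \<omega> assume "\<omega> \<in> space (P x)"
      from avg01(1)[OF this t] have "\<bar>?i t \<omega> - avg t \<omega>\<bar> \<le> 2"
        by (cases "\<omega> t \<in> V t") auto
      then show "norm \<bar>?i t \<omega> - avg t \<omega>\<bar> \<le> 2" by simp
    qed
  qed (use m_i[OF t] m_avg[of t] in auto)
  have set: "{\<omega> \<in> space (P x). \<forall>t\<in>I. \<omega> t \<in> V t} \<in> sets (P x)"
    by (rule sets_path_fdd[OF x I sets.top])
  have "(\<integral>\<omega>. (\<Prod>t\<in>I. ?i t \<omega>) \<partial>P x) = (\<integral>\<omega>. indicator {\<omega> \<in> space (P x). \<forall>t\<in>I. \<omega> t \<in> V t} \<omega> \<partial>P x)"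
    using I(1) by (intro Bochner_Integration.integral_cong) (auto simp: indicator_def prod_zero_iff)
  then have "measure (P x) {\<omega> \<in> space (P x). \<forall>t\<in>I. \<omega> t \<in> V t} = (\<integral>\<omega>. (\<Prod>t\<in>I. ?i t \<omega>) \<partial>P x)"
    using sets.sets_into_space[OF set] by (simp add: Int_absorb2)
  then have "\<bar>measure (P x) {\<omega> \<in> space (P x). \<forall>t\<in>I. \<omega> t \<in> V t} - (\<integral>\<omega>. (\<Prod>t\<in>I. avg t \<omega>) \<partial>P x)\<bar>
      = \<bar>\<integral>\<omega>. (\<Prod>t\<in>I. ?i t \<omega>) - (\<Prod>t\<in>I. avg t \<omega>) \<partial>P x\<bar>"
    using i_i i_avg by simp
  also have "\<dots> \<le> (\<integral>\<omega>. \<bar>(\<Prod>t\<in>I. ?i t \<omega>) - (\<Prod>t\<in>I. avg t \<omega>)\<bar> \<partial>P x)"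
    by (rule integral_abs_bound)
  also have "\<dots> \<le> (\<integral>\<omega>. (\<Sum>t\<in>I. \<bar>?i t \<omega> - avg t \<omega>\<bar>) \<partial>P x)"
  proof (rule integral_mono)
    show "integrable (P x) (\<lambda>\<omega>. \<bar>(\<Prod>t\<in>I. ?i t \<omega>) - (\<Prod>t\<in>I. avg t \<omega>)\<bar>)"
      by (intro integrable_abs Bochner_Integration.integrable_diff i_i i_avg)
    show "integrable (P x) (\<lambda>\<omega>. \<Sum>t\<in>I. \<bar>?i t \<omega> - avg t \<omega>\<bar>)"
      by (intro Bochner_Integration.integrable_sum i_diff)
    fix \<omega> assume "\<omega> \<in> space (P x)"
    then show "\<bar>(\<Prod>t\<in>I. ?i t \<omega>) - (\<Prod>t\<in>I. avg t \<omega>)\<bar> \<le> (\<Sum>t\<in>I. \<bar>?i t \<omega> - avg t \<omega>\<bar>)"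
      using norm_prod_diff[of I "\<lambda>t. ?i t \<omega>" "\<lambda>t. avg t \<omega>"] avg01(1) by simp
  qed
  also have "\<dots> = (\<Sum>t\<in>I. \<integral>\<omega>. \<bar>?i t \<omega> - avg t \<omega>\<bar> \<partial>P x)"
    using i_diff by (intro Bochner_Integration.integral_sum)
  also have "\<dots> \<le> (\<Sum>t\<in>I. measure (P x) {\<omega> \<in> space (P x). \<omega> t \<notin> G} + c)"
    unfolding avg_def using I(2) by (intro sum_mono average_estimate[OF x _ d G c] inside outside) auto
  finally show ?thesis
    unfolding avg_def .
qed

end


subsection \<open>Wells\<close>

lemma well_index_eq:
  assumes "disjoint_family_on W {1..n}" "x \<in> {1..n}" "\<eta> \<in> W x"
  shows "well_index n W \<eta> = x"
proof -
  have "(THE y. y \<in> {1..n} \<and> \<eta> \<in> W y) = x"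
  proof (rule the_equality)
    show "y = x" if "y \<in> {1..n} \<and> \<eta> \<in> W y" for y
      using assms that unfolding disjoint_family_on_def by blast
  qed (use assms in auto)
  then show ?thesis
    using assms by (auto simp: well_index_def)
qed

lemma well_index_eq_0: "\<eta> \<notin> wells n W \<Longrightarrow> well_index n W \<eta> = 0"
  by (auto simp: well_index_def wells_def)

lemma well_index_range:
  assumes "disjoint_family_on W {1..n}"
  shows "well_index n W \<eta> \<in> {0..n}"
proof (cases "\<eta> \<in> wells n W")
  case True
  then obtain x where "x \<in> {1..n}" "\<eta> \<in> W x"
    by (auto simp: wells_def)
  then show ?thesis
    using well_index_eq[OF assms] by auto
qed (simp add: well_index_eq_0)

lemma well_index_wells:
  assumes "disjoint_family_on W {1..n}" "\<eta> \<in> wells n W"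
  shows "well_index n W \<eta> \<in> {1..n}" "\<eta> \<in> W (well_index n W \<eta>)"
proof -
  obtain x where x: "x \<in> {1..n}" "\<eta> \<in> W x"
    using assms(2) unfolding wells_def by blast
  then have "well_index n W \<eta> = x"
    using well_index_eq[OF assms(1)] by blast
  with x show "well_index n W \<eta> \<in> {1..n}" "\<eta> \<in> W (well_index n W \<eta>)"
    by simp_all
qed

locale well_chain = finite_chain K P for K :: "'a set" and P +
  fixes n :: nat and W :: "nat \<Rightarrow> 'a set" and D :: "'a set"
  assumes irreducible: "irreducible_chain K P"
    and partition: "K = wells n W \<union> D"
    and disjoint_D: "wells n W \<inter> D = {}"
    and disjoint_W: "disjoint_family_on W {1..n}"
    and wells_nonempty: "wells n W \<noteq> {}"
begin

text \<open>For \<open>a \<in> {1..n}\<close> this is the well \<open>W a\<close>; for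
  \<open>a = 0\<close> it is the complement of all wells in the whole type; for larger
  \<open>a\<close> it is empty. One formula thus covers every value of the order process.\<close>

abbreviation level :: "nat \<Rightarrow> 'a set" where
  "level a \<equiv> {\<eta>. well_index n W \<eta> = a}"

abbreviation trace_index :: "(real \<Rightarrow> 'a) \<Rightarrow> real \<Rightarrow> nat" where
  "trace_index \<omega> \<equiv> (\<lambda>t\<in>{0..}. well_index n W (trace_path (wells n W) \<omega> t))"

lemma wells_subset: "wells n W \<subseteq> K"
  using partition by blast

lemma level_well: "a \<in> {1..n} \<Longrightarrow> level a = W a"
  using well_index_eq[OF disjoint_W] well_index_wells[OF disjoint_W] well_index_eq_0[of _ n W]
  by (smt (verit, best) Collect_cong Collect_mem_eq atLeastAtMost_iff not_one_le_zero)

lemma level_no_well: "a \<notin> {1..n} \<Longrightarrow> level a \<subseteq> - wells n W"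
  using well_index_wells(1)[OF disjoint_W] by blast

lemma measurable_trace_index: "trace_index \<in> measurable (path_space K) (path_space {1..n})"
proof -
  have "(\<lambda>\<omega>. \<lambda>t\<in>{0..}. well_index n W (\<omega> t)) \<in> measurable (path_space (wells n W)) (path_space {1..n})"
    using well_index_wells(1)[OF disjoint_W] by (intro measurable_path_map) auto
  from measurable_compose[OF measurable_trace_path[OF countable_finite[OF finite_K] wells_nonempty wells_subset] this]
  show ?thesis .
qed

lemma occupation_time_D:
  assumes "\<omega> \<in> cadlag_paths K"
  shows "occupation_time (- wells n W) \<omega> t = occupation_time D \<omega> t"
  by (rule occupation_time_cong) (use cadlag_paths_range[OF assms] partition disjoint_D in blast)

text \<open>For a well this is the comparison of trace and path. For any other \<open>a\<close> the
  trace spends no time at \<open>a\<close>, and the path spends at most its time in \<open>D\<close>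
  there.\<close>

lemma occupation_time_trace_index:
  assumes \<omega>: "\<omega> \<in> cadlag_paths K" and unb: "\<forall>u. \<exists>s\<ge>0. u < occupation_time (wells n W) \<omega> s"
    and u: "0 \<le> u"
  shows "\<bar>occupation_time {a} (trace_index \<omega>) u - occupation_time (level a) \<omega> u\<bar> \<le> occupation_time D \<omega> u"
proof -
  have tr: "occupation_time {a} (trace_index \<omega>) u = occupation_time (level a) (trace_path (wells n W) \<omega>) u"
    by (rule occupation_time_cong) auto
  show ?thesis
  proof (cases "a \<in> {1..n}")
    case True
    have "W a \<subseteq> wells n W"
      using True by (auto simp: wells_def)
    from occupation_time_trace_path_bound[OF \<omega> unb this u] show ?thesis
      unfolding tr level_well[OF True] occupation_time_D[OF \<omega>] .
  next
    case False
    have "occupation_time (level a) (trace_path (wells n W) \<omega>) u = occupation_time {} \<omega> u"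
      using cadlag_paths_range[OF cadlag_trace_path[OF \<omega> wells_nonempty]] level_no_well[OF False]
      by (intro occupation_time_cong) blast
    also have "\<dots> = 0"
      by (simp add: occupation_time_def set_lebesgue_integral_def)
    finally have "occupation_time {a} (trace_index \<omega>) u = 0"
      unfolding tr .
    moreover have "occupation_time (level a) \<omega> u \<le> occupation_time D \<omega> u"
      using occupation_time_diff_mono[OF \<omega> order_refl u, of "level a" "- wells n W"] level_no_well[OF False]
        occupation_time_D[OF \<omega>, of u]
      by auto
    ultimately show ?thesis
      using occupation_time_nonneg[of "level a" \<omega> u] by simp
  qed
qed

text \<open>The average over a window is a difference of occupation times at \<open>t\<close> and
  \<open>t + d\<close>, each off by at most the time spent in \<open>D\<close> up to
  \<open>t + d\<close>; hence the factor \<open>2 / d\<close>.\<close>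

lemma trace_average_estimate:
  assumes \<eta>: "\<eta> \<in> K" and I: "finite I" "I \<subseteq> {0..}" and d: "0 < d"
  shows "\<bar>(\<integral>\<omega>. (\<Prod>t\<in>I. (occupation_time {a t} \<omega> (t + d) - occupation_time {a t} \<omega> t) / d) \<partial>trace_process_law n W (P \<eta>))
      - (\<integral>\<omega>. (\<Prod>t\<in>I. (occupation_time (level (a t)) \<omega> (t + d) - occupation_time (level (a t)) \<omega> t) / d) \<partial>P \<eta>)\<bar>
    \<le> (\<Sum>t\<in>I. 2 / d * (\<integral>\<omega>. occupation_time D \<omega> (t + d) \<partial>P \<eta>))"
proof -
  interpret prob_space "P \<eta>" by (rule prob_space_P[OF \<eta>])
  define A where "A t \<omega> = (occupation_time {a t} \<omega> (t + d) - occupation_time {a t} \<omega> t) / d" for t \<omega>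
  define B where "B t \<omega> = (occupation_time (level (a t)) \<omega> (t + d) - occupation_time (level (a t)) \<omega> t) / d" for t \<omega>
  have unit: "\<bar>(occupation_time C \<omega> (t + d) - occupation_time C \<omega> t) / d\<bar> \<le> 1"
    if "\<omega> \<in> cadlag_paths L" "t \<in> I" for C L t and \<omega> :: "real \<Rightarrow> 'c"
  proof -
    have "0 \<le> occupation_time C \<omega> (t + d) - occupation_time C \<omega> t"
      "occupation_time C \<omega> (t + d) - occupation_time C \<omega> t \<le> d"
      using occupation_time_mono[OF that(1), of t "t + d" C] occupation_time_diff_le[OF that(1), of t "t + d" C]
        that(2) I(2) d by auto
    then show ?thesis
      using d by (simp add: abs_divide)
  qed
  have tr: "trace_index \<omega> \<in> cadlag_paths {1..n}" if "\<omega> \<in> space (P \<eta>)" for \<omega>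
    using measurable_space[OF measurable_trace_index] that by (simp add: space_P[OF \<eta>])
  have mA: "A t \<in> borel_measurable (path_space {1..n})" for t
    unfolding A_def by (intro borel_measurable_divide borel_measurable_diff borel_measurable_occupation_time) simp
  have mT: "trace_index \<in> measurable (P \<eta>) (path_space {1..n})"
    using measurable_trace_index by (simp add: measurable_P[OF \<eta>])
  have mB: "B t \<in> borel_measurable (P \<eta>)" for t
    unfolding B_def measurable_P[OF \<eta>]
    by (intro borel_measurable_divide borel_measurable_diff borel_measurable_occupation_time) simp
  have mA': "(\<lambda>\<omega>. A t (trace_index \<omega>)) \<in> borel_measurable (P \<eta>)" for t
    by (rule measurable_compose[OF mT mA])
  have A1: "\<bar>A t (trace_index \<omega>)\<bar> \<le> 1" if "\<omega> \<in> space (P \<eta>)" "t \<in> I" for t \<omega>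
    unfolding A_def using tr[OF that(1)] that(2) by (rule unit)
  have B1: "\<bar>B t \<omega>\<bar> \<le> 1" if "\<omega> \<in> space (P \<eta>)" "t \<in> I" for t \<omega>
    unfolding B_def using that space_P[OF \<eta>] by (intro unit) auto
  have iA: "integrable (P \<eta>) (\<lambda>\<omega>. \<Prod>t\<in>I. A t (trace_index \<omega>))"
  proof (rule integrable_const_bound[of _ 1])
    show "AE \<omega> in P \<eta>. norm (\<Prod>t\<in>I. A t (trace_index \<omega>)) \<le> 1"
      using A1 by (intro AE_I2) (simp add: abs_prod prod_le_1)
  qed (use mA' in \<open>intro borel_measurable_prod\<close>)
  have iB: "integrable (P \<eta>) (\<lambda>\<omega>. \<Prod>t\<in>I. B t \<omega>)"
  proof (rule integrable_const_bound[of _ 1])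
    show "AE \<omega> in P \<eta>. norm (\<Prod>t\<in>I. B t \<omega>) \<le> 1"
      using B1 by (intro AE_I2) (simp add: abs_prod prod_le_1)
  qed (use mB in \<open>intro borel_measurable_prod\<close>)
  have iD: "integrable (P \<eta>) (\<lambda>\<omega>. occupation_time D \<omega> (t + d))" if "t \<in> I" for t
    using that I(2) d by (intro integrable_occupation_time[OF \<eta>]) auto
  obtain w where w: "w \<in> wells n W"
    using wells_nonempty by blast
  then have "w \<in> K"
    using wells_subset by blast
  have "(\<integral>\<omega>. (\<Prod>t\<in>I. A t \<omega>) \<partial>trace_process_law n W (P \<eta>)) = (\<integral>\<omega>. (\<Prod>t\<in>I. A t (trace_index \<omega>)) \<partial>P \<eta>)"
    unfolding trace_process_law_def using mA by (intro integral_distr[OF mT] borel_measurable_prod)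
  then have "\<bar>(\<integral>\<omega>. (\<Prod>t\<in>I. A t \<omega>) \<partial>trace_process_law n W (P \<eta>)) - (\<integral>\<omega>. (\<Prod>t\<in>I. B t \<omega>) \<partial>P \<eta>)\<bar>
      = \<bar>\<integral>\<omega>. (\<Prod>t\<in>I. A t (trace_index \<omega>)) - (\<Prod>t\<in>I. B t \<omega>) \<partial>P \<eta>\<bar>"
    using iA iB by simp
  also have "\<dots> \<le> (\<integral>\<omega>. \<bar>(\<Prod>t\<in>I. A t (trace_index \<omega>)) - (\<Prod>t\<in>I. B t \<omega>)\<bar> \<partial>P \<eta>)"
    by (rule integral_abs_bound)
  also have "\<dots> \<le> (\<integral>\<omega>. (\<Sum>t\<in>I. 2 / d * occupation_time D \<omega> (t + d)) \<partial>P \<eta>)"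
  proof (rule integral_mono_AE)
    show "integrable (P \<eta>) (\<lambda>\<omega>. \<bar>(\<Prod>t\<in>I. A t (trace_index \<omega>)) - (\<Prod>t\<in>I. B t \<omega>)\<bar>)"
      by (intro integrable_abs Bochner_Integration.integrable_diff iA iB)
    show "integrable (P \<eta>) (\<lambda>\<omega>. \<Sum>t\<in>I. 2 / d * occupation_time D \<omega> (t + d))"
      using iD by (intro Bochner_Integration.integrable_sum integrable_mult_right)
    \<comment> \<open>Only almost surely: the comparison needs an unbounded clock, as on the other
      paths the trace is an arbitrary constant.\<close>
    show "AE \<omega> in P \<eta>. \<bar>(\<Prod>t\<in>I. A t (trace_index \<omega>)) - (\<Prod>t\<in>I. B t \<omega>)\<bar>
        \<le> (\<Sum>t\<in>I. 2 / d * occupation_time D \<omega> (t + d))"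
      using AE_unbounded_occupation_time[OF irreducible \<eta> w \<open>w \<in> K\<close>] AE_space
    proof eventually_elim
      case (elim \<omega>)
      then have \<omega>: "\<omega> \<in> cadlag_paths K" by (simp add: space_P[OF \<eta>])
      have "\<bar>(\<Prod>t\<in>I. A t (trace_index \<omega>)) - (\<Prod>t\<in>I. B t \<omega>)\<bar> \<le> (\<Sum>t\<in>I. \<bar>A t (trace_index \<omega>) - B t \<omega>\<bar>)"
        using norm_prod_diff[of I "\<lambda>t. A t (trace_index \<omega>)" "\<lambda>t. B t \<omega>"] A1 B1 elim(2) by simp
      also have "\<dots> \<le> (\<Sum>t\<in>I. 2 / d * occupation_time D \<omega> (t + d))"
      proof (rule sum_mono)
        fix t assume "t \<in> I"
        then have t: "0 \<le> t" "0 \<le> t + d" "t \<le> t + d" using I(2) d by auto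
        define p q r s where pqrs: "p = occupation_time {a t} (trace_index \<omega>) (t + d)"
          "q = occupation_time {a t} (trace_index \<omega>) t"
          "r = occupation_time (level (a t)) \<omega> (t + d)" "s = occupation_time (level (a t)) \<omega> t"
        have "\<bar>p - r\<bar> \<le> occupation_time D \<omega> (t + d)" "\<bar>q - s\<bar> \<le> occupation_time D \<omega> t"
          "occupation_time D \<omega> t \<le> occupation_time D \<omega> (t + d)"
          unfolding pqrs
          by (rule occupation_time_trace_index[OF \<omega> elim(1) t(2)] occupation_time_trace_index[OF \<omega> elim(1) t(1)]
            occupation_time_mono[OF \<omega> t(1,3)])+
        then have "\<bar>(p - q) - (r - s)\<bar> \<le> 2 * occupation_time D \<omega> (t + d)"
          by linarith
        then have "\<bar>((p - q) - (r - s)) / d\<bar> \<le> 2 * occupation_time D \<omega> (t + d) / d"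
          using d by (simp add: abs_divide divide_right_mono)
        then show "\<bar>A t (trace_index \<omega>) - B t \<omega>\<bar> \<le> 2 / d * occupation_time D \<omega> (t + d)"
          unfolding A_def B_def pqrs by (simp add: diff_divide_distrib)
      qed
      finally show ?case .
    qed
  qed
  also have "\<dots> = (\<Sum>t\<in>I. 2 / d * (\<integral>\<omega>. occupation_time D \<omega> (t + d) \<partial>P \<eta>))"
    using iD by (subst Bochner_Integration.integral_sum) auto
  finally show ?thesis
    unfolding A_def B_def .
qed

text \<open>With the wells as good states, the wrong side for a state in the well \<open>W x\<close>
  is always contained in \<open>- W x\<close>, whether or not \<open>x\<close> is the prescribed
  value. So the single bound \<open>exit\<close> serves both cases.\<close>

lemma fdd_trace_estimate:
  assumes \<eta>: "\<eta> \<in> K" and I: "finite I" "I \<subseteq> {0..}" and d: "0 < d" and c: "0 \<le> c"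
    and exit: "\<And>x y. x \<in> {1..n} \<Longrightarrow> y \<in> W x \<Longrightarrow> (\<integral>\<omega>. occupation_time (- W x) \<omega> d \<partial>P y) \<le> c * d"
  shows "\<bar>measure (P \<eta>) {\<omega> \<in> space (P \<eta>). \<forall>t\<in>I. well_index n W (\<omega> t) = a t}
      - (\<integral>\<omega>. (\<Prod>t\<in>I. (occupation_time {a t} \<omega> (t + d) - occupation_time {a t} \<omega> t) / d) \<partial>trace_process_law n W (P \<eta>))\<bar>
    \<le> (\<Sum>t\<in>I. measure (P \<eta>) {\<omega> \<in> space (P \<eta>). \<omega> t \<in> D} + c + 2 / d * (\<integral>\<omega>. occupation_time D \<omega> (t + d) \<partial>P \<eta>))"
proof -
  let ?B = "\<integral>\<omega>. (\<Prod>t\<in>I. (occupation_time (level (a t)) \<omega> (t + d) - occupation_time (level (a t)) \<omega> t) / d) \<partial>P \<eta>"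
  have "\<bar>measure (P \<eta>) {\<omega> \<in> space (P \<eta>). \<forall>t\<in>I. \<omega> t \<in> level (a t)} - ?B\<bar>
      \<le> (\<Sum>t\<in>I. measure (P \<eta>) {\<omega> \<in> space (P \<eta>). \<omega> t \<notin> wells n W} + c)"
  proof (rule fdd_average_estimate[OF \<eta> I d wells_subset c])
    fix t y assume y: "y \<in> wells n W" "y \<in> level (a t)"
    then have "a t \<in> {1..n}" "y \<in> W (a t)"
      using well_index_wells[OF disjoint_W y(1)] by auto
    then show "(\<integral>\<omega>. occupation_time (- level (a t)) \<omega> d \<partial>P y) \<le> c * d"
      unfolding level_well[OF \<open>a t \<in> {1..n}\<close>] by (rule exit)
  next
    fix t y assume y: "y \<in> wells n W" "y \<notin> level (a t)"
    define x where "x = well_index n W y"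
    have x: "x \<in> {1..n}" "y \<in> W x"
      unfolding x_def by (rule well_index_wells[OF disjoint_W y(1)])+
    have yK: "y \<in> K" using y(1) wells_subset by blast
    \<comment> \<open>Here the prescribed value differs from \<open>x\<close>, so reaching it
      entails leaving the well \<open>W x\<close>.\<close>
    have "level (a t) \<subseteq> - W x"
      unfolding level_well[OF x(1), symmetric] using y(2) by (auto simp: x_def)
    then have "(\<integral>\<omega>. occupation_time (level (a t)) \<omega> d \<partial>P y) \<le> (\<integral>\<omega>. occupation_time (- W x) \<omega> d \<partial>P y)"
      using d occupation_time_diff_mono[of _ K 0 d "level (a t)" "- W x"]
      by (intro integral_mono integrable_occupation_time yK) (auto simp: space_P[OF yK])
    also have "\<dots> \<le> c * d"
      by (rule exit[OF x])
    finally show "(\<integral>\<omega>. occupation_time (level (a t)) \<omega> d \<partial>P y) \<le> c * d" .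
  qed
  moreover have "measure (P \<eta>) {\<omega> \<in> space (P \<eta>). \<omega> t \<notin> wells n W} = measure (P \<eta>) {\<omega> \<in> space (P \<eta>). \<omega> t \<in> D}"
    if "t \<in> I" for t
    using cadlag_paths_range[of _ K t] partition disjoint_D that I(2)
    by (intro arg_cong[of _ _ "measure (P \<eta>)"] Collect_cong) (auto simp: space_P[OF \<eta>])
  ultimately have "\<bar>measure (P \<eta>) {\<omega> \<in> space (P \<eta>). \<forall>t\<in>I. well_index n W (\<omega> t) = a t} - ?B\<bar>
      \<le> (\<Sum>t\<in>I. measure (P \<eta>) {\<omega> \<in> space (P \<eta>). \<omega> t \<in> D} + c)"
    by simp
  with trace_average_estimate[OF \<eta> I d, of a] show ?thesis
    unfolding sum.distrib by linarith
qed

end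


subsection \<open>Convergence of finite-dimensional distributions\<close>

text \<open>The finite product is discrete, so every function on it is a finite combination of point
  indicators. The larger set \<open>L\<close> accommodates the limit chain, which lives on
  \<open>{1..n}\<close> but is compared on \<open>{0..n}\<close>.\<close>

lemma integral_fin_dim_distr:
  assumes M: "finite_measure M" "sets M = sets (path_space K)" and K: "finite L" "K \<subseteq> L"
    and I: "finite I" "I \<subseteq> {0..}"
  shows "integral\<^sup>L (fin_dim_distr L I M) f
    = (\<Sum>a\<in>(\<Pi>\<^sub>E t\<in>I. L). f a * measure M {\<omega> \<in> space M. \<forall>t\<in>I. \<omega> t = a t})"
proof -
  interpret finite_measure M by fact
  have sp: "space M = cadlag_paths K"
    using sets_eq_imp_space_eq[OF M(2)] by simp
  have fin: "finite (\<Pi>\<^sub>E t\<in>I. L)"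
    using I(1) K(1) by (intro finite_PiE) auto
  have PiM: "(\<Pi>\<^sub>M t\<in>I. count_space L) = count_space (\<Pi>\<^sub>E t\<in>I. L)"
    by (rule count_space_PiM_finite) (use I(1) K(1) countable_finite in auto)
  have at: "(\<lambda>\<omega>. \<omega> t) \<in> measurable M (count_space L)" if "t \<in> I" for t
  proof -
    have "(\<lambda>\<omega>. \<omega> t) \<in> measurable M (count_space K)"
      using measurable_path_component[of t K] that I(2) measurable_cong_sets[OF M(2) refl] by auto
    moreover have "(\<lambda>x. x) \<in> measurable (count_space K) (count_space L)"
      using K(2) by auto
    ultimately show ?thesis
      by (rule measurable_compose)
  qed
  have m: "(\<lambda>\<omega>. restrict \<omega> I) \<in> measurable M (\<Pi>\<^sub>M t\<in>I. count_space L)"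
    using at by (intro measurable_restrict)
  have iff: "restrict \<omega> I = a \<longleftrightarrow> (\<forall>t\<in>I. \<omega> t = a t)" if "a \<in> (\<Pi>\<^sub>E t\<in>I. L)" for a and \<omega> :: "real \<Rightarrow> 'a"
  proof
    assume "\<forall>t\<in>I. \<omega> t = a t"
    then show "restrict \<omega> I = a"
      using that by (intro extensionalityI[of _ I]) (auto simp: PiE_iff)
  next
    assume "restrict \<omega> I = a"
    then show "\<forall>t\<in>I. \<omega> t = a t"
      by (metis restrict_apply')
  qed
  have S: "{\<omega> \<in> space M. \<forall>t\<in>I. \<omega> t = a t} \<in> sets M" if "a \<in> (\<Pi>\<^sub>E t\<in>I. L)" for a
  proof -
    have "{a} \<in> sets (\<Pi>\<^sub>M t\<in>I. count_space L)"
      using that by (simp add: PiM)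
    from measurable_sets[OF m this]
    have "(\<lambda>\<omega>. restrict \<omega> I) -` {a} \<inter> space M \<in> sets M" .
    also have "(\<lambda>\<omega>. restrict \<omega> I) -` {a} \<inter> space M = {\<omega> \<in> space M. \<forall>t\<in>I. \<omega> t = a t}"
      unfolding iff[OF that, symmetric] by blast
    finally show ?thesis .
  qed
  have "integral\<^sup>L (fin_dim_distr L I M) f = (\<integral>\<omega>. f (restrict \<omega> I) \<partial>M)"
    unfolding fin_dim_distr_def by (rule integral_distr[OF m]) (simp add: PiM)
  also have "\<dots> = (\<integral>\<omega>. (\<Sum>a\<in>(\<Pi>\<^sub>E t\<in>I. L). f a * indicator {\<omega> \<in> space M. \<forall>t\<in>I. \<omega> t = a t} \<omega>) \<partial>M)"
  proof (intro Bochner_Integration.integral_cong refl)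
    fix \<omega> assume \<omega>: "\<omega> \<in> space M"
    then have r: "restrict \<omega> I \<in> (\<Pi>\<^sub>E t\<in>I. L)"
      using cadlag_paths_range[of \<omega> K] I(2) K(2) sp by auto
    have "(\<Sum>a\<in>(\<Pi>\<^sub>E t\<in>I. L). f a * indicator {\<omega> \<in> space M. \<forall>t\<in>I. \<omega> t = a t} \<omega>)
        = (\<Sum>a\<in>(\<Pi>\<^sub>E t\<in>I. L). if a = restrict \<omega> I then f a else 0)"
    proof (rule sum.cong[OF refl])
      fix a assume a: "a \<in> (\<Pi>\<^sub>E t\<in>I. L)"
      show "f a * indicator {\<omega> \<in> space M. \<forall>t\<in>I. \<omega> t = a t} \<omega> = (if a = restrict \<omega> I then f a else 0)"
        using \<omega> unfolding iff[OF a, symmetric] by (auto simp: indicator_def)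
    qed
    also have "\<dots> = f (restrict \<omega> I)"
      using r fin by simp
    finally show "f (restrict \<omega> I) = (\<Sum>a\<in>(\<Pi>\<^sub>E t\<in>I. L). f a * indicator {\<omega> \<in> space M. \<forall>t\<in>I. \<omega> t = a t} \<omega>)" ..
  qed
  also have "\<dots> = (\<Sum>a\<in>(\<Pi>\<^sub>E t\<in>I. L). f a * measure M {\<omega> \<in> space M. \<forall>t\<in>I. \<omega> t = a t})"
  proof (subst Bochner_Integration.integral_sum)
    show "integrable M (\<lambda>\<omega>. f a * indicator {\<omega> \<in> space M. \<forall>t\<in>I. \<omega> t = a t} \<omega>)" if "a \<in> (\<Pi>\<^sub>E t\<in>I. L)" for a
      using S[OF that] by (intro integrable_mult_right) (simp add: emeasure_eq_measure)
    show "(\<Sum>a\<in>(\<Pi>\<^sub>E t\<in>I. L). \<integral>\<omega>. f a * indicator {\<omega> \<in> space M. \<forall>t\<in>I. \<omega> t = a t} \<omega> \<partial>M)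
        = (\<Sum>a\<in>(\<Pi>\<^sub>E t\<in>I. L). f a * measure M {\<omega> \<in> space M. \<forall>t\<in>I. \<omega> t = a t})"
    proof (rule sum.cong[OF refl])
      fix a assume "a \<in> (\<Pi>\<^sub>E t\<in>I. L)"
      from sets.sets_into_space[OF S[OF this]]
      show "(\<integral>\<omega>. f a * indicator {\<omega> \<in> space M. \<forall>t\<in>I. \<omega> t = a t} \<omega> \<partial>M)
          = f a * measure M {\<omega> \<in> space M. \<forall>t\<in>I. \<omega> t = a t}"
        by (simp add: Int_absorb2)
    qed
  qed
  finally show ?thesis .
qed

text \<open>On a finite discrete product, convergence of the point probabilities gives convergence
  of all integrals. Assumptions on \<open>M N\<close> are only eventual, as the chains are given for
  \<open>N \<ge> 1\<close>.\<close>

lemma fdd_convI: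
  assumes M: "\<forall>\<^sub>F N in sequentially. finite_measure (M N) \<and> sets (M N) = sets (path_space L)"
    and M': "finite_measure M'" "sets M' = sets (path_space K)" and K: "finite L" "K \<subseteq> L"
    and conv: "\<And>I a. finite I \<Longrightarrow> I \<subseteq> {0..} \<Longrightarrow>
      (\<lambda>N. measure (M N) {\<omega> \<in> space (M N). \<forall>t\<in>I. \<omega> t = a t})
        \<longlonglongrightarrow> measure M' {\<omega> \<in> space M'. \<forall>t\<in>I. \<omega> t = a t}"
  shows "fdd_conv L M M'"
  unfolding fdd_conv_def weak_conv_in_def
proof (intro allI impI, elim conjE)
  fix I :: "real set" and f :: "(real \<Rightarrow> 'a) \<Rightarrow> real" assume I: "finite I" "I \<subseteq> {0..}"
  have "(\<lambda>N. \<Sum>a\<in>(\<Pi>\<^sub>E t\<in>I. L). f a * measure (M N) {\<omega> \<in> space (M N). \<forall>t\<in>I. \<omega> t = a t})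
      \<longlonglongrightarrow> integral\<^sup>L (fin_dim_distr L I M') f"
    unfolding integral_fin_dim_distr[OF M' K I] by (intro tendsto_intros conv I)
  moreover have "\<forall>\<^sub>F N in sequentially. integral\<^sup>L (fin_dim_distr L I (M N)) f
      = (\<Sum>a\<in>(\<Pi>\<^sub>E t\<in>I. L). f a * measure (M N) {\<omega> \<in> space (M N). \<forall>t\<in>I. \<omega> t = a t})"
    using M by eventually_elim (simp add: integral_fin_dim_distr[OF _ _ K(1) order_refl I])
  ultimately show "(\<lambda>N. integral\<^sup>L (fin_dim_distr L I (M N)) f) \<longlonglongrightarrow> integral\<^sup>L (fin_dim_distr L I M') f"
    by (simp add: tendsto_cong)
qed

lemma (in well_chain) order_process_law:
  assumes \<eta>: "\<eta> \<in> K"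
  shows "finite_measure (order_process_law n W (P \<eta>))"
    and "sets (order_process_law n W (P \<eta>)) = sets (path_space {0..n})"
    and "finite I \<Longrightarrow> I \<subseteq> {0..} \<Longrightarrow>
      measure (order_process_law n W (P \<eta>)) {\<omega> \<in> space (order_process_law n W (P \<eta>)). \<forall>t\<in>I. \<omega> t = a t}
      = measure (P \<eta>) {\<omega> \<in> space (P \<eta>). \<forall>t\<in>I. well_index n W (\<omega> t) = a t}"
proof -
  interpret prob_space "P \<eta>" by (rule prob_space_P[OF \<eta>])
  let ?\<Phi> = "\<lambda>\<omega>. \<lambda>t\<in>{0..}. well_index n W (\<omega> t)"
  have "?\<Phi> \<in> measurable (path_space K) (path_space {0..n})"
    using well_index_range[OF disjoint_W] by (intro measurable_path_map) auto
  then have m: "?\<Phi> \<in> measurable (P \<eta>) (path_space {0..n})"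
    by (simp add: measurable_P[OF \<eta>])
  interpret \<Phi>: prob_space "order_process_law n W (P \<eta>)"
    unfolding order_process_law_def by (rule prob_space_distr[OF m])
  show "finite_measure (order_process_law n W (P \<eta>))"
    by (rule \<Phi>.finite_measure_axioms)
  show "sets (order_process_law n W (P \<eta>)) = sets (path_space {0..n})"
    by (simp add: order_process_law_def)
  assume I: "finite I" "I \<subseteq> {0..}"
  let ?S = "{\<omega> \<in> cadlag_paths {0..n}. \<forall>t\<in>I. \<omega> t = a t}"
  have "{\<omega> \<in> space (path_space {0..n}). \<omega> t = a t} \<in> sets (path_space {0..n})" if "t \<in> I" for t
  proof -
    have t: "0 \<le> t" using that I(2) by auto
    have "{\<omega> \<in> space (path_space {0..n}). \<omega> t = a t}
        = (\<lambda>\<omega>. \<omega> t) -` ({a t} \<inter> {0..n}) \<inter> space (path_space {0..n})"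
      using cadlag_paths_range[of _ "{0..n}", OF _ t] by fastforce
    also have "\<dots> \<in> sets (path_space {0..n})"
      by (rule measurable_sets[OF measurable_path_component[OF t]]) simp
    finally show ?thesis .
  qed
  then have S: "?S \<in> sets (path_space {0..n})"
    using sets.sets_Collect_finite_All[of I "path_space {0..n}" "\<lambda>t \<omega>. \<omega> t = a t"] I(1) by simp
  have "measure (order_process_law n W (P \<eta>)) {\<omega> \<in> space (order_process_law n W (P \<eta>)). \<forall>t\<in>I. \<omega> t = a t}
      = measure (P \<eta>) (?\<Phi> -` ?S \<inter> space (P \<eta>))"
    unfolding order_process_law_def using measure_distr[OF m S] by simp
  also have "?\<Phi> -` ?S \<inter> space (P \<eta>) = {\<omega> \<in> space (P \<eta>). \<forall>t\<in>I. well_index n W (\<omega> t) = a t}"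
    using measurable_space[OF m] I(2) by auto
  finally show "measure (order_process_law n W (P \<eta>)) {\<omega> \<in> space (order_process_law n W (P \<eta>)). \<forall>t\<in>I. \<omega> t = a t}
      = measure (P \<eta>) {\<omega> \<in> space (P \<eta>). \<forall>t\<in>I. well_index n W (\<omega> t) = a t}" .
qed

lemma weak_conv_average:
  assumes conv: "weak_conv_in (skorohod_topology L) M M'"
    and I: "finite I" "I \<subseteq> {0..}" and d: "0 < d"
  shows "(\<lambda>N. \<integral>\<omega>. (\<Prod>t\<in>I. (occupation_time (A t) \<omega> (t + d) - occupation_time (A t) \<omega> t) / d) \<partial>M N)
    \<longlonglongrightarrow> (\<integral>\<omega>. (\<Prod>t\<in>I. (occupation_time (A t) \<omega> (t + d) - occupation_time (A t) \<omega> t) / d) \<partial>M')"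
proof -
  let ?f = "\<lambda>\<omega>. \<Prod>t\<in>I. (occupation_time (A t) \<omega> (t + d) - occupation_time (A t) \<omega> t) / d"
  have "continuous_map (skorohod_topology L) euclideanreal ?f"
    using I(1) d by (intro continuous_map_prod continuous_map_real_divide continuous_map_diff
        continuous_map_occupation_time) auto
  moreover have "\<bar>?f \<omega>\<bar> \<le> 1" if "\<omega> \<in> topspace (skorohod_topology L)" for \<omega>
  proof -
    have \<omega>: "\<omega> \<in> cadlag_paths L"
      using that by (simp add: topspace_skorohod)
    have "\<bar>(occupation_time (A t) \<omega> (t + d) - occupation_time (A t) \<omega> t) / d\<bar> \<le> 1" if "t \<in> I" for t
      using occupation_time_mono[OF \<omega>, of t "t + d" "A t"] occupation_time_diff_le[OF \<omega>, of t "t + d" "A t"]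
        that I(2) d by (auto simp: abs_divide)
    then show ?thesis
      unfolding abs_prod by (intro prod_le_1) auto
  qed
  ultimately show ?thesis
    using conv unfolding weak_conv_in_def by blast
qed

theorem proposition2p1:
  fixes n :: nat
    and E :: "nat \<Rightarrow> 'e set" and W :: "nat \<Rightarrow> nat \<Rightarrow> 'e set" and \<Delta> :: "nat \<Rightarrow> 'e set"
    and \<theta> :: "nat \<Rightarrow> real"
    and Q P :: "nat \<Rightarrow> 'e \<Rightarrow> (real \<Rightarrow> 'e) measure"
    and PX :: "nat \<Rightarrow> (real \<Rightarrow> nat) measure"
  assumes n: "n \<ge> 2"
    and finite: "\<And>N. N \<ge> 1 \<Longrightarrow> finite (E N)"
    and card: "filterlim (\<lambda>N. card (E N)) at_top sequentially"
    and chain: "\<And>N. N \<ge> 1 \<Longrightarrow> markov_chain (E N) (Q N)"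
    and irreducible: "\<And>N. N \<ge> 1 \<Longrightarrow> irreducible_chain (E N) (Q N)"
    and partition: "\<And>N. N \<ge> 1 \<Longrightarrow> E N = wells n (W N) \<union> \<Delta> N"
    and disjoint_\<Delta>: "\<And>N. N \<ge> 1 \<Longrightarrow> wells n (W N) \<inter> \<Delta> N = {}"
    and disjoint_wells: "\<And>N. N \<ge> 1 \<Longrightarrow> disjoint_family_on (W N) {1..n}"
    and nonempty: "\<And>N x. N \<ge> 1 \<Longrightarrow> x \<in> {1..n} \<Longrightarrow> W N x \<noteq> {}"
    and \<theta>_pos: "\<And>N. N \<ge> 1 \<Longrightarrow> \<theta> N > 0"
    and P_law: "\<And>N \<eta>. P N \<eta> = accelerated_law (E N) (\<theta> N) (Q N \<eta>)"
    and limit_chain: "markov_chain {1..n} PX"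
    and trace_conv: "\<And>x \<eta>. x \<in> {1..n} \<Longrightarrow> (\<And>N. N \<ge> 1 \<Longrightarrow> \<eta> N \<in> W N x) \<Longrightarrow>
      weak_conv_in (skorohod_topology {1..n})
        (\<lambda>N. trace_process_law n (W N) (P N (\<eta> N))) (PX x)"
    and negligible: "\<And>t. t > 0 \<Longrightarrow>
      (\<lambda>N. Max ((\<lambda>\<eta>. \<integral>\<omega>. occupation_time (\<Delta> N) \<omega> t \<partial>P N \<eta>) ` wells n (W N)))
        \<longlonglongrightarrow> 0"
    and short_times: "\<And>x. x \<in> {1..n} \<Longrightarrow>
      ((\<lambda>\<delta>. limsup (\<lambda>N. ereal (Max ((\<lambda>\<eta>.
          SUP s\<in>{2 * \<delta>..3 * \<delta>}. measure (P N \<eta>) {\<omega> \<in> space (P N \<eta>). \<omega> s \<in> \<Delta> N}) ` W N x))))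
        \<longlongrightarrow> 0) (at_right (0::real))"
  shows "\<forall>x\<in>{1..n}. \<forall>\<eta>. (\<forall>N\<ge>1. \<eta> N \<in> W N x) \<longrightarrow>
    fdd_conv {0..n} (\<lambda>N. order_process_law n (W N) (P N (\<eta> N))) (PX x)"
proof (intro ballI allI impI)
  fix x and \<eta> :: "nat \<Rightarrow> 'e"
  assume x: "x \<in> {1..n}" and \<eta>: "\<forall>N\<ge>1. \<eta> N \<in> W N x"

  \<comment> \<open>The accelerated chains and their wells\<close>
  have W0: "wells n (W N) \<noteq> {}" if "N \<ge> 1" for N
    using nonempty[OF that x] x by (auto simp: wells_def)
  have wc: "well_chain (E N) (P N) n (W N) (\<Delta> N)" if N: "N \<ge> 1" for N
  proof -
    interpret Q: finite_chain "E N" "Q N"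
      using finite[OF N] chain[OF N] by unfold_locales
    have P: "P N = (\<lambda>\<eta>. accelerated_law (E N) (\<theta> N) (Q N \<eta>))"
      using P_law by blast
    have "finite_chain (E N) (P N)" "irreducible_chain (E N) (P N)"
      unfolding P by (rule Q.accelerated[OF \<theta>_pos[OF N]]
        Q.irreducible_accelerated[OF irreducible[OF N] \<theta>_pos[OF N]])+
    then show ?thesis
      unfolding well_chain_def well_chain_axioms_def
      using partition[OF N] disjoint_\<Delta>[OF N] disjoint_wells[OF N] W0[OF N] by blast
  qed
  interpret X: finite_chain "{1..n}" PX
    using limit_chain by unfold_locales auto
  have W_E: "y \<in> E N" "y \<in> wells n (W N)" if "N \<ge> 1" "z \<in> {1..n}" "y \<in> W N z" for N z y
    using partition[OF that(1)] that(2,3) by (auto simp: wells_def)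
  have fin_wells: "finite (wells n (W N))" "finite (W N z)" if "N \<ge> 1" "z \<in> {1..n}" for N z
    using finite[OF that(1)] W_E(1,2)[OF that] partition[OF that(1)]
    by (auto intro: finite_subset[of _ "E N"])

  \<comment> \<open>Expected time spent in \<open>\<Delta>\<close>\<close>
  have occ_\<Delta>: "(\<lambda>N. \<integral>\<omega>. occupation_time (\<Delta> N) \<omega> t \<partial>P N (y N)) \<longlonglongrightarrow> 0"
    if t: "0 < t" and z: "z \<in> {1..n}" and y: "\<And>N. N \<ge> 1 \<Longrightarrow> y N \<in> W N z" for t y z
  proof (rule tendsto_sandwich[OF _ _ tendsto_const negligible[OF t]])
    show "\<forall>\<^sub>F N in sequentially. 0 \<le> (\<integral>\<omega>. occupation_time (\<Delta> N) \<omega> t \<partial>P N (y N))"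
      by (intro always_eventually allI Bochner_Integration.integral_nonneg occupation_time_nonneg)
    show "\<forall>\<^sub>F N in sequentially. (\<integral>\<omega>. occupation_time (\<Delta> N) \<omega> t \<partial>P N (y N))
        \<le> Max ((\<lambda>\<eta>. \<integral>\<omega>. occupation_time (\<Delta> N) \<omega> t \<partial>P N \<eta>) ` wells n (W N))"
      using eventually_ge_at_top[of "1::nat"]
    proof eventually_elim
      case (elim N)
      show ?case
        using fin_wells(1)[OF elim z] W_E(2)[OF elim z y[OF elim]] by (intro Max_ge) auto
    qed
  qed

  \<comment> \<open>Probability of being in \<open>\<Delta>\<close> at a fixed time\<close>
  have at_\<Delta>: "(\<lambda>N. measure (P N (\<eta> N)) {\<omega> \<in> space (P N (\<eta> N)). \<omega> t \<in> \<Delta> N}) \<longlonglongrightarrow> 0" if "0 \<le> t" for t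
  \<comment> \<open>Time \<open>0\<close> leaves no room for an earlier time \<open>t - r\<close>,
    but there the chain is almost surely at its starting point, in a well.\<close>
  proof (cases "t = 0")
    case True
    have "\<forall>\<^sub>F N in sequentially. measure (P N (\<eta> N)) {\<omega> \<in> space (P N (\<eta> N)). \<omega> t \<in> \<Delta> N} = 0"
      using eventually_ge_at_top[of "1::nat"]
    proof eventually_elim
      case (elim N)
      interpret C: well_chain "E N" "P N" n "W N" "\<Delta> N" by (rule wc[OF elim])
      have \<eta>N: "\<eta> N \<in> E N" "\<eta> N \<in> wells n (W N)"
        using W_E[OF elim x] \<eta> elim by auto
      interpret prob_space "P N (\<eta> N)" by (rule C.prob_space_P[OF \<eta>N(1)])
      have "AE \<omega> in P N (\<eta> N). \<omega> t \<notin> \<Delta> N"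
        using C.AE_start[OF \<eta>N(1)] by eventually_elim (use \<eta>N(2) C.disjoint_D True in auto)
      then show ?case
        using C.sets_path_at[OF \<eta>N(1) that, of "\<Delta> N"] by (subst prob_eq_0) auto
    qed
    then show ?thesis
      by (rule tendsto_eventually)
  next
    case False
    with that have t: "0 < t" by simp
    show ?thesis
    proof (rule order_tendstoI)
      fix e :: real assume "e < 0"
      then show "\<forall>\<^sub>F N in sequentially. e < measure (P N (\<eta> N)) {\<omega> \<in> space (P N (\<eta> N)). \<omega> t \<in> \<Delta> N}"
        by (intro always_eventually allI) (meson less_le_trans measure_nonneg)
    next
      fix e :: real assume e: "0 < e"
      define m where "m N z d = Max ((\<lambda>\<eta>. SUP s\<in>{2 * d..3 * d}. measure (P N \<eta>) {\<omega> \<in> space (P N \<eta>). \<omega> s \<in> \<Delta> N}) ` W N z)"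
        for N z and d :: real
      \<comment> \<open>Condition (iii) is available well by well; as there are finitely many wells,
        one \<open>d\<close> serves them all.\<close>
      have "\<forall>\<^sub>F d in at_right 0. \<forall>z\<in>{1..n}. limsup (\<lambda>N. ereal (m N z d)) < ereal (e / 2)"
      proof (intro eventually_ball_finite ballI)
        fix z assume "z \<in> {1..n}"
        from short_times[OF this] show "\<forall>\<^sub>F d in at_right 0. limsup (\<lambda>N. ereal (m N z d)) < ereal (e / 2)"
          unfolding m_def by (rule order_tendstoD) (use e in simp)
      qed simp
      moreover have "\<forall>\<^sub>F d in at_right 0. 0 < d \<and> d < t / 3"
        using t by (auto simp: eventually_at_right_field intro!: exI[of _ "t / 3"])
      ultimately have "\<forall>\<^sub>F d in at_right 0. (\<forall>z\<in>{1..n}. limsup (\<lambda>N. ereal (m N z d)) < ereal (e / 2)) \<and> 0 < d \<and> d < t / 3"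
        by (rule eventually_conj)
      then obtain d where d: "0 < d" "d < t / 3" "\<And>z. z \<in> {1..n} \<Longrightarrow> limsup (\<lambda>N. ereal (m N z d)) < ereal (e / 2)"
        using eventually_happens'[OF trivial_limit_at_right_real] by blast
      have "\<forall>\<^sub>F N in sequentially. \<forall>z\<in>{1..n}. ereal (m N z d) < ereal (e / 2)"
        by (intro eventually_ball_finite ballI Limsup_lessD d(3)) auto
      \<comment> \<open>The factor \<open>d\<close> in the threshold compensates the later division
        by \<open>d\<close>, which stays fixed while \<open>N\<close> grows.\<close>
      moreover have "\<forall>\<^sub>F N in sequentially. (\<integral>\<omega>. occupation_time (\<Delta> N) \<omega> t \<partial>P N (\<eta> N)) < d * (e / 2)"
        using \<eta> d(1) e by (intro order_tendstoD(2)[OF occ_\<Delta>[OF t x]]) auto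
      ultimately show "\<forall>\<^sub>F N in sequentially. measure (P N (\<eta> N)) {\<omega> \<in> space (P N (\<eta> N)). \<omega> t \<in> \<Delta> N} < e"
        using eventually_ge_at_top[of "1::nat"]
      proof eventually_elim
        case (elim N)
        interpret C: well_chain "E N" "P N" n "W N" "\<Delta> N" by (rule wc[OF elim(3)])
        have "measure (P N (\<eta> N)) {\<omega> \<in> space (P N (\<eta> N)). \<omega> t \<in> \<Delta> N}
            \<le> (\<integral>\<omega>. occupation_time (\<Delta> N) \<omega> t \<partial>P N (\<eta> N)) / d + e / 2"
        proof (rule C.measure_at_le_occupation_time)
          show "\<eta> N \<in> E N"
            using W_E(1)[OF elim(3) x] \<eta> elim(3) by auto
          fix y r assume y: "y \<in> E N" "y \<notin> \<Delta> N" and r: "2 * d \<le> r" "r \<le> 3 * d"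
          let ?p = "\<lambda>y s. measure (P N y) {\<omega> \<in> space (P N y). \<omega> s \<in> \<Delta> N}"
          obtain z where z: "z \<in> {1..n}" "y \<in> W N z"
            using y C.partition by (auto simp: wells_def)
          have "bdd_above (?p y ` {2 * d..3 * d})"
            by (rule bdd_aboveI[of _ 1]) (use prob_space.prob_le_1[OF C.prob_space_P[OF y(1)]] in auto)
          then have "?p y r \<le> (SUP s\<in>{2 * d..3 * d}. ?p y s)"
            using r by (intro cSUP_upper) auto
          also have "\<dots> \<le> m N z d"
            unfolding m_def using fin_wells(2)[OF elim(3) z(1)] z(2) by (intro Max_ge) auto
          also have "\<dots> \<le> e / 2"
            using elim(1) z(1) by (auto intro: less_imp_le)
          finally show "?p y r \<le> e / 2" .
        qed (use d e in auto)
        also have "\<dots> < e / 2 + e / 2"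
          using elim(2) d(1) by (intro add_strict_right_mono) (simp add: pos_divide_less_eq mult.commute)
        finally show ?case by simp
      qed
    qed
  qed

  \<comment> \<open>Fraction of a short time spent outside of the starting well\<close>
  define q where "q d = (\<Sum>z\<in>{1..n}. (\<integral>\<omega>. occupation_time (- {z}) \<omega> d \<partial>PX z) / d)" for d
  \<comment> \<open>A sum over wells rather than a maximum: it dominates each nonnegative summand
    all the same, and limits pass through it termwise.\<close>
  define qN where "qN N d = (\<Sum>z\<in>{1..n}. Max ((\<lambda>y. (\<integral>\<omega>. occupation_time (- W N z) \<omega> d \<partial>P N y) / d) ` W N z))" for N d
  have q_0: "(q \<longlongrightarrow> 0) (at_right 0)"
    unfolding q_def by (rule tendsto_null_sum) (rule X.tendsto_early_exit)
  have exit_nonneg: "0 \<le> (\<integral>\<omega>. occupation_time B \<omega> d \<partial>M) / d" if "0 < d" for B M and d :: real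
    using that by (intro divide_nonneg_pos Bochner_Integration.integral_nonneg occupation_time_nonneg)

  have qN: "(\<lambda>N. qN N d) \<longlonglongrightarrow> q d" if d: "0 < d" for d
    unfolding qN_def q_def
  proof (rule tendsto_sum)
    fix z assume z: "z \<in> {1..n}"
    let ?e = "\<lambda>N y. (\<integral>\<omega>. occupation_time (- W N z) \<omega> d \<partial>P N y) / d"
    \<comment> \<open>The product over the single time \<open>0\<close> is the fraction of
      \<open>[0, d]\<close> spent in \<open>A\<close>, written so that the results on products of
      averages apply.\<close>
    let ?avg = "\<lambda>(A :: nat set) \<omega>. \<Prod>t\<in>{0}. (occupation_time A \<omega> (t + d) - occupation_time A \<omega> t) / d"
    \<comment> \<open>A worst starting state exists because the well is finite and nonempty. Trace
      convergence along the sequence of worst states turns a pointwise hypothesis into a uniform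
      bound.\<close>
    have "\<exists>y. y \<in> W N z \<and> ?e N y = Max (?e N ` W N z)" if N: "N \<ge> 1" for N
    proof -
      have "Max (?e N ` W N z) \<in> ?e N ` W N z"
        using fin_wells(2)[OF N z] nonempty[OF N z] by (intro Max_in) auto
      then show ?thesis
        unfolding image_iff by metis
    qed
    then obtain y where y: "\<And>N. N \<ge> 1 \<Longrightarrow> y N \<in> W N z" "\<And>N. N \<ge> 1 \<Longrightarrow> ?e N (y N) = Max (?e N ` W N z)"
      by metis
    have "(\<lambda>N. \<integral>\<omega>. ?avg {z} \<omega> \<partial>trace_process_law n (W N) (P N (y N))) \<longlonglongrightarrow> (\<integral>\<omega>. ?avg {z} \<omega> \<partial>PX z)"
      by (rule weak_conv_average[OF trace_conv[OF z y(1)]]) (use d in auto)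
    moreover have "(\<lambda>N. 2 / d * (\<integral>\<omega>. occupation_time (\<Delta> N) \<omega> d \<partial>P N (y N))) \<longlonglongrightarrow> 0"
      by (rule tendsto_mult_right_zero[OF occ_\<Delta>[OF d z y(1)]])
    then have "(\<lambda>N. (\<integral>\<omega>. ?avg {z} \<omega> \<partial>trace_process_law n (W N) (P N (y N))) - (1 - ?e N (y N))) \<longlonglongrightarrow> 0"
    proof (rule Lim_null_comparison[rotated])
      show "\<forall>\<^sub>F N in sequentially. norm ((\<integral>\<omega>. ?avg {z} \<omega> \<partial>trace_process_law n (W N) (P N (y N))) - (1 - ?e N (y N)))
          \<le> 2 / d * (\<integral>\<omega>. occupation_time (\<Delta> N) \<omega> d \<partial>P N (y N))"
        using eventually_ge_at_top[of "1::nat"]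
      proof eventually_elim
        case (elim N)
        interpret C: well_chain "E N" "P N" n "W N" "\<Delta> N" by (rule wc[OF elim])
        have yE: "y N \<in> E N"
          by (rule W_E(1)[OF elim z y(1)[OF elim]])
        interpret prob_space "P N (y N)" by (rule C.prob_space_P[OF yE])
        have "(\<integral>\<omega>. occupation_time (W N z) \<omega> d / d \<partial>P N (y N)) = (\<integral>\<omega>. 1 - occupation_time (- W N z) \<omega> d / d \<partial>P N (y N))"
        proof (intro Bochner_Integration.integral_cong refl)
          fix \<omega> assume "\<omega> \<in> space (P N (y N))"
          then have "occupation_time (W N z) \<omega> d + occupation_time (- W N z) \<omega> d = d"
            using d by (intro occupation_time_Compl[of _ "E N"]) (auto simp: C.space_P[OF yE])
          then have "(occupation_time (W N z) \<omega> d + occupation_time (- W N z) \<omega> d) / d = 1"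
            using d by simp
          then show "occupation_time (W N z) \<omega> d / d = 1 - occupation_time (- W N z) \<omega> d / d"
            by (simp add: add_divide_distrib)
        qed
        also have "\<dots> = 1 - ?e N (y N)"
          using C.integrable_occupation_time[OF yE, of d "- W N z"] d by (simp add: prob_space)
        finally have "(\<integral>\<omega>. occupation_time (W N z) \<omega> d / d \<partial>P N (y N)) = 1 - ?e N (y N)" .
        then show ?case
          using C.trace_average_estimate[OF yE _ _ d, of "{0}" "\<lambda>_. z"] C.level_well[OF z] by simp
      qed
    qed
    \<comment> \<open>The nested difference simplifies to \<open>?e N (y N)\<close>; it is arranged
      so that both ingredients have known limits.\<close>
    ultimately have "(\<lambda>N. 1 - ((\<integral>\<omega>. ?avg {z} \<omega> \<partial>trace_process_law n (W N) (P N (y N)))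
        - ((\<integral>\<omega>. ?avg {z} \<omega> \<partial>trace_process_law n (W N) (P N (y N))) - (1 - ?e N (y N)))))
        \<longlonglongrightarrow> 1 - ((\<integral>\<omega>. ?avg {z} \<omega> \<partial>PX z) - 0)"
      by (intro tendsto_diff tendsto_const)
    moreover have "1 - (\<integral>\<omega>. ?avg {z} \<omega> \<partial>PX z) = (\<integral>\<omega>. occupation_time (- {z}) \<omega> d \<partial>PX z) / d"
    proof -
      interpret prob_space "PX z" by (rule X.prob_space_P[OF z])
      have "(\<integral>\<omega>. ?avg {z} \<omega> \<partial>PX z) = (\<integral>\<omega>. 1 - occupation_time (- {z}) \<omega> d / d \<partial>PX z)"
      proof (intro Bochner_Integration.integral_cong refl)
        fix \<omega> assume "\<omega> \<in> space (PX z)"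
        then have "occupation_time {z} \<omega> d + occupation_time (- {z}) \<omega> d = d"
          using d by (intro occupation_time_Compl[of _ "{1..n}"]) (auto simp: X.space_P[OF z])
        then have "(occupation_time {z} \<omega> d + occupation_time (- {z}) \<omega> d) / d = 1"
          using d by simp
        then show "?avg {z} \<omega> = 1 - occupation_time (- {z}) \<omega> d / d"
          by (simp add: add_divide_distrib)
      qed
      also have "\<dots> = 1 - (\<integral>\<omega>. occupation_time (- {z}) \<omega> d \<partial>PX z) / d"
        using X.integrable_occupation_time[OF z, of d "- {z}"] d by (simp add: prob_space)
      finally show ?thesis by simp
    qed
    ultimately have "(\<lambda>N. ?e N (y N)) \<longlonglongrightarrow> (\<integral>\<omega>. occupation_time (- {z}) \<omega> d \<partial>PX z) / d"
      by simp
    moreover have "\<forall>\<^sub>F N in sequentially. ?e N (y N) = Max (?e N ` W N z)"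
      using eventually_ge_at_top[of "1::nat"] by eventually_elim (rule y(2))
    ultimately show "(\<lambda>N. Max (?e N ` W N z)) \<longlonglongrightarrow> (\<integral>\<omega>. occupation_time (- {z}) \<omega> d \<partial>PX z) / d"
      by (rule Lim_transform_eventually)
  qed

  \<comment> \<open>Comparison of the finite-dimensional distributions\<close>
  have \<eta>E: "\<eta> N \<in> E N" if "N \<ge> 1" for N
    using W_E(1)[OF that x] \<eta> that by auto
  interpret PX: prob_space "PX x" by (rule X.prob_space_P[OF x])
  show "fdd_conv {0..n} (\<lambda>N. order_process_law n (W N) (P N (\<eta> N))) (PX x)"
  proof (rule fdd_convI)
    show "\<forall>\<^sub>F N in sequentially. finite_measure (order_process_law n (W N) (P N (\<eta> N)))
        \<and> sets (order_process_law n (W N) (P N (\<eta> N))) = sets (path_space {0..n})"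
      using eventually_ge_at_top[of "1::nat"]
      by eventually_elim (use well_chain.order_process_law(1,2)[OF wc \<eta>E] in blast)
    show "finite_measure (PX x)" by (rule PX.finite_measure_axioms)
    show "sets (PX x) = sets (path_space {1..n})" by (rule X.sets_P[OF x])
  next
    fix I :: "real set" and a :: "real \<Rightarrow> nat" assume I: "finite I" "I \<subseteq> {0..}"
    let ?L = "\<lambda>N. order_process_law n (W N) (P N (\<eta> N))"
    let ?p = "\<lambda>N. measure (P N (\<eta> N)) {\<omega> \<in> space (P N (\<eta> N)). \<forall>t\<in>I. well_index n (W N) (\<omega> t) = a t}"
    let ?pX = "measure (PX x) {\<omega> \<in> space (PX x). \<forall>t\<in>I. \<omega> t = a t}"
    let ?avg = "\<lambda>d \<omega>. \<Prod>t\<in>I. (occupation_time {a t} \<omega> (t + d) - occupation_time {a t} \<omega> t) / d"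
    let ?T = "\<lambda>N d. \<integral>\<omega>. ?avg d \<omega> \<partial>trace_process_law n (W N) (P N (\<eta> N))"
    let ?R = "\<lambda>N d. \<Sum>t\<in>I. measure (P N (\<eta> N)) {\<omega> \<in> space (P N (\<eta> N)). \<omega> t \<in> \<Delta> N} + qN N d
        + 2 / d * (\<integral>\<omega>. occupation_time (\<Delta> N) \<omega> (t + d) \<partial>P N (\<eta> N))"
    have est_N: "\<bar>?p N - ?T N d\<bar> \<le> ?R N d" if N: "N \<ge> 1" and d: "0 < d" for N d
    proof -
      interpret C: well_chain "E N" "P N" n "W N" "\<Delta> N" by (rule wc[OF N])
      let ?e = "\<lambda>z y. (\<integral>\<omega>. occupation_time (- W N z) \<omega> d \<partial>P N y) / d"
      have Max0: "0 \<le> Max (?e z ` W N z)" if z: "z \<in> {1..n}" for z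
        using fin_wells(2)[OF N z] nonempty[OF N z] exit_nonneg[OF d] by (subst Max_ge_iff) auto
      show ?thesis
      proof (rule C.fdd_trace_estimate[OF \<eta>E[OF N] I d])
        show "0 \<le> qN N d"
          unfolding qN_def by (intro sum_nonneg Max0)
        fix z y assume z: "z \<in> {1..n}" and y: "y \<in> W N z"
        have "?e z y \<le> Max (?e z ` W N z)"
          using fin_wells(2)[OF N z] y by (intro Max_ge) auto
        also have "\<dots> \<le> qN N d"
          unfolding qN_def using z Max0 by (intro member_le_sum[where f = "\<lambda>z. Max (?e z ` W N z)"]) auto
        finally show "(\<integral>\<omega>. occupation_time (- W N z) \<omega> d \<partial>P N y) \<le> qN N d * d"
          using d by (simp add: pos_divide_le_eq)
      qed
    qed
    have est_X: "\<bar>?pX - (\<integral>\<omega>. ?avg d \<omega> \<partial>PX x)\<bar> \<le> real (card I) * q d" if d: "0 < d" for d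
    proof -
      have q: "(\<integral>\<omega>. occupation_time (- {z}) \<omega> d \<partial>PX z) \<le> q d * d" if z: "z \<in> {1..n}" for z
      proof -
        have "(\<integral>\<omega>. occupation_time (- {z}) \<omega> d \<partial>PX z) / d \<le> q d"
          unfolding q_def using z exit_nonneg[OF d]
          by (intro member_le_sum[where f = "\<lambda>z. (\<integral>\<omega>. occupation_time (- {z}) \<omega> d \<partial>PX z) / d"]) auto
        then show ?thesis
          using d by (simp add: pos_divide_le_eq)
      qed
      \<comment> \<open>For the limit chain every state is good, so the probability of a bad state
        vanishes and only the exit term \<open>q d\<close> remains.\<close>
      have "\<bar>measure (PX x) {\<omega> \<in> space (PX x). \<forall>t\<in>I. \<omega> t \<in> {a t}} - (\<integral>\<omega>. ?avg d \<omega> \<partial>PX x)\<bar>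
          \<le> (\<Sum>t\<in>I. measure (PX x) {\<omega> \<in> space (PX x). \<omega> t \<notin> {1..n}} + q d)"
      proof (rule X.fdd_average_estimate[OF x I d order_refl])
        show "0 \<le> q d"
          unfolding q_def by (intro sum_nonneg exit_nonneg[OF d])
        show "(\<integral>\<omega>. occupation_time (- {a t}) \<omega> d \<partial>PX y) \<le> q d * d" if "y \<in> {1..n}" "y \<in> {a t}" for t y
          using q[OF that(1)] that(2) by simp
        show "(\<integral>\<omega>. occupation_time {a t} \<omega> d \<partial>PX y) \<le> q d * d" if y: "y \<in> {1..n}" "y \<notin> {a t}" for t y
        proof -
          have "(\<integral>\<omega>. occupation_time {a t} \<omega> d \<partial>PX y) \<le> (\<integral>\<omega>. occupation_time (- {y}) \<omega> d \<partial>PX y)"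
            using d y(2) occupation_time_diff_mono[of _ "{1..n}" 0 d "{a t}" "- {y}"]
            by (intro integral_mono X.integrable_occupation_time y(1)) (auto simp: X.space_P[OF y(1)])
          also have "\<dots> \<le> q d * d" by (rule q[OF y(1)])
          finally show ?thesis .
        qed
      qed
      also have "\<dots> = (\<Sum>t\<in>I. q d)"
      proof (rule sum.cong[OF refl])
        fix t assume "t \<in> I"
        then have "{\<omega> \<in> space (PX x). \<omega> t \<notin> {1..n}} = {}"
          using cadlag_paths_range[of _ "{1..n}" t] I(2) X.space_P[OF x] by blast
        then show "measure (PX x) {\<omega> \<in> space (PX x). \<omega> t \<notin> {1..n}} + q d = q d"
          by (simp only: measure_empty add_0_left)
      qed
      finally show ?thesis by simp
    qed
    have "?p \<longlonglongrightarrow> ?pX"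
    proof (rule LIMSEQ_I)
      \<comment> \<open>Three errors, each below \<open>e / 4\<close>: the two replacements of
        values by averages, and the convergence of the averaged quantity for a fixed
        \<open>d\<close>.\<close>
      fix e :: real assume e: "0 < e"
      have "((\<lambda>d. real (card I) * q d) \<longlongrightarrow> 0) (at_right 0)"
        by (rule tendsto_mult_right_zero[OF q_0])
      then have "\<forall>\<^sub>F d in at_right 0. real (card I) * q d < e / 4"
        by (rule order_tendstoD) (use e in simp)
      moreover have "\<forall>\<^sub>F d in at_right 0. (0::real) < d"
        by (rule eventually_at_right_less)
      ultimately have "\<forall>\<^sub>F d in at_right 0. real (card I) * q d < e / 4 \<and> 0 < d"
        by (rule eventually_conj)
      then obtain d where d: "real (card I) * q d < e / 4" "0 < d"
        using eventually_happens'[OF trivial_limit_at_right_real] by blast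
      \<comment> \<open>For fixed \<open>d\<close> the terms involving \<open>\<Delta>\<close>
        vanish despite the factor \<open>2 / d\<close>; what remains is the number of times
        multiplied by \<open>q d\<close>, already below \<open>e / 4\<close>.\<close>
      have "(\<lambda>N. ?R N d) \<longlonglongrightarrow> (\<Sum>t\<in>I. 0 + q d + 2 / d * 0)"
        using I(2) d(2) \<eta>
        by (intro tendsto_sum tendsto_add tendsto_mult tendsto_const at_\<Delta> qN occ_\<Delta>[OF _ x]) auto
      then have "\<forall>\<^sub>F N in sequentially. ?R N d < e / 4"
        by (rule order_tendstoD) (use d(1) in simp)
      moreover have "(\<lambda>N. ?T N d) \<longlonglongrightarrow> (\<integral>\<omega>. ?avg d \<omega> \<partial>PX x)"
        by (rule weak_conv_average[OF trace_conv[OF x] I d(2)]) (use \<eta> in auto)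
      then have "\<forall>\<^sub>F N in sequentially. dist (?T N d) (\<integral>\<omega>. ?avg d \<omega> \<partial>PX x) < e / 4"
        using e by (intro tendstoD) auto
      ultimately have "\<forall>\<^sub>F N in sequentially. norm (?p N - ?pX) < e"
        using eventually_ge_at_top[of "1::nat"]
      proof eventually_elim
        case (elim N)
        then show ?case
          using est_N[OF elim(3) d(2)] est_X[OF d(2)] d(1) unfolding dist_real_def real_norm_def by linarith
      qed
      then show "\<exists>no. \<forall>N\<ge>no. norm (?p N - ?pX) < e"
        by (simp add: eventually_sequentially)
    qed
    moreover have "\<forall>\<^sub>F N in sequentially. ?p N = measure (?L N) {\<omega> \<in> space (?L N). \<forall>t\<in>I. \<omega> t = a t}"
      using eventually_ge_at_top[of "1::nat"]
      by eventually_elim (use well_chain.order_process_law(3)[OF wc \<eta>E I] in simp)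
    ultimately show "(\<lambda>N. measure (?L N) {\<omega> \<in> space (?L N). \<forall>t\<in>I. \<omega> t = a t}) \<longlonglongrightarrow> ?pX"
      by (rule Lim_transform_eventually)
  qed auto
qed

end
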